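(* Let $\varphi:(0,\infty)\to(0,\infty)$ be a weakly increasing function such that $r\mapsto \varphi(r)/r^2$ is weakly decreasing on $(0,\infty)$. Then the following are equivalent: (i) $\displaystyle\int_0^1 \frac{\varphi(r)}{r^2}\,dr<\infty$. (ii) For every Borel set $A\subset\mathbb{R}^2$ with $\mathcal{H}^\varphi(A)>0$, one has $\mathcal{L}^1(p_\theta(A))>0$ for Lebesgue-almost all $\theta\in[0,\pi)$. (iii) $\mathcal{H}^\varphi$ is absolutely continuous with respect to $\mathcal{I}^1$ on Borel sets in $\mathbb{R}^2$; that is, every Borel set $A\subset\mathbb{R}^2$ with $\mathcal{I}^1(A)=0$ satisfies $\mathcal{H}^\varphi(A)=0$.
   Context: For a positive function $\varphi$ on $(0,\infty)$, the Hausdorff measure $\mathcal{H}^\varphi$ of a set $A$ is $$\mathcal{H}^\varphi(A)=\lim_{\epsilon\downarrow 0}\inf\Bigl\{\sum_i\varphi(\operatorname{diam}A_i)\ :\ A\subset\bigcup_i A_i,\ \operatorname{diam}A_i<\epsilon\Bigr\},$$ the infimum being over countable covers; for sets of diameter $0$ one uses $\varphi(0):=\lim_{r\downarrow0}\varphi(r)$, and the empty set contributes $0$. $p_\theta$ denotes the orthogonal projection from $\mathbb{R}^2$ onto the line through the origin making angle $\theta$ with the horizontal axis. $\mathcal{L}^1$ is one-dimensional Lebesgue measure. The integral-geometric measure $\mathcal{I}^1$ on Borel sets $A\subset\mathbb{R}^2$ is $\mathcal{I}^1(A)=\int \#(A\cap\ell)\,d\eta(\ell)$, where $\eta$ is the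 isometry-invariant measure on the space of all lines in $\mathbb{R}^2$ and $\#$ denotes cardinality (possibly $\infty$). Equivalently, up to a normalizing constant, $\mathcal{I}^1(A)=\int_0^\pi\int_{L_\theta}\#\bigl(A\cap p_\theta^{-1}(a)\bigr)\,d\mathcal{L}^1(a)\,d\theta$, where $L_\theta$ is the line onto which $p_\theta$ projects. *)

theory Defs
  imports "HOL-Analysis.Analysis"
begin

section \<open>Hausdorff measures of a gauge function\<close>

text \<open>Only the values of \<open>\<phi>\<close> on \<open>(0,\<infinity>)\<close> are used: for diameter \<open>0\<close> the value is
  \<open>\<phi>(0) := lim \<phi>(r)\<close> as \<open>r \<down> 0\<close>, whatever the term \<open>\<phi> 0\<close> denotes.\<close>

definition gauge_diam :: "(real \<Rightarrow> real) \<Rightarrow> 'a::metric_space set \<Rightarrow> ennreal" where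
  "gauge_diam \<phi> S =
     (if S = {} then 0
      else if diameter S = 0 then ennreal (Lim (at_right 0) \<phi>)
      else ennreal (\<phi> (diameter S)))"

text \<open>Boundedness is required explicitly because \<^const>\<open>diameter\<close> is a real number and has
  no meaningful value on unbounded sets. Finite covers are included, since \<open>C i = {}\<close> is allowed.\<close>

definition hausdorff_pre :: "(real \<Rightarrow> real) \<Rightarrow> real \<Rightarrow> 'a::metric_space set \<Rightarrow> ennreal" where
  "hausdorff_pre \<phi> \<epsilon> A =
     Inf {(\<Sum>i. gauge_diam \<phi> (C i)) | C :: nat \<Rightarrow> 'a set.
            A \<subseteq> (\<Union>i. C i) \<and> (\<forall>i. bounded (C i) \<and> diameter (C i) < \<epsilon>)}"

definition hausdorff :: "(real \<Rightarrow> real) \<Rightarrow> 'a::metric_space set \<Rightarrow> ennreal" where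
  "hausdorff \<phi> A = Lim (at_right 0) (\<lambda>\<epsilon>. hausdorff_pre \<phi> \<epsilon> A)"

lemma hausdorff_pre_antimono: "\<epsilon> \<le> \<delta> \<Longrightarrow> hausdorff_pre \<phi> \<delta> A \<le> hausdorff_pre \<phi> \<epsilon> A"
  unfolding hausdorff_pre_def by (rule Inf_superset_mono) (blast intro: less_le_trans)

lemma hausdorff_limit:
  "((\<lambda>\<epsilon>. hausdorff_pre \<phi> \<epsilon> A) \<longlongrightarrow> (SUP \<epsilon>\<in>{0<..}. hausdorff_pre \<phi> \<epsilon> A)) (at_right 0)"
proof (rule order_tendstoI)
  fix a assume "a < (SUP \<epsilon>\<in>{0<..}. hausdorff_pre \<phi> \<epsilon> A)"
  then obtain \<delta> where d: "\<delta> > 0" "a < hausdorff_pre \<phi> \<delta> A"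
    by (auto simp: less_SUP_iff)
  show "\<forall>\<^sub>F \<epsilon> in at_right 0. a < hausdorff_pre \<phi> \<epsilon> A"
    using eventually_at_right_real[OF d(1)]
    by eventually_elim (use d in \<open>auto intro: less_le_trans[OF _ hausdorff_pre_antimono]\<close>)
next
  fix a assume less: "(SUP \<epsilon>\<in>{0<..}. hausdorff_pre \<phi> \<epsilon> A) < a"
  have "hausdorff_pre \<phi> \<epsilon> A < a" if "\<epsilon> > 0" for \<epsilon>
  proof (rule le_less_trans[OF _ less])
    show "hausdorff_pre \<phi> \<epsilon> A \<le> (SUP \<epsilon>\<in>{0<..}. hausdorff_pre \<phi> \<epsilon> A)"
      using that by (intro SUP_upper) simp
  qed
  then show "\<forall>\<^sub>F \<epsilon> in at_right 0. hausdorff_pre \<phi> \<epsilon> A < a"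
    by (rule eventually_mono[OF eventually_at_right_less])
qed

lemma hausdorff_eq_SUP: "hausdorff \<phi> A = (SUP \<epsilon>\<in>{0<..}. hausdorff_pre \<phi> \<epsilon> A)"
  unfolding hausdorff_def by (rule tendsto_Lim[OF _ hausdorff_limit]) simp

section \<open>Projections onto lines\<close>

definition dir :: "real \<Rightarrow> real^2" where
  "dir \<theta> = vector [cos \<theta>, sin \<theta>]"

definition proj :: "real \<Rightarrow> real^2 \<Rightarrow> real^2" where
  "proj \<theta> x = (x \<bullet> dir \<theta>) *\<^sub>R dir \<theta>"

text \<open>One-dimensional Lebesgue measure on the line spanned by \<open>dir \<theta>\<close>, transported from the real
  line by the isometry \<open>t \<mapsto> t *\<^sub>R dir \<theta>\<close>. The projection of a Borel set is analytic, hence Lebesgue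
  measurable, so the outer measure used here is its Lebesgue measure; it avoids the convention that
  \<^const>\<open>emeasure\<close> is \<open>0\<close> on sets that are not known to be measurable.\<close>

definition L1_on_line :: "real \<Rightarrow> (real^2) set \<Rightarrow> ennreal" where
  "L1_on_line \<theta> S = outer_measure_of lebesgue {t. t *\<^sub>R dir \<theta> \<in> S}"

section \<open>The integral-geometric measure\<close>

definition perp_line :: "real \<Rightarrow> real \<Rightarrow> (real^2) set" where
  "perp_line \<theta> a = proj \<theta> -` {a *\<^sub>R dir \<theta>}"

text \<open>The isometry-invariant measure on the space of all lines (normalized as \<open>da d\<theta>\<close>): every line is
  \<open>perp_line \<theta> a\<close> for exactly one \<open>(\<theta>,a) \<in> [0,\<pi>) \<times> \<real>\<close>, and the measure is the image of Lebesgue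
  measure under this parametrization. Injectivity, which \<^const>\<open>embed_measure\<close> needs in order to be
  the image measure, is proved below.\<close>

definition line_measure :: "(real^2) set measure" where
  "line_measure = embed_measure (lebesgue_on ({0..<pi} \<times> UNIV)) (\<lambda>(\<theta>, a). perp_line \<theta> a)"

definition integral_geometric :: "(real^2) set \<Rightarrow> ennreal" where
  "integral_geometric A = (\<integral>\<^sup>+ l. emeasure (count_space UNIV) (A \<inter> l) \<partial>line_measure)"

lemma inner_dir: "x \<bullet> dir \<theta> = x $ 1 * cos \<theta> + x $ 2 * sin \<theta>"
  by (simp add: dir_def inner_vec_def sum_2)

lemma perp_line_eq: "perp_line \<theta> a = {x. x \<bullet> dir \<theta> = a}"
proof -
  have "dir \<theta> \<bullet> dir \<theta> = 1"
    by (simp add: inner_dir) (simp add: dir_def flip: power2_eq_square)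
  then have "dir \<theta> \<noteq> 0" by force
  then show ?thesis by (auto simp: perp_line_def proj_def)
qed

lemma inj_perp_line: "inj_on (\<lambda>(\<theta>, a). perp_line \<theta> a) ({0..<pi} \<times> UNIV)"
proof (rule inj_onI, clarsimp)
  fix \<theta> a \<theta>' a' :: real
  assume t: "0 \<le> \<theta>" "\<theta> < pi" "0 \<le> \<theta>'" "\<theta>' < pi" and eq: "perp_line \<theta> a = perp_line \<theta>' a'"
  define x :: "real \<Rightarrow> real^2" where
    "x s = vector [a * cos \<theta> - s * sin \<theta>, a * sin \<theta> + s * cos \<theta>]" for s
  have xd: "x s \<bullet> dir \<psi> = a * cos (\<theta> - \<psi>) - s * sin (\<theta> - \<psi>)" for s \<psi>
    by (simp add: inner_dir x_def cos_diff sin_diff algebra_simps)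
  have *: "a * cos (\<theta> - \<theta>') - s * sin (\<theta> - \<theta>') = a'" for s
  proof -
    have "x s \<in> perp_line \<theta> a"
      by (simp add: perp_line_eq xd)
    then have "x s \<in> perp_line \<theta>' a'"
      by (simp only: eq)
    then show ?thesis
      by (simp add: perp_line_eq xd)
  qed
  from *[of 0] *[of 1] have s0: "sin (\<theta> - \<theta>') = 0" by simp
  have "\<theta> = \<theta>'"
  proof (rule ccontr)
    assume "\<theta> \<noteq> \<theta>'"
    then have "\<theta> - \<theta>' > 0 \<or> \<theta>' - \<theta> > 0" by linarith
    then show False
      using sin_gt_zero[of "\<theta> - \<theta>'"] sin_gt_zero[of "\<theta>' - \<theta>"] s0 t sin_minus[of "\<theta> - \<theta>'"]
      by auto
  qed
  with *[of 0] show "\<theta> = \<theta>' \<and> a = a'" by simp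
qed

end

theory Submission
  imports Defs
begin

text \<open>Everything is discretised to dyadic squares: \<open>H\<^sup>\<phi>\<close> has the same null sets as the net content
  with weights \<open>\<phi>(2\<^sup>-\<^sup>k)\<close>, and the integral condition becomes \<open>\<Sum> 2\<^sup>k \<phi>(2\<^sup>-\<^sup>k) < \<infinity>\<close>.

  If the sum converges, a Borel set of positive content contains a compact set of positive content
  (capacitability), which carries discrete Frostman measures at every scale. Their 1-energies are
  bounded by the sum, so the Cauchy-Schwarz inequality, averaged over the directions, bounds the
  lengths of the neighbourhoods of almost all projections from below.

  If the sum diverges, take a random dyadic Cantor set in which the squares of a level keep either
  all four quarters or one random quarter each, such that level \<open>k\<close> has about
  \<open>1 / \<phi>(2\<^sup>-\<^sup>k)\<close> squares. A comparison with electrical networks shows that a fixed line hits the set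
  down to level \<open>n\<close> with probability at most a constant divided by \<open>\<Sum>k\<le>n. 2\<^sup>k \<phi>(2\<^sup>-\<^sup>k)\<close>.
  Averaging over the lines and iterating yields a compact set of positive content that almost no
  line meets.\<close>

section \<open>Dyadic net content\<close>

text \<open>Conditions (ii) and (iii) see only the null sets of \<open>hausdorff \<phi>\<close>, so
  a content with the same null sets may replace it. Dyadic cells are used because two of them are
  nested or disjoint; this yields continuity along increasing sequences, the property capacitability
  rests on, without any sigma-finiteness of \<open>hausdorff \<phi>\<close>. The weight 2^k in the
  series comes from directions: those in which two points at distance r project within s of each
  other have measure of order s/r. So the energy kernel is 1/r, and mass at most \<open>g k\<close>
  on the cells of level k gives energy of order the sum of 2^k \<open>g k\<close>. The two
  monotonicity hypotheses say that \<phi>(2^-k) drops by a factor between 1 and 4 per level. The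
  choices "one quarter" and "four quarters" are the two ends of this range, so such Cantor sets can
  follow every admissible \<phi>. Only the levels that keep one quarter add resistance to the
  network, because a line misses one of the four quarters; the levels that keep all quarters are
  controlled by them through a geometric sum. In either case one compact set settles (ii) and (iii)
  together, since both are read off from the lengths of its projections.\<close>

definition cell :: "nat \<Rightarrow> real^2 \<Rightarrow> int \<times> int" where
  "cell k x = (\<lfloor>2 ^ k * x $ 1\<rfloor>, \<lfloor>2 ^ k * x $ 2\<rfloor>)"

lemma floor_pow2_mult_cong:
  fixes a b :: real
  assumes "\<lfloor>2 ^ k * a\<rfloor> = \<lfloor>2 ^ k * b\<rfloor>" "j \<le> k"
  shows "\<lfloor>2 ^ j * a\<rfloor> = \<lfloor>2 ^ j * b\<rfloor>"
proof -
  have *: "\<lfloor>2 ^ j * c\<rfloor> = \<lfloor>2 ^ k * c\<rfloor> div 2 ^ (k - j)" for c :: real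
  proof -
    have "(2::real) ^ k = 2 ^ j * 2 ^ (k - j)"
      using assms(2) by (simp flip: power_add)
    then have "2 ^ j * c = 2 ^ k * c / real_of_int (2 ^ (k - j))"
      by simp
    then show ?thesis
      by (metis floor_divide_real_eq_div zero_le_numeral zero_le_power)
  qed
  show ?thesis using assms(1) by (simp add: *)
qed

lemma cell_mono: "cell k x = cell k y \<Longrightarrow> j \<le> k \<Longrightarrow> cell j x = cell j y"
  by (auto simp: cell_def intro: floor_pow2_mult_cong)

definition cells :: "(nat \<times> int \<times> int) set \<Rightarrow> (real^2) set" where
  "cells Q = {x. \<exists>k. (k, cell k x) \<in> Q}"

text \<open>Weighing covers by a measure on index pairs, instead of by a sum, makes countable
  subadditivity and continuity from below available for infinite covers.\<close>

definition net_measure :: "(nat \<Rightarrow> real) \<Rightarrow> (nat \<times> int \<times> int) measure" where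
  "net_measure g = density (count_space UNIV) (\<lambda>q. ennreal (g (fst q)))"

text \<open>Cells of all levels compete at once, with no mesh tending to zero: this is a content,
  which shares with the Hausdorff measure only its null sets.\<close>

definition net_content :: "(nat \<Rightarrow> real) \<Rightarrow> (real^2) set \<Rightarrow> ennreal" where
  "net_content g A = (INF Q\<in>{Q. A \<subseteq> cells Q}. emeasure (net_measure g) Q)"

lemma sets_net_measure [simp]: "sets (net_measure g) = UNIV"
  by (simp add: net_measure_def)

lemma net_measure_finite:
  assumes "finite Q"
  shows "emeasure (net_measure g) Q = (\<Sum>q\<in>Q. ennreal (g (fst q)))"
  using assms
  by (simp add: net_measure_def emeasure_density nn_integral_count_space_indicator[symmetric]
      nn_integral_count_space_finite)

lemma net_measure_singleton [simp]: "emeasure (net_measure g) {q} = ennreal (g (fst q))"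
  by (simp add: net_measure_finite)

lemma cells_UN: "cells (\<Union>i\<in>I. Q i) = (\<Union>i\<in>I. cells (Q i))"
  by (auto simp: cells_def)

lemma net_content_le: "A \<subseteq> cells Q \<Longrightarrow> net_content g A \<le> emeasure (net_measure g) Q"
  by (auto simp: net_content_def intro: INF_lower)

lemma net_content_mono: "A \<subseteq> B \<Longrightarrow> net_content g A \<le> net_content g B"
  unfolding net_content_def by (rule INF_superset_mono) auto

lemma net_content_lessE:
  assumes "net_content g A < c"
  obtains Q where "A \<subseteq> cells Q" "emeasure (net_measure g) Q < c"
  using assms unfolding net_content_def by (auto simp: INF_less_iff)

text \<open>The maximal cells of the union of near-optimal covers \<open>Q n\<close> of \<open>A n\<close> cover everything, and
  the maximal cells that come from \<open>Q n\<close> cannot weigh much more than the cells of \<open>Q N\<close> below them,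
  since these could replace them in \<open>Q n\<close>.\<close>

theorem net_content_incseq:
  assumes inc: "incseq A" and le: "\<And>n. net_content g (A n) \<le> c"
  shows "net_content g (\<Union>n. A n) \<le> c"
proof (cases "c = \<infinity>")
  case False
  let ?w = "emeasure (net_measure g)"
  show ?thesis
  proof (rule ennreal_le_epsilon)
    fix e :: real assume e: "e > 0"
    define d where "d n = e * (1/2) ^ Suc n" for n
    have d_pos: "d n > 0" for n using e by (simp add: d_def)
    \<comment> \<open>The remainder \<open>d N\<close> is kept on purpose: it pays for the error of
      the last cover \<open>Q N\<close>, which enters the final estimate once more.\<close>
    have sum_d: "(\<Sum>n\<le>N. d n) \<le> e - d N" for N
    proof (induction N)
      case (Suc N) then show ?case by (simp add: d_def)
    qed (simp add: d_def)
    have "\<exists>Q. A n \<subseteq> cells Q \<and> ?w Q < net_content g (A n) + ennreal (d n)" for n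
    proof -
      have "net_content g (A n) < \<infinity>" using le[of n] False by (auto simp: top.not_eq_extremum intro: le_less_trans)
      then have "net_content g (A n) < net_content g (A n) + ennreal (d n)"
        using d_pos[of n] by (metis ennreal_add_left_cancel_less add.right_neutral ennreal_less_zero_iff infinity_ennreal_def order_less_irrefl)
      then show ?thesis by (meson net_content_lessE)
    qed
    then obtain Q where Q: "\<And>n. A n \<subseteq> cells (Q n)"
      and Qw: "\<And>n. ?w (Q n) < net_content g (A n) + ennreal (d n)" by metis
    have Qfin: "?w (Q n) < \<infinity>" for n using less_le_trans[OF Qw[of n] top_greatest] by simp
    define U where "U = (\<Union>n. Q n)"
    \<comment> \<open>A smaller level means a larger square, so \<open>M\<close> consists of the
      maximal squares of \<open>U\<close>; \<open>P n\<close> then charges each of them to the first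
      cover that contains it.\<close>
    define M where "M = {(k, z) \<in> U. \<forall>j<k. \<forall>x. cell k x = z \<longrightarrow> (j, cell j x) \<notin> U}"
    define P where "P n = {q \<in> M \<inter> Q n. \<forall>m<n. q \<notin> Q m}" for n
    have M_P: "M = (\<Union>n. P n)"
    proof -
      have "q \<in> (\<Union>n. P n)" if "q \<in> M" for q
      proof -
        have ex: "\<exists>n. q \<in> Q n" using that by (auto simp: M_def U_def)
        define n where "n = (LEAST n. q \<in> Q n)"
        have "q \<in> Q n" unfolding n_def by (rule LeastI_ex[OF ex])
        moreover have "q \<notin> Q m" if "m < n" for m using that not_less_Least unfolding n_def by blast
        ultimately have "q \<in> P n" using \<open>q \<in> M\<close> unfolding P_def by blast
        then show ?thesis by blast
      qed
      then show ?thesis by (auto simp: P_def)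
    qed
    have cov: "(\<Union>n. A n) \<subseteq> cells M"
    proof
      fix x assume "x \<in> (\<Union>n. A n)"
      then have ex: "\<exists>k. (k, cell k x) \<in> U"
        using Q by (force simp: cells_def U_def)
      define k where "k = (LEAST k. (k, cell k x) \<in> U)"
      have "(k, cell k x) \<in> U" unfolding k_def by (rule LeastI_ex[OF ex])
      moreover have "(j, cell j y) \<notin> U" if "j < k" "cell k y = cell k x" for j y
        using cell_mono[OF that(2), of j] that(1) not_less_Least[of j "\<lambda>k. (k, cell k x) \<in> U"]
        by (auto simp: k_def)
      ultimately show "x \<in> cells M" by (auto simp: cells_def M_def)
    qed
    have disj: "disjoint_family P"
      unfolding disjoint_family_on_def P_def by (auto) (metis linorder_neqE_nat)
    have part: "?w (\<Union>n\<le>N. P n) \<le> c + ennreal e" for N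
    proof -
      \<comment> \<open>\<open>R n\<close> holds the cells of the last cover that lie inside a cell
        of \<open>P n\<close>. Maximal squares are disjoint, hence so are the families
        \<open>R n\<close>, and together they weigh no more than \<open>Q N\<close>.\<close>
      define R where "R n = {q \<in> Q N. \<exists>x. snd q = cell (fst q) x \<and> (\<exists>k\<le>fst q. (k, cell k x) \<in> P n)}" for n
      have disjR: "disjoint_family R"
      proof -
        have False if qm: "q \<in> R m" and qn: "q \<in> R n" and "m \<noteq> n" for q m n
        proof -
          obtain x k where x: "snd q = cell (fst q) x" "k \<le> fst q" "(k, cell k x) \<in> P m"
            using qm unfolding R_def by blast
          obtain y l where y: "snd q = cell (fst q) y" "l \<le> fst q" "(l, cell l y) \<in> P n"
            using qn unfolding R_def by blast
          have eq: "cell j x = cell j y" if "j \<le> fst q" for j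
            using cell_mono x(1) y(1) that by metis
          have "k = l"
          proof (rule ccontr)
            assume "k \<noteq> l"
            have M1: "(k, cell k x) \<in> M" "(l, cell l y) \<in> M" using x y by (auto simp: P_def)
            then have M2: "(k, cell k x) \<in> U" "(l, cell l y) \<in> U" by (auto simp: M_def)
            from \<open>k \<noteq> l\<close> consider "k < l" | "l < k" by linarith
            then show False
              using M1 M2 eq[OF x(2)] eq[OF y(2)] unfolding M_def by cases fastforce+
          qed
          then have "(k, cell k x) \<in> P n" using y eq[OF x(2)] by simp
          then show False using disj x(3) \<open>m \<noteq> n\<close> by (auto simp: disjoint_family_on_def)
        qed
        then show ?thesis by (auto simp: disjoint_family_on_def)
      qed
      have PR: "?w (P n) \<le> ?w (R n) + ennreal (d n)" if n: "n \<le> N" for n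
      proof -
        have "A n \<subseteq> cells ((Q n - P n) \<union> R n)"
        proof
          fix x assume x: "x \<in> A n"
          show "x \<in> cells ((Q n - P n) \<union> R n)"
          proof (cases "x \<in> cells (P n)")
            case False
            with Q[of n] x show ?thesis by (auto simp: cells_def)
          next
            case True
            then obtain k where k: "(k, cell k x) \<in> P n" by (auto simp: cells_def)
            have "x \<in> A N" using x inc n by (auto simp: incseq_def)
            then obtain l where l: "(l, cell l x) \<in> Q N" using Q[of N] by (auto simp: cells_def)
            \<comment> \<open>The cell of \<open>Q N\<close> around \<open>x\<close> cannot be
              strictly larger than a maximal one, so it lies inside the cell from \<open>P n\<close>
              and may replace it.\<close>
            have "\<not> l < k" using k l by (auto simp: P_def M_def U_def)
            then have "(l, cell l x) \<in> R n"
              using k l True by (auto simp: R_def intro!: exI[of _ x] exI[of _ k])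
            then show ?thesis by (auto simp: cells_def)
          qed
        qed
        then have "net_content g (A n) \<le> ?w ((Q n - P n) \<union> R n)" by (rule net_content_le)
        also have "\<dots> \<le> ?w (Q n - P n) + ?w (R n)" by (rule emeasure_subadditive) auto
        finally have 1: "net_content g (A n) \<le> ?w (Q n - P n) + ?w (R n)" .
        have "?w (Q n) = ?w ((Q n - P n) \<union> P n)"
          by (rule arg_cong[where f="?w"]) (auto simp: P_def)
        also have "\<dots> = ?w (Q n - P n) + ?w (P n)"
          by (rule plus_emeasure[symmetric]) auto
        finally have "?w (Q n - P n) + ?w (P n) \<le> net_content g (A n) + ennreal (d n)"
          using Qw[of n] by simp
        also have "\<dots> \<le> ?w (Q n - P n) + (?w (R n) + ennreal (d n))"
          using 1 by (simp add: add.assoc[symmetric] add_right_mono)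
        finally have "?w (Q n - P n) + ?w (P n) \<le> ?w (Q n - P n) + (?w (R n) + ennreal (d n))" .
        moreover have "?w (Q n - P n) < \<infinity>"
          by (rule le_less_trans[OF emeasure_mono Qfin[of n]]) auto
        ultimately show ?thesis by (auto simp: ennreal_add_left_cancel_le)
      qed
      have "?w (\<Union>n\<le>N. P n) = (\<Sum>n\<le>N. ?w (P n))"
        using disj by (intro sum_emeasure[symmetric]) (auto simp: disjoint_family_on_def)
      also have "\<dots> \<le> (\<Sum>n\<le>N. ?w (R n) + ennreal (d n))"
        by (intro sum_mono PR) auto
      also have "\<dots> = (\<Sum>n\<le>N. ?w (R n)) + ennreal (\<Sum>n\<le>N. d n)"
        using d_pos by (simp add: sum.distrib less_imp_le)
      also have "(\<Sum>n\<le>N. ?w (R n)) = ?w (\<Union>n\<le>N. R n)"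
        using disjR by (intro sum_emeasure) (auto simp: disjoint_family_on_def)
      also have "\<dots> \<le> ?w (Q N)" by (intro emeasure_mono) (auto simp: R_def)
      also have "\<dots> \<le> c + ennreal (d N)"
        using less_imp_le[OF Qw[of N]] add_right_mono[OF le[of N]] by (rule order_trans)
      finally have "?w (\<Union>n\<le>N. P n) \<le> c + (ennreal (d N) + ennreal (\<Sum>n\<le>N. d n))"
        by (simp add: add_right_mono add.assoc)
      also have "ennreal (d N) + ennreal (\<Sum>n\<le>N. d n) = ennreal (d N + (\<Sum>n\<le>N. d n))"
        using d_pos by (intro ennreal_plus[symmetric] sum_nonneg) (auto intro: less_imp_le)
      also have "\<dots> \<le> ennreal e" using sum_d[of N] by (intro ennreal_leI) auto
      finally show ?thesis by (simp add: add_left_mono)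
    qed
    have "net_content g (\<Union>n. A n) \<le> ?w M" by (rule net_content_le[OF cov])
    also have "?w M = ?w (\<Union>N. \<Union>n\<le>N. P n)" unfolding M_P by (rule arg_cong[where f="?w"]) auto
    also have "\<dots> = (SUP N. ?w (\<Union>n\<le>N. P n))"
      by (intro SUP_emeasure_incseq[symmetric] monoI UN_mono) auto
    also have "\<dots> \<le> c + ennreal e" by (intro SUP_least part)
    finally show "net_content g (\<Union>n. A n) \<le> c + ennreal e" .
  qed
qed simp

text \<open>Cells are half-open, so compactness applies only after enlarging each cell to the open
  square \<open>O' q\<close>, which the 3 by 3 block of cells around it covers; this costs the
  factor 9. The complements of the \<open>K n\<close> complete an open cover of \<open>K 0\<close>,
  and since the sequence decreases, a finite subcover already covers one of the
  \<open>K n\<close>.\<close>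

lemma compact_decseq_cells:
  assumes K: "\<And>n. compact (K n)" "decseq K" and cov: "(\<Inter>n. K n) \<subseteq> cells Q"
  obtains n R where "finite R" "K n \<subseteq> cells R"
    "emeasure (net_measure g) R \<le> 9 * emeasure (net_measure g) Q"
proof -
  define blk :: "nat \<times> int \<times> int \<Rightarrow> (nat \<times> int \<times> int) set" where
    "blk = (\<lambda>(k, a, b). {k} \<times> {a-1..a+1} \<times> {b-1..b+1})"
  define O' :: "nat \<times> int \<times> int \<Rightarrow> (real^2) set" where
    "O' = (\<lambda>(k, a, b). {x. of_int a - 1 < 2^k * x$1} \<inter> {x. 2^k * x$1 < of_int a + 2}
       \<inter> {x. of_int b - 1 < 2^k * x$2} \<inter> {x. 2^k * x$2 < of_int b + 2})"
  have op: "open (O' q)" for q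
    unfolding O'_def split_def by (intro open_Int open_Collect_less continuous_intros)
  have O1: "cells {q} \<subseteq> O' q" for q
  proof (cases q)
    case (fields k a b)
    show ?thesis unfolding fields O'_def by (auto simp: cells_def cell_def) linarith+
  qed
  have O2: "O' q \<subseteq> cells (blk q)" for q
  proof (cases q)
    case (fields k a b)
    show ?thesis unfolding fields O'_def blk_def by (auto simp: cells_def cell_def floor_le_iff le_floor_iff)
  qed
  have Kc: "closed (K n)" for n using K(1) by (rule compact_imp_closed)
  have "K 0 \<subseteq> \<Union> (O' ` Q \<union> range (\<lambda>n. - K n))"
  proof
    fix x assume "x \<in> K 0"
    show "x \<in> \<Union> (O' ` Q \<union> range (\<lambda>n. - K n))"
    proof (cases "x \<in> (\<Inter>n. K n)")
      case True
      then obtain k where "(k, cell k x) \<in> Q" using cov by (auto simp: cells_def)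
      moreover have "x \<in> O' (k, cell k x)" using O1[of "(k, cell k x)"] by (auto simp: cells_def)
      ultimately show ?thesis by blast
    qed auto
  qed
  moreover have "\<And>S. S \<in> O' ` Q \<union> range (\<lambda>n. - K n) \<Longrightarrow> open S" using op Kc by auto
  ultimately obtain D where D: "D \<subseteq> O' ` Q \<union> range (\<lambda>n. - K n)" "finite D" "K 0 \<subseteq> \<Union> D"
    using compactE[OF K(1)[of 0]] by metis
  obtain Q' where Q': "Q' \<subseteq> Q" "finite Q'" "D \<inter> O' ` Q = O' ` Q'"
    using finite_subset_image[of "D \<inter> O' ` Q" O' Q] D(2) by auto
  obtain I where I: "finite I" "D \<inter> range (\<lambda>n. - K n) = (\<lambda>n. - K n) ` I"
    using finite_subset_image[of "D \<inter> range (\<lambda>n. - K n)" "\<lambda>n. - K n" UNIV] D(2) by auto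
  define n where "n = Max (insert 0 I)"
  have "K n \<subseteq> K i" if "i \<in> insert 0 I" for i
    using K(2) I(1) that unfolding n_def decseq_def by (metis Max_ge finite.insertI)
  then have n: "K n \<subseteq> K 0" "\<And>i. i \<in> I \<Longrightarrow> K n \<subseteq> K i" by auto
  have "K n \<subseteq> (\<Union>q\<in>Q'. O' q)"
  proof
    fix x assume x: "x \<in> K n"
    then obtain S where S: "S \<in> D" "x \<in> S" using D(3) n by blast
    have "S \<notin> range (\<lambda>n. - K n)"
    proof
      assume "S \<in> range (\<lambda>n. - K n)"
      then have "S \<in> (\<lambda>n. - K n) ` I" using S I by blast
      then show False using S(2) n(2) x by blast
    qed
    then have "S \<in> O' ` Q'" using S D(1) Q'(3) by blast
    then show "x \<in> (\<Union>q\<in>Q'. O' q)" using S by blast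
  qed
  also have "\<dots> \<subseteq> cells (\<Union>q\<in>Q'. blk q)" unfolding cells_UN by (intro UN_mono O2) simp
  finally have Kn: "K n \<subseteq> cells (\<Union>q\<in>Q'. blk q)" .
  have w: "emeasure (net_measure g) (blk q) = 9 * ennreal (g (fst q))" for q
  proof (cases q)
    case (fields k a b)
    have "finite (blk q)" "card (blk q) = 9" "\<And>p. p \<in> blk q \<Longrightarrow> fst p = k"
      by (auto simp: fields blk_def)
    then show ?thesis by (simp add: net_measure_finite fields)
  qed
  have "emeasure (net_measure g) (\<Union>q\<in>Q'. blk q) \<le> (\<Sum>q\<in>Q'. emeasure (net_measure g) (blk q))"
    using Q'(2) by (intro emeasure_subadditive_finite) auto
  also have "\<dots> = 9 * emeasure (net_measure g) Q'"
    using Q'(2) by (simp add: w net_measure_finite sum_distrib_left)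
  also have "\<dots> \<le> 9 * emeasure (net_measure g) Q"
    using Q'(1) by (intro mult_left_mono emeasure_mono) auto
  finally show ?thesis
    using that[OF _ Kn] Q'(2) by (auto simp: blk_def split: prod.splits)
qed

section \<open>Suslin representation of Borel sets\<close>

text \<open>The Suslin operation on closed sets. Finite index sequences are encoded as functions of
  which \<open>F n\<close> reads only the first \<open>n\<close> values.\<close>

definition suslin_scheme :: "(nat \<Rightarrow> (nat \<Rightarrow> nat) \<Rightarrow> 'a::topological_space set) \<Rightarrow> 'a set \<Rightarrow> bool" where
  "suslin_scheme F A \<longleftrightarrow> (\<forall>n f. closed (F n f)) \<and>
     (\<forall>n f g. (\<forall>i<n. f i = g i) \<longrightarrow> F n f = F n g) \<and> A = {x. \<exists>f. \<forall>n. x \<in> F n f}"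

definition suslin :: "'a::topological_space set \<Rightarrow> bool" where
  "suslin A \<longleftrightarrow> (\<exists>F. suslin_scheme F A)"

lemma suslin_schemeD:
  assumes "suslin_scheme F A"
  shows "closed (F n f)" "(\<forall>i<n. f i = g i) \<Longrightarrow> F n f = F n g" "A = {x. \<exists>f. \<forall>n. x \<in> F n f}"
  using assms unfolding suslin_scheme_def by blast+

lemma suslin_closed: "closed A \<Longrightarrow> suslin A"
  unfolding suslin_def suslin_scheme_def by (rule exI[of _ "\<lambda>_ _. A"]) auto

lemma suslin_UN:
  fixes A :: "nat \<Rightarrow> 'a::topological_space set"
  assumes "\<And>i. suslin (A i)"
  shows "suslin (\<Union>i. A i)"
proof -
  obtain F where "\<forall>i. suslin_scheme (F i) (A i)"
    using assms unfolding suslin_def by metis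
  then have F: "\<And>i. suslin_scheme (F i) (A i)" ..
  note F = suslin_schemeD[OF F]
  define G where "G n f = (case n of 0 \<Rightarrow> UNIV | Suc m \<Rightarrow> F (f 0) m (\<lambda>i. f (Suc i)))" for n f
  have "closed (G n f)" for n f by (auto simp: G_def F split: nat.splits)
  moreover have "G n f = G n g" if "\<forall>i<n. f i = g i" for n f g
  proof (cases n)
    case (Suc m)
    then have "F (f 0) m (\<lambda>i. f (Suc i)) = F (f 0) m (\<lambda>i. g (Suc i))" using that by (intro F(2)) auto
    then show ?thesis using that Suc by (simp add: G_def)
  qed (simp add: G_def)
  moreover have "(\<Union>i. A i) = {x. \<exists>f. \<forall>n. x \<in> G n f}"
  proof (intro set_eqI iffI)
    fix x assume "x \<in> (\<Union>i. A i)"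
    then obtain i f where "\<forall>n. x \<in> F i n f" by (auto simp: F(3))
    then have "\<forall>n. x \<in> G n (case_nat i f)" by (auto simp: G_def split: nat.splits)
    then show "x \<in> {x. \<exists>f. \<forall>n. x \<in> G n f}" by blast
  next
    fix x assume "x \<in> {x. \<exists>f. \<forall>n. x \<in> G n f}"
    then obtain f where f: "\<And>n. x \<in> G n f" by blast
    have "x \<in> F (f 0) n (\<lambda>i. f (Suc i))" for n using f[of "Suc n"] by (simp add: G_def)
    then show "x \<in> (\<Union>i. A i)" by (auto simp: F(3))
  qed
  ultimately show ?thesis unfolding suslin_def suslin_scheme_def by blast
qed

text \<open>Countably many branches are interleaved into one by \<open>prod_encode\<close>. The set
  \<open>F i n\<close> is imposed at stage \<open>N\<close> only when every coordinate it reads lies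
  below \<open>N\<close>, which is what \<open>I N\<close> expresses.\<close>

lemma suslin_INT:
  fixes A :: "nat \<Rightarrow> 'a::topological_space set"
  assumes "\<And>i. suslin (A i)"
  shows "suslin (\<Inter>i. A i)"
proof -
  obtain F where "\<forall>i. suslin_scheme (F i) (A i)"
    using assms unfolding suslin_def by metis
  then have F: "\<And>i. suslin_scheme (F i) (A i)" ..
  note F = suslin_schemeD[OF F]
  define I where "I N = {(i, n). \<forall>m<n. prod_encode (i, m) < N}" for N
  define G where "G N f = (\<Inter>(i, n)\<in>I N. F i n (\<lambda>m. f (prod_encode (i, m))))" for N f
  have "closed (G n f)" for n f by (auto simp: G_def F split: prod.splits)
  moreover have "G n f = G n g" if "\<forall>i<n. f i = g i" for n f g
  proof -
    have "F i k (\<lambda>m. f (prod_encode (i, m))) = F i k (\<lambda>m. g (prod_encode (i, m)))"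
      if "(i, k) \<in> I n" for i k using that \<open>\<forall>i<n. f i = g i\<close> by (intro F(2)) (auto simp: I_def)
    then show ?thesis unfolding G_def by auto
  qed
  moreover have "(\<Inter>i. A i) = {x. \<exists>f. \<forall>n. x \<in> G n f}"
  proof (intro set_eqI iffI)
    fix x assume "x \<in> (\<Inter>i. A i)"
    then have "\<forall>i. \<exists>f. \<forall>n. x \<in> F i n f" by (auto simp: F(3))
    from choice[OF this] obtain f where f: "\<And>i n. x \<in> F i n (f i)" by blast
    have "\<forall>n. x \<in> G n (\<lambda>m. case prod_decode m of (i, j) \<Rightarrow> f i j)" using f by (auto simp: G_def)
    then show "x \<in> {x. \<exists>f. \<forall>n. x \<in> G n f}" by blast
  next
    fix x assume "x \<in> {x. \<exists>f. \<forall>n. x \<in> G n f}"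
    then obtain f where f: "\<And>n. x \<in> G n f" by blast
    have "x \<in> F i n (\<lambda>m. f (prod_encode (i, m)))" for i n
    proof -
      define N where "N = Suc (\<Sum>m<n. prod_encode (i, m))"
      have "(i, n) \<in> I N" unfolding I_def N_def by (auto intro!: member_le_sum simp: less_Suc_eq_le)
      then show ?thesis using f[of N] by (auto simp: G_def)
    qed
    then show "x \<in> (\<Inter>i. A i)" by (auto simp: F(3))
  qed
  ultimately show ?thesis unfolding suslin_def suslin_scheme_def by blast
qed

lemma suslin_open:
  fixes A :: "'a::euclidean_space set"
  assumes "open A" shows "suslin A"
proof -
  obtain C :: "nat \<Rightarrow> 'a set" where C: "\<And>n. compact (C n)" "\<Union> (range C) = A"
    using open_Union_compact_subsets[OF assms] by metis
  show ?thesis unfolding C(2)[symmetric] by (intro suslin_UN suslin_closed compact_imp_closed C)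
qed

text \<open>Suslin sets are not closed under complements, so the induction over the Borel sets
  carries a set together with its complement.\<close>

lemma suslin_borel:
  fixes A :: "'a::euclidean_space set"
  assumes "A \<in> sets borel" shows "suslin A"
proof -
  have "A \<in> sigma_sets UNIV {S. open S}" using assms by (simp add: borel_def)
  then have "suslin A \<and> suslin (- A)"
  proof (induction rule: sigma_sets.induct)
    case (Basic a) then show ?case by (auto intro: suslin_open suslin_closed)
  next
    case Empty then show ?case by (auto intro: suslin_closed)
  next
    case (Compl a) then show ?case by (simp add: Compl_eq_Diff_UNIV[symmetric])
  next
    case (Union a) then show ?case by (auto intro: suslin_UN suslin_INT simp: Compl_UN)
  qed
  then show ?thesis ..
qed

text \<open>Coordinate \<open>k\<close> is fixed at step \<open>k\<close> and never altered later,
  so the diagonal agrees with the \<open>k\<close>-th approximation on its first \<open>k\<close>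
  values.\<close>

lemma prefix_choice:
  fixes P :: "nat \<Rightarrow> (nat \<Rightarrow> nat) \<Rightarrow> bool"
  assumes "P 0 f0" and step: "\<And>k g. P k g \<Longrightarrow> \<exists>j. P (Suc k) (g(k := j))"
    and local: "\<And>k f g. (\<forall>i<k. f i = g i) \<Longrightarrow> P k f \<Longrightarrow> P k g"
  obtains f where "\<And>k. P k f"
proof -
  have "\<exists>H. \<forall>k. P k (H k) \<and> (\<exists>j. H (Suc k) = (H k)(k := j))"
    by (rule dependent_nat_choice) (use assms(1) step in blast)+
  then obtain H where H: "\<And>k. P k (H k)" "\<And>k. \<exists>j. H (Suc k) = (H k)(k := j)" by blast
  have stable: "H (Suc i + m) i = H (Suc i) i" for i m
  proof (induction m)
    case (Suc m)
    then show ?case using H(2)[of "Suc i + m"] by auto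
  qed simp
  have eq: "H k i = H (Suc i) i" if "i < k" for i k using stable[of i "k - Suc i"] that by simp
  have "P k (\<lambda>i. H (Suc i) i)" for k
    by (rule local[OF _ H(1)[of k]]) (use eq in blast)
  then show ?thesis by (rule that)
qed

text \<open>Koenig's lemma for a finitely branching tree: a prefix is kept if it extends to every
  level. If no value at coordinate \<open>k\<close> preserved this, a level beyond the finitely many
  failures for the values up to \<open>h k\<close> would contradict it.\<close>

lemma koenig_bounded:
  fixes V :: "nat \<Rightarrow> (nat \<Rightarrow> nat) \<Rightarrow> bool"
  assumes ex: "\<And>n. \<exists>f. V n f" and dec: "\<And>m n f. V n f \<Longrightarrow> m \<le> n \<Longrightarrow> V m f"
    and local: "\<And>k f g. (\<forall>i<k. f i = g i) \<Longrightarrow> V k f \<Longrightarrow> V k g"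
    and bound: "\<And>n f i. V n f \<Longrightarrow> i < n \<Longrightarrow> f i \<le> h i"
  obtains f where "\<And>n. V n f"
proof -
  define P where "P k g \<longleftrightarrow> (\<forall>n\<ge>k. \<exists>f. V n f \<and> (\<forall>i<k. f i = g i))" for k g
  have step: "\<exists>j. P (Suc k) (g(k := j))" if P: "P k g" for k g
  proof (rule ccontr)
    assume "\<not> ?thesis"
    then have "\<forall>j. \<exists>n\<ge>Suc k. \<forall>f. V n f \<longrightarrow> \<not> (\<forall>i<Suc k. f i = (g(k := j)) i)"
      unfolding P_def by blast
    from choice[OF this] obtain n where "\<forall>j. n j \<ge> Suc k \<and> (\<forall>f. V (n j) f \<longrightarrow> \<not> (\<forall>i<Suc k. f i = (g(k := j)) i))" ..
    then have n: "\<And>j. n j \<ge> Suc k"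
      "\<And>j f. V (n j) f \<Longrightarrow> \<not> (\<forall>i<Suc k. f i = (g(k := j)) i)" by blast+
    define m where "m = Max (n ` {..h k})"
    have nm: "n j \<le> m" if "j \<le> h k" for j using that unfolding m_def by auto
    have km: "k < m" using nm[of 0] n(1)[of 0] by simp
    with P obtain f where f: "V m f" "\<forall>i<k. f i = g i" unfolding P_def by (meson less_imp_le)
    have "f k \<le> h k" using bound[OF f(1) km] .
    then have "V (n (f k)) f" using dec[OF f(1) nm] by blast
    from n(2)[OF this] f(2) show False by (auto simp: less_Suc_eq)
  qed
  have "P 0 (\<lambda>_. 0)" using ex by (auto simp: P_def)
  moreover have "P k g'" if "\<forall>i<k. g i = g' i" "P k g" for k g g' using that by (simp add: P_def)
  ultimately obtain f where f: "\<And>k. P k f"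
    using prefix_choice[of P "\<lambda>_. 0"] step by blast
  have "V n f" for n
  proof -
    obtain f' where "V n f'" "\<forall>i<n. f' i = f i" using f[of n] unfolding P_def by blast
    then show ?thesis using local[of n f' f] by simp
  qed
  then show ?thesis by (rule that)
qed

text \<open>Choquet's capacitability argument; the net content is not continuous from above along
  compact sets, but it drops by a factor of at most 9.\<close>

theorem net_content_compact_subset:
  assumes A: "A \<in> sets borel" and pos: "net_content g A > 0"
  obtains K where "compact K" "K \<subseteq> A" "net_content g K > 0"
proof -
  obtain c where c: "0 < c" "c < net_content g A" using dense[OF pos] by blast
  \<comment> \<open>Cutting with a large ball turns the closed sets of the scheme into compact ones;
    continuity along increasing sequences preserves content above \<open>c\<close>.\<close>
  have "\<exists>N::nat. c < net_content g (A \<inter> cball 0 (real N))"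
  proof (rule ccontr)
    assume "\<not> ?thesis"
    then have "net_content g (\<Union>N::nat. A \<inter> cball 0 (real N)) \<le> c"
      by (intro net_content_incseq monoI) (auto simp: not_less)
    moreover have "(\<Union>N::nat. A \<inter> cball 0 (real N)) = A"
      using real_arch_simple by (auto simp: dist_norm)
    ultimately show False using c by simp
  qed
  then obtain N :: nat where N: "c < net_content g (A \<inter> cball 0 (real N))" by blast
  define B :: "(real^2) set" where "B = cball 0 (real N)"
  obtain F where "suslin_scheme F A"
    using suslin_borel[OF A] unfolding suslin_def by blast
  note F = suslin_schemeD[OF this]
  define G where "G n f = B \<inter> (\<Inter>m\<le>n. F m f)" for n f
  have G_comp: "compact (G n f)" for n f
    unfolding G_def B_def by (intro compact_Int_closed closed_INT ballI F) auto
  have G_local: "G n f = G n g" if "\<forall>i<n. f i = g i" for n f g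
  proof -
    have "F m f = F m g" if "m \<le> n" for m using \<open>\<forall>i<n. f i = g i\<close> that by (intro F(2)) auto
    then show ?thesis unfolding G_def by auto
  qed
  have G_dec: "G n f \<subseteq> G m f" if "m \<le> n" for m n f using that by (auto simp: G_def)
  have AB: "x \<in> A \<inter> B \<longleftrightarrow> (\<exists>f. \<forall>n. x \<in> G n f)" for x unfolding F(3) G_def by auto
  \<comment> \<open>Only the first \<open>k\<close> entries of a branch are bounded by
    \<open>h\<close>. Letting the next bound grow exhausts \<open>S k h\<close>, so some finite
    bound keeps the content above \<open>c\<close>.\<close>
  define S where "S k h = {x. \<exists>f. (\<forall>i<k. f i \<le> h i) \<and> (\<forall>n. x \<in> G n f)}" for k and h :: "nat \<Rightarrow> nat"
  have "S 0 h = A \<inter> B" for h using AB by (auto simp: S_def)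
  then have S0: "c < net_content g (S 0 (\<lambda>_. 0))" using N by (simp add: B_def)
  have step: "\<exists>j. c < net_content g (S (Suc k) (h(k := j)))" if "c < net_content g (S k h)" for k h
  proof (rule ccontr)
    assume "\<not> ?thesis"
    then have "net_content g (\<Union>j. S (Suc k) (h(k := j))) \<le> c"
    proof (intro net_content_incseq monoI)
      show "S (Suc k) (h(k := a)) \<subseteq> S (Suc k) (h(k := b))" if "a \<le> b" for a b
        using that by (auto simp: S_def less_Suc_eq) (metis order_trans)
    qed (simp add: not_less)
    moreover have "S k h \<subseteq> (\<Union>j. S (Suc k) (h(k := j)))"
    proof
      fix x assume "x \<in> S k h"
      then obtain f where "(\<forall>i<k. f i \<le> h i)" "(\<forall>n. x \<in> G n f)" by (auto simp: S_def)
      then have "x \<in> S (Suc k) (h(k := f k))" by (auto simp: S_def less_Suc_eq intro!: exI[of _ f])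
      then show "x \<in> (\<Union>j. S (Suc k) (h(k := j)))" by blast
    qed
    ultimately show False using that net_content_mono[of "S k h" "\<Union>j. S (Suc k) (h(k := j))" g] by auto
  qed
  have S_local: "S k f = S k h" if "\<forall>i<k. f i = h i" for k f h using that by (auto simp: S_def)
  obtain h where h: "\<And>k. c < net_content g (S k h)"
    using prefix_choice[of "\<lambda>k h. c < net_content g (S k h)" "\<lambda>_. 0", OF S0 step] S_local by metis
  \<comment> \<open>\<open>K k\<close> forgets the tail of the branch. This makes it a finite union
    of compact sets that contains \<open>S k h\<close>, and Koenig's lemma recovers a full branch in
    the intersection.\<close>
  define K where "K k = (\<Union>f\<in>{f. \<forall>i<k. f i \<le> h i}. G k f)" for k
  have K_comp: "compact (K k)" for k
  proof -
    have "K k = (\<Union>f\<in>Pi\<^sub>E {..<k} (\<lambda>i. {..h i}). G k f)"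
    proof (intro equalityI subsetI)
      fix x assume "x \<in> K k"
      then obtain f where f: "\<forall>i<k. f i \<le> h i" "x \<in> G k f" by (auto simp: K_def)
      then have "x \<in> G k (restrict f {..<k})" using G_local[of k f "restrict f {..<k}"] by simp
      moreover have "restrict f {..<k} \<in> Pi\<^sub>E {..<k} (\<lambda>i. {..h i})" using f by auto
      ultimately show "x \<in> (\<Union>f\<in>Pi\<^sub>E {..<k} (\<lambda>i. {..h i}). G k f)" by blast
    next
      fix x assume "x \<in> (\<Union>f\<in>Pi\<^sub>E {..<k} (\<lambda>i. {..h i}). G k f)"
      then obtain f where "f \<in> Pi\<^sub>E {..<k} (\<lambda>i. {..h i})" "x \<in> G k f" by blast
      then show "x \<in> K k" unfolding K_def by (intro UN_I[of f]) (auto simp: PiE_iff)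
    qed
    moreover have "finite (Pi\<^sub>E {..<k} (\<lambda>i. {..h i}))" by (intro finite_PiE) auto
    ultimately show ?thesis using G_comp by (simp add: compact_UN)
  qed
  have K_dec: "decseq K"
  proof (rule decseq_SucI)
    fix k show "K (Suc k) \<subseteq> K k" unfolding K_def by (rule UN_mono) (use G_dec[of k "Suc k"] in auto)
  qed
  have SK: "S k h \<subseteq> K k" for k by (auto simp: S_def K_def)
  have KA: "(\<Inter>k. K k) \<subseteq> A"
  proof
    fix x assume "x \<in> (\<Inter>k. K k)"
    then have ex: "\<exists>f. (\<forall>i<n. f i \<le> h i) \<and> x \<in> G n f" for n by (auto simp: K_def)
    obtain f where "\<And>n. (\<forall>i<n. f i \<le> h i) \<and> x \<in> G n f"
    proof (rule koenig_bounded[of "\<lambda>n f. (\<forall>i<n. f i \<le> h i) \<and> x \<in> G n f" h, OF ex])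
      show "(\<forall>i<m. f i \<le> h i) \<and> x \<in> G m f" if "(\<forall>i<n. f i \<le> h i) \<and> x \<in> G n f" "m \<le> n" for m n f
        using that G_dec[OF that(2), of f] by auto
      show "(\<forall>i<k. g i \<le> h i) \<and> x \<in> G k g" if "\<forall>i<k. f i = g i" "(\<forall>i<k. f i \<le> h i) \<and> x \<in> G k f" for k f g
        using that G_local[OF that(1)] by auto
    qed auto
    then show "x \<in> A" using AB by blast
  qed
  have "net_content g (\<Inter>k. K k) > 0"
  proof (rule ccontr)
    assume "\<not> ?thesis"
    \<comment> \<open>A cover of weight below \<open>c / 9\<close> would give some
      \<open>K n\<close> a cover of weight at most \<open>c\<close>, after the loss of the factor 9,
      although every \<open>K n\<close> has content above \<open>c\<close>.\<close>
    then have "net_content g (\<Inter>k. K k) < c / 9" using c(1)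
      by (simp add: ennreal_zero_less_divide not_less)
    then obtain Q where Q: "(\<Inter>k. K k) \<subseteq> cells Q" "emeasure (net_measure g) Q < c / 9"
      by (rule net_content_lessE)
    obtain n R where R: "K n \<subseteq> cells R" "emeasure (net_measure g) R \<le> 9 * emeasure (net_measure g) Q"
      using compact_decseq_cells[OF K_comp K_dec Q(1)] by metis
    have "c < net_content g (K n)" using h[of n] net_content_mono[OF SK] by (rule less_le_trans)
    also have "\<dots> \<le> 9 * emeasure (net_measure g) Q" using net_content_le[OF R(1)] R(2) by (rule order_trans)
    also have "\<dots> \<le> 9 * (c / 9)" using Q(2) by (intro mult_left_mono) auto
    also have "\<dots> = c" by (simp add: ennreal_times_divide ennreal_mult_divide_eq mult.commute)
    finally show False by simp
  qed
  moreover have "compact (\<Inter>k. K k)" using K_comp by (auto intro!: compact_Inter)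
  ultimately show ?thesis using that KA by blast
qed

section \<open>Gauge functions\<close>

locale gauge =
  fixes \<phi> :: "real \<Rightarrow> real"
  assumes pos: "\<And>r. r > 0 \<Longrightarrow> \<phi> r > 0"
    and incr: "mono_on {0<..} \<phi>"
    and decr: "antimono_on {0<..} (\<lambda>r. \<phi> r / r\<^sup>2)"
begin

definition dyad :: "nat \<Rightarrow> real" where "dyad k = \<phi> ((1/2) ^ k)"

lemma phi_mono: "0 < r \<Longrightarrow> r \<le> s \<Longrightarrow> \<phi> r \<le> \<phi> s"
  using incr by (auto simp: mono_on_def)

lemma phi_quot_antimono: "0 < r \<Longrightarrow> r \<le> s \<Longrightarrow> \<phi> s / s\<^sup>2 \<le> \<phi> r / r\<^sup>2"
  using decr by (auto simp: monotone_on_def)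

lemma phi_double: "0 < r \<Longrightarrow> \<phi> (2 * r) \<le> 4 * \<phi> r"
  using phi_quot_antimono[of r "2 * r"] by (simp add: field_simps power2_eq_square)

lemma dyad_pos: "dyad k > 0"
  by (simp add: dyad_def pos)

lemma dyad_antimono: "j \<le> k \<Longrightarrow> dyad k \<le> dyad j"
  unfolding dyad_def by (intro phi_mono) (auto intro: power_decreasing)

lemma dyad_le_4_Suc: "dyad k \<le> 4 * dyad (Suc k)"
  using phi_double[of "(1/2) ^ Suc k"] by (simp add: dyad_def)

lemma phi_tendsto: "(\<phi> \<longlongrightarrow> (INF r\<in>{0<..}. \<phi> r)) (at_right 0)"
proof -
  have bdd: "bdd_below (\<phi> ` {0<..})" using pos by (auto intro!: bdd_belowI[of _ 0] less_imp_le)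
  show ?thesis
  proof (rule order_tendstoI)
    fix a assume a: "a < (INF r\<in>{0<..}. \<phi> r)"
    have "a < \<phi> r" if "r > 0" for r
      using a cINF_lower[OF bdd, of r] that by simp
    then show "\<forall>\<^sub>F r in at_right 0. a < \<phi> r"
      by (rule eventually_mono[OF eventually_at_right_less])
  next
    fix a assume "(INF r\<in>{0<..}. \<phi> r) < a"
    then obtain s where s: "s > 0" "\<phi> s < a" using cINF_less_iff[OF _ bdd, of a] by auto
    show "\<forall>\<^sub>F r in at_right 0. \<phi> r < a"
      using eventually_at_right_real[OF s(1)]
    proof eventually_elim
      case (elim r)
      then show ?case using phi_mono[of r s] s(2) by simp
    qed
  qed
qed

lemma Lim_phi: "Lim (at_right 0) \<phi> = (INF r\<in>{0<..}. \<phi> r)"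
  by (rule tendsto_Lim[OF _ phi_tendsto]) simp

lemma Lim_phi_le: "0 < r \<Longrightarrow> Lim (at_right 0) \<phi> \<le> \<phi> r"
  unfolding Lim_phi using pos by (intro cINF_lower bdd_belowI[of _ 0]) (auto intro: less_imp_le)

lemma Lim_phi_nonneg: "0 \<le> Lim (at_right 0) \<phi>"
  unfolding Lim_phi using pos by (intro cINF_greatest) (auto intro: less_imp_le)

lemma gauge_diam_le:
  assumes "bounded S" "diameter S \<le> d" "0 < d"
  shows "gauge_diam \<phi> S \<le> ennreal (\<phi> d)"
proof (cases "diameter S = 0")
  case True
  then show ?thesis using Lim_phi_le[OF assms(3)] by (auto simp: gauge_diam_def intro: ennreal_leI)
next
  case False
  then have "0 < diameter S" using diameter_ge_0[OF assms(1)] by simp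
  then show ?thesis using assms(2) by (auto simp: gauge_diam_def intro!: ennreal_leI phi_mono)
qed

end

section \<open>Comparison of the net content with the Hausdorff measure\<close>

lemma cell_dist:
  assumes "cell k x = cell k y" shows "norm (x - y) \<le> 2 * (1/2) ^ k"
proof -
  have *: "\<bar>a - b\<bar> \<le> (1/2) ^ k" if "\<lfloor>2 ^ k * a\<rfloor> = \<lfloor>2 ^ k * b\<rfloor>" for a b :: real
  proof -
    have "\<bar>2 ^ k * a - 2 ^ k * b\<bar> \<le> 1" using that by linarith
    then have "2 ^ k * \<bar>a - b\<bar> \<le> 1" by (simp add: abs_mult flip: right_diff_distrib)
    then show ?thesis by (simp add: field_simps)
  qed
  have "norm (x - y) \<le> \<bar>(x - y) $ 1\<bar> + \<bar>(x - y) $ 2\<bar>"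
    using norm_le_l1_cart[of "x - y"] by (simp add: sum_2)
  also have "\<dots> \<le> (1/2) ^ k + (1/2) ^ k"
    using assms by (intro add_mono) (auto simp: cell_def intro: *)
  finally show ?thesis by simp
qed

definition near_cells :: "int \<times> int \<Rightarrow> (int \<times> int) set" where
  "near_cells = (\<lambda>(a, b). {a-1..a+1} \<times> {b-1..b+1})"

lemma near_cells: "finite (near_cells z)" "card (near_cells z) = 9"
  by (auto simp: near_cells_def split: prod.splits)

lemma cell_near:
  assumes "norm (x - y) \<le> (1/2) ^ k" shows "cell k y \<in> near_cells (cell k x)"
proof -
  have "\<bar>(x - y) $ i\<bar> \<le> (1/2) ^ k" for i using component_le_norm_cart[of "x - y" i] assms by linarith
  then have "2 ^ k * \<bar>(x - y) $ i\<bar> \<le> 1" for i by (simp add: field_simps)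
  then have "\<bar>2 ^ k * x $ i - 2 ^ k * y $ i\<bar> \<le> 1" for i
    by (simp add: abs_mult flip: right_diff_distrib)
  from this[of 1] this[of 2] show ?thesis
    by (auto simp: cell_def near_cells_def) linarith+
qed

lemma cells_cover_small:
  assumes "bounded S" "diameter S \<le> (1/2) ^ k"
  obtains Q where "S \<subseteq> cells Q" "emeasure (net_measure g) Q \<le> 9 * ennreal (g k)"
proof (cases "S = {}")
  case True
  then show ?thesis using that[of "{}"] by simp
next
  case False
  then obtain x where x: "x \<in> S" by blast
  define Q where "Q = {k} \<times> near_cells (cell k x)"
  have "S \<subseteq> cells Q"
  proof
    fix y assume y: "y \<in> S"
    have "norm (x - y) \<le> (1/2) ^ k"
      using diameter_bounded_bound[OF assms(1) x y] assms(2) by (simp add: dist_norm)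
    then show "y \<in> cells Q" using cell_near by (auto simp: cells_def Q_def)
  qed
  moreover have "emeasure (net_measure g) Q = 9 * ennreal (g k)"
  proof -
    have "finite Q" "card Q = 9" "\<And>p. p \<in> Q \<Longrightarrow> fst p = k"
      using near_cells by (auto simp: Q_def card_cartesian_product_singleton)
    then show ?thesis by (simp add: net_measure_finite)
  qed
  ultimately show ?thesis using that[of Q] by simp
qed

context gauge
begin

text \<open>The content puts no limit on the size of the cells, but a cover of total weight below
  \<open>dyad k0\<close> can only use cells of level beyond \<open>k0\<close>. So covers of tiny
  weight are automatically fine.\<close>

theorem hausdorff_zero_if_net_content_zero:
  assumes "net_content dyad A = 0"
  shows "hausdorff \<phi> A = 0"
proof -
  have "hausdorff_pre \<phi> \<epsilon> A \<le> ennreal \<delta>" if \<epsilon>: "\<epsilon> > 0" and \<delta>: "\<delta> > 0" for \<epsilon> \<delta>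
  proof -
    obtain k0 where "(1/2) ^ k0 < \<epsilon> / 2"
      using real_arch_pow_inv[of "\<epsilon>/2" "1/2"] \<epsilon> by auto
    then have k0: "2 * (1/2) ^ k0 < \<epsilon>" by simp
    \<comment> \<open>The second bound forces the cells to be small. The first one pays for
      replacing \<phi>(2^-k) by \<phi> at the diameter of a cell, which is at most 2 * 2^-k; by
      \<open>phi_double\<close> this costs a factor 4.\<close>
    define \<delta>' where "\<delta>' = min (\<delta> / 4) (dyad k0)"
    have "\<delta>' > 0" using \<delta> dyad_pos by (simp add: \<delta>'_def)
    then obtain Q where Q: "A \<subseteq> cells Q" "emeasure (net_measure dyad) Q < ennreal \<delta>'"
      using assms net_content_lessE[of dyad A "ennreal \<delta>'"] by auto
    define e where "e = from_nat_into (UNIV :: (nat \<times> int \<times> int) set)"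
    have e: "bij_betw e UNIV UNIV" unfolding e_def
      by (intro bij_betw_from_nat_into) (auto simp: finite_prod)
    define C where "C i = (if e i \<in> Q then {x. cell (fst (e i)) x = snd (e i)} else {})" for i
    have bnd: "bounded (C i)" "diameter (C i) \<le> 2 * (1/2) ^ fst (e i)" for i
    proof -
      have *: "norm (x - y) \<le> 2 * (1/2) ^ fst (e i)" if "x \<in> C i" "y \<in> C i" for x y
        using that cell_dist[of "fst (e i)" x y] by (auto simp: C_def split: if_splits)
      then show "diameter (C i) \<le> 2 * (1/2) ^ fst (e i)"
        by (intro diameter_le) auto
      show "bounded (C i)"
        using * unfolding bounded_two_points dist_norm by blast
    qed
    have small: "2 * (1/2) ^ fst (e i) < \<epsilon>" if "e i \<in> Q" for i
    proof -
      have "ennreal (dyad (fst (e i))) \<le> emeasure (net_measure dyad) Q"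
        using emeasure_mono[of "{e i}" Q "net_measure dyad"] that by simp
      also note Q(2)
      also have "ennreal \<delta>' \<le> ennreal (dyad k0)" by (intro ennreal_leI) (simp add: \<delta>'_def)
      finally have "dyad (fst (e i)) < dyad k0" using dyad_pos[of k0] dyad_pos by (simp add: ennreal_less_iff less_imp_le)
      then have "k0 \<le> fst (e i)" using dyad_antimono[of "fst (e i)" k0] by linarith
      then have "2 * (1/2 :: real) ^ fst (e i) \<le> 2 * (1/2) ^ k0" by (simp add: power_decreasing)
      then show ?thesis using k0 by linarith
    qed
    have "A \<subseteq> (\<Union>i. C i)"
    proof
      fix x assume "x \<in> A"
      then obtain k where k: "(k, cell k x) \<in> Q" using Q(1) by (auto simp: cells_def)
      obtain i where "e i = (k, cell k x)" using e by (metis bij_betw_imp_surj_on rangeE UNIV_I)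
      then show "x \<in> (\<Union>i. C i)" using k by (auto simp: C_def intro!: exI[of _ i])
    qed
    moreover have "diameter (C i) < \<epsilon>" for i
      using bnd(2)[of i] small[of i] \<epsilon> by (cases "e i \<in> Q") (auto simp: C_def)
    ultimately have "hausdorff_pre \<phi> \<epsilon> A \<le> (\<Sum>i. gauge_diam \<phi> (C i))"
      unfolding hausdorff_pre_def using bnd(1) by (intro Inf_lower) auto
    also have "\<dots> \<le> (\<Sum>i. 4 * (ennreal (dyad (fst (e i))) * indicator Q (e i)))"
    proof (intro suminf_le allI)
      fix i
      show "gauge_diam \<phi> (C i) \<le> 4 * (ennreal (dyad (fst (e i))) * indicator Q (e i))"
      proof (cases "e i \<in> Q")
        case True
        have "gauge_diam \<phi> (C i) \<le> ennreal (\<phi> (2 * (1/2) ^ fst (e i)))"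
          by (intro gauge_diam_le bnd) auto
        also have "\<dots> \<le> ennreal (4 * dyad (fst (e i)))"
          unfolding dyad_def by (intro ennreal_leI phi_double) simp
        also have "\<dots> = 4 * ennreal (dyad (fst (e i)))" by (simp add: ennreal_mult')
        finally show ?thesis using True by simp
      qed (simp add: C_def gauge_diam_def)
    qed auto
    also have "\<dots> = (\<integral>\<^sup>+i. 4 * (ennreal (dyad (fst (e i))) * indicator Q (e i)) \<partial>count_space UNIV)"
      by (rule nn_integral_count_space_nat[symmetric])
    also have "\<dots> = (\<integral>\<^sup>+q. 4 * (ennreal (dyad (fst q)) * indicator Q q) \<partial>count_space UNIV)"
      by (rule nn_integral_bij_count_space[OF e])
    also have "\<dots> = 4 * emeasure (net_measure dyad) Q"
      by (simp add: net_measure_def emeasure_density nn_integral_cmult)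
    also have "\<dots> \<le> 4 * ennreal (\<delta> / 4)"
      using Q(2) by (intro mult_left_mono order_trans[OF less_imp_le[OF Q(2)]] ennreal_leI) (auto simp: \<delta>'_def)
    also have "\<dots> = ennreal \<delta>" using \<delta> by (simp add: ennreal_mult'[symmetric] flip: ennreal_numeral)
    finally show ?thesis .
  qed
  note pre = this
  have "hausdorff_pre \<phi> \<epsilon> A \<le> 0" if "\<epsilon> > 0" for \<epsilon>
  proof (rule ennreal_le_epsilon)
    fix e :: real assume "e > 0"
    from pre[OF that this] show "hausdorff_pre \<phi> \<epsilon> A \<le> 0 + ennreal e" by simp
  qed
  then have "hausdorff \<phi> A \<le> 0" unfolding hausdorff_eq_SUP by (intro SUP_least) simp
  then show ?thesis by simp
qed

text \<open>Mesh 1 is enough, because the largest cells have side 1. A set of the cover is replaced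
  by 9 cells of comparable size whose weights exceed its own by a factor of at most 4, up to a
  summable error; this explains 36 = 9 * 4 and the split of \<delta> into 36 * \<delta>/72 and 9 *
  \<delta>/18.\<close>

theorem net_content_zero_if_hausdorff_zero:
  fixes A :: "(real^2) set"
  assumes "hausdorff \<phi> A = 0"
  shows "net_content dyad A = 0"
proof -
  let ?w = "emeasure (net_measure dyad)"
  have "hausdorff_pre \<phi> 1 A \<le> hausdorff \<phi> A"
    unfolding hausdorff_eq_SUP by (rule SUP_upper) simp
  then have pre: "hausdorff_pre \<phi> 1 A = 0" using assms by simp
  have "net_content dyad A \<le> ennreal \<delta>" if \<delta>: "\<delta> > 0" for \<delta>
  proof -
    have "hausdorff_pre \<phi> 1 A < ennreal (\<delta> / 72)" using pre \<delta> by simp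
    then obtain C :: "nat \<Rightarrow> (real^2) set" where C: "A \<subseteq> (\<Union>i. C i)" "\<And>i. bounded (C i)" "\<And>i. diameter (C i) < 1"
      "(\<Sum>i. gauge_diam \<phi> (C i)) < ennreal (\<delta> / 72)"
      unfolding hausdorff_pre_def Inf_less_iff by blast
    \<comment> \<open>These errors are for the sets of diameter 0: they are charged the limit of
      \<phi> at 0, which no \<open>dyad k\<close> need attain.\<close>
    define d where "d i = \<delta> / 18 * (1/2) ^ Suc i" for i :: nat
    have d: "d i > 0" for i using \<delta> by (simp add: d_def)
    have "\<exists>Q. C i \<subseteq> cells Q \<and> ?w Q \<le> 36 * gauge_diam \<phi> (C i) + 9 * ennreal (d i)" for i
    proof -
      have "\<exists>k. diameter (C i) \<le> (1/2) ^ k \<and>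
          (C i \<noteq> {} \<longrightarrow> ennreal (dyad k) \<le> 4 * gauge_diam \<phi> (C i) + ennreal (d i))"
      proof (cases "diameter (C i) = 0")
        case True
        have "\<forall>\<^sub>F r in at_right 0. \<phi> r < Lim (at_right 0) \<phi> + d i"
          using phi_tendsto d[of i] by (intro order_tendstoD(2)[of _ "Lim (at_right 0) \<phi>"]) (auto simp: Lim_phi)
        then obtain s where s: "s > 0" "\<And>r. 0 < r \<Longrightarrow> r < s \<Longrightarrow> \<phi> r < Lim (at_right 0) \<phi> + d i"
          unfolding eventually_at_right_field by auto
        obtain k where "(1/2 :: real) ^ k < s" using real_arch_pow_inv[OF s(1), of "1/2"] by auto
        then have "dyad k \<le> Lim (at_right 0) \<phi> + d i" using s(2) by (simp add: dyad_def less_imp_le)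
        then have "ennreal (dyad k) \<le> ennreal (Lim (at_right 0) \<phi>) + ennreal (d i)"
          using d[of i] Lim_phi_nonneg by (simp add: ennreal_leI flip: ennreal_plus)
        also have "\<dots> \<le> 4 * ennreal (Lim (at_right 0) \<phi>) + ennreal (d i)"
          using mult_right_mono[of 1 4 "ennreal (Lim (at_right 0) \<phi>)"] by (intro add_right_mono) simp
        finally show ?thesis using True by (intro exI[of _ k]) (auto simp: gauge_diam_def)
      next
        case False
        define D where "D = diameter (C i)"
        have D: "0 < D" "D < 1" using False diameter_ge_0[OF C(2)[of i]] C(3)[of i] by (auto simp: D_def)
        have ex: "\<exists>k. (1/2) ^ k < D" using real_arch_pow_inv[OF D(1), of "1/2"] by auto
        \<comment> \<open>The diameter lies between 2^-m and 2^-(m-1), so level m - 1 is coarse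
          enough to cover, and its weight is at most 4 times \<phi>(2^-m). Here m > 0 because the
          diameter is below 1.\<close>
        define m where "m = (LEAST k. (1/2) ^ k < D)"
        have m: "(1/2) ^ m < D" unfolding m_def by (rule LeastI_ex[OF ex])
        then obtain k where k: "m = Suc k" using D by (cases m) auto
        have "D \<le> (1/2) ^ k" using not_less_Least[of k "\<lambda>k. (1/2) ^ k < D"] k by (auto simp: m_def)
        moreover have "dyad k \<le> 4 * \<phi> D"
        proof -
          have "dyad k \<le> 4 * dyad (Suc k)" by (rule dyad_le_4_Suc)
          also have "dyad (Suc k) \<le> \<phi> D" unfolding dyad_def using m k by (intro phi_mono) auto
          finally show ?thesis by simp
        qed
        then have "ennreal (dyad k) \<le> ennreal (4 * \<phi> D)" by (rule ennreal_leI)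
        then have "ennreal (dyad k) \<le> 4 * ennreal (\<phi> D)" by (simp add: ennreal_mult')
        then have "C i \<noteq> {} \<longrightarrow> ennreal (dyad k) \<le> 4 * gauge_diam \<phi> (C i) + ennreal (d i)"
          using False by (auto simp: gauge_diam_def D_def intro: add_increasing2)
        ultimately show ?thesis by (auto simp: D_def)
      qed
      then obtain k where k: "diameter (C i) \<le> (1/2) ^ k"
          "C i \<noteq> {} \<Longrightarrow> ennreal (dyad k) \<le> 4 * gauge_diam \<phi> (C i) + ennreal (d i)" by blast
      show ?thesis
      proof (cases "C i = {}")
        case True then show ?thesis by (intro exI[of _ "{}"]) auto
      next
        case False
        obtain Q where Q: "C i \<subseteq> cells Q" "?w Q \<le> 9 * ennreal (dyad k)"
          using cells_cover_small[OF C(2) k(1)] .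
        note Q(2)
        also have "9 * ennreal (dyad k) \<le> 9 * (4 * gauge_diam \<phi> (C i) + ennreal (d i))"
          using k(2)[OF False] by (rule mult_left_mono) simp
        also have "\<dots> = 36 * gauge_diam \<phi> (C i) + 9 * ennreal (d i)"
          by (simp add: distrib_left mult.assoc[symmetric])
        finally show ?thesis using Q(1) by blast
      qed
    qed
    then obtain Q where Q: "\<And>i. C i \<subseteq> cells (Q i)"
      "\<And>i. ?w (Q i) \<le> 36 * gauge_diam \<phi> (C i) + 9 * ennreal (d i)" by metis
    have "A \<subseteq> cells (\<Union>i. Q i)" using C(1) Q(1) unfolding cells_UN by blast
    then have "net_content dyad A \<le> ?w (\<Union>i. Q i)" by (rule net_content_le)
    also have "\<dots> \<le> (\<Sum>i. ?w (Q i))" by (rule emeasure_subadditive_countably) auto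
    also have "\<dots> \<le> (\<Sum>i. 36 * gauge_diam \<phi> (C i) + 9 * ennreal (d i))"
      by (intro suminf_le Q) auto
    also have "\<dots> = 36 * (\<Sum>i. gauge_diam \<phi> (C i)) + 9 * (\<Sum>i. ennreal (d i))"
      by (simp add: suminf_add[symmetric])
    also have "(\<Sum>i. ennreal (d i)) = ennreal (\<delta> / 18)"
    proof -
      have "d sums (\<delta> / 18 * 1)" unfolding d_def using power_half_series by (rule sums_mult)
      then show ?thesis using d by (intro suminf_ennreal_eq) (auto intro: less_imp_le)
    qed
    also have "36 * (\<Sum>i. gauge_diam \<phi> (C i)) + 9 * ennreal (\<delta> / 18)
        \<le> 36 * ennreal (\<delta> / 72) + 9 * ennreal (\<delta> / 18)"
      using C(4) by (intro add_right_mono mult_left_mono) auto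
    also have "\<dots> = ennreal (36 * (\<delta> / 72) + 9 * (\<delta> / 18))"
    proof -
      have "36 * ennreal (\<delta> / 72) = ennreal (36 * (\<delta> / 72))" "9 * ennreal (\<delta> / 18) = ennreal (9 * (\<delta> / 18))"
        using \<delta> by (simp_all only: ennreal_mult' ennreal_numeral zero_le_numeral)
      then show ?thesis using \<delta> by (simp only:) (rule ennreal_plus[symmetric]; simp)
    qed
    also have "36 * (\<delta> / 72) + 9 * (\<delta> / 18) = \<delta>" by simp
    finally show ?thesis .
  qed
  note le = this
  have "net_content dyad A \<le> 0"
  proof (rule ennreal_le_epsilon)
    fix e :: real assume "e > 0"
    from le[OF this] show "net_content dyad A \<le> 0 + ennreal e" by simp
  qed
  then show ?thesis by simp
qed

section \<open>The integral condition as a dyadic series\<close>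

definition step_gauge :: "real \<Rightarrow> ennreal" where
  "step_gauge r = (\<Sum>k. ennreal (4 ^ k * dyad k) * indicator {(1/2) ^ Suc k<..(1/2) ^ k} r)"

lemma step_gauge_eq:
  assumes "(1/2) ^ Suc k < r" "r \<le> (1/2) ^ k"
  shows "step_gauge r = ennreal (4 ^ k * dyad k)"
proof -
  define f where "f j = ennreal (4 ^ j * dyad j) * indicator {(1/2) ^ Suc j<..(1/2) ^ j} r" for j
  have "f j = 0" if "j \<noteq> k" for j
  proof -
    have "\<not> ((1/2) ^ Suc j < r \<and> r \<le> (1/2) ^ j)"
    proof (cases "j < k")
      case True
      then have "(1/2 :: real) ^ k \<le> (1/2) ^ Suc j" by (intro power_decreasing) auto
      then show ?thesis using assms by linarith
    next
      case False
      then have "(1/2 :: real) ^ j \<le> (1/2) ^ Suc k" using that by (intro power_decreasing) auto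
      then show ?thesis using assms by linarith
    qed
    then show ?thesis by (auto simp: f_def indicator_def)
  qed
  then have "suminf f = f k" using suminf_finite[of "{k}" f] by simp
  moreover have "step_gauge r = suminf f" unfolding step_gauge_def f_def ..
  ultimately show ?thesis using assms by (simp add: f_def)
qed

text \<open>On (2^-(k+1), 2^-k] the value of \<open>step_gauge\<close> is that of \<phi>(r)/r^2 at
  the right end, hence a lower bound. At the left end the quotient is 4^(k+1) \<phi>(2^-(k+1)), at
  most 4 times as large because \<phi> increases.\<close>

lemma step_gauge_bounds:
  assumes "0 < r" "r \<le> 1"
  shows "step_gauge r \<le> ennreal (\<phi> r / r\<^sup>2)" "ennreal (\<phi> r / r\<^sup>2) \<le> 4 * step_gauge r"
proof -
  have ex: "\<exists>k. (1/2) ^ Suc k < r"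
    using real_arch_pow_inv[of "2 * r" "1/2"] assms by (auto simp: field_simps)
  define k where "k = (LEAST k. (1/2) ^ Suc k < r)"
  have k1: "(1/2) ^ Suc k < r" unfolding k_def by (rule LeastI_ex[OF ex])
  have k2: "r \<le> (1/2) ^ k"
  proof (cases k)
    case (Suc j)
    then show ?thesis using not_less_Least[of j "\<lambda>k. (1/2) ^ Suc k < r"] by (auto simp: k_def)
  qed (use assms in simp)
  have four: "((1/2 :: real) ^ j)\<^sup>2 = 1 / 4 ^ j" for j
    by (simp add: power2_eq_square power_one_over flip: power_mult_distrib)
  have "4 ^ k * dyad k \<le> \<phi> r / r\<^sup>2"
    using phi_quot_antimono[OF assms(1) k2] by (simp add: dyad_def four mult.commute)
  then show "step_gauge r \<le> ennreal (\<phi> r / r\<^sup>2)" unfolding step_gauge_eq[OF k1 k2] by (rule ennreal_leI)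
  have "\<phi> r / r\<^sup>2 \<le> 4 ^ Suc k * dyad (Suc k)"
    using phi_quot_antimono[of "(1/2) ^ Suc k" r] k1 by (simp add: dyad_def four mult.commute del: power_Suc)
  also have "\<dots> \<le> 4 * (4 ^ k * dyad k)" using dyad_antimono[of k "Suc k"] by simp
  finally have "ennreal (\<phi> r / r\<^sup>2) \<le> ennreal (4 * (4 ^ k * dyad k))" by (rule ennreal_leI)
  then show "ennreal (\<phi> r / r\<^sup>2) \<le> 4 * step_gauge r" unfolding step_gauge_eq[OF k1 k2]
    using dyad_pos[of k] by (simp add: ennreal_mult' del: ennreal_mult)
qed

lemma nn_integral_step_gauge:
  "(\<integral>\<^sup>+ r\<in>{0<..1}. step_gauge r \<partial>lborel) = (\<Sum>k. ennreal (2 ^ k * dyad k / 2))"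
proof -
  have "(\<integral>\<^sup>+ r\<in>{0<..1}. step_gauge r \<partial>lborel) = (\<integral>\<^sup>+ r. step_gauge r \<partial>lborel)"
  proof (intro nn_integral_cong)
    fix r :: real
    have "indicator {(1/2) ^ Suc k<..(1/2) ^ k} r = (0 :: ennreal)" if "r \<notin> {0<..1}" for k
    proof -
      have "(0::real) < (1/2) ^ Suc k" "(1/2 :: real) ^ k \<le> 1" by (auto simp: power_le_one)
      then show ?thesis using that by (auto simp: indicator_def)
    qed
    then show "step_gauge r * indicator {0<..1} r = step_gauge r"
      by (cases "r \<in> {0<..1}") (auto simp: step_gauge_def)
  qed
  also have "\<dots> = (\<Sum>k. \<integral>\<^sup>+ r. ennreal (4 ^ k * dyad k) * indicator {(1/2 :: real) ^ Suc k<..(1/2) ^ k} r \<partial>lborel)"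
    unfolding step_gauge_def by (intro nn_integral_suminf) auto
  also have "\<dots> = (\<Sum>k. ennreal (2 ^ k * dyad k / 2))"
  proof (intro suminf_cong)
    fix k
    have "(\<integral>\<^sup>+ r. ennreal (4 ^ k * dyad k) * indicator {(1/2 :: real) ^ Suc k<..(1/2) ^ k} r \<partial>lborel)
        = ennreal (4 ^ k * dyad k) * ennreal ((1/2) ^ k - (1/2) ^ Suc k)"
      by (simp add: nn_integral_cmult)
    also have "\<dots> = ennreal (4 ^ k * dyad k * ((1/2) ^ k / 2))"
      by (subst ennreal_mult'') auto
    also have "4 ^ k * dyad k * ((1/2) ^ k / 2) = 2 ^ k * dyad k / 2"
    proof -
      have "(4::real) ^ k = 2 ^ k * 2 ^ k" by (simp flip: power_mult_distrib)
      then show ?thesis by (simp add: field_simps)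
    qed
    finally show "(\<integral>\<^sup>+ r. ennreal (4 ^ k * dyad k) * indicator {(1/2 :: real) ^ Suc k<..(1/2) ^ k} r \<partial>lborel)
      = ennreal (2 ^ k * dyad k / 2)" .
  qed
  finally show ?thesis .
qed

lemma integral_finite_iff_summable:
  "(\<integral>\<^sup>+ r\<in>{0<..1}. ennreal (\<phi> r / r\<^sup>2) \<partial>lborel) < \<infinity> \<longleftrightarrow> summable (\<lambda>k. 2 ^ k * dyad k)"
proof -
  let ?I = "\<integral>\<^sup>+ r\<in>{0<..1}. ennreal (\<phi> r / r\<^sup>2) \<partial>lborel"
  let ?S = "\<Sum>k. ennreal (2 ^ k * dyad k / 2)"
  have lower: "?S \<le> ?I" unfolding nn_integral_step_gauge[symmetric]
    by (intro nn_integral_mono) (auto simp: indicator_def step_gauge_bounds)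
  have meas: "step_gauge \<in> borel_measurable lborel" unfolding step_gauge_def by measurable
  have "?I \<le> (\<integral>\<^sup>+ r. 4 * (step_gauge r * indicator {0<..1} r) \<partial>lborel)"
    by (intro nn_integral_mono) (auto simp: indicator_def step_gauge_bounds)
  also have "\<dots> = 4 * ?S" unfolding nn_integral_step_gauge[symmetric]
    by (intro nn_integral_cmult borel_measurable_times_ennreal meas) auto
  finally have upper: "?I \<le> 4 * ?S" .
  have "?S < \<infinity> \<longleftrightarrow> summable (\<lambda>k. 2 ^ k * dyad k / 2)"
  proof
    assume "?S < \<infinity>"
    then show "summable (\<lambda>k. 2 ^ k * dyad k / 2)"
      using dyad_pos by (intro summable_suminf_not_top) (auto simp: less_imp_le)
  next
    assume "summable (\<lambda>k. 2 ^ k * dyad k / 2)"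
    then have "?S = ennreal (\<Sum>k. 2 ^ k * dyad k / 2)"
      using dyad_pos by (intro suminf_ennreal_eq summable_sums) (auto simp: less_imp_le)
    then show "?S < \<infinity>" by simp
  qed
  moreover have "?I < \<infinity> \<longleftrightarrow> ?S < \<infinity>"
  proof
    assume "?I < \<infinity>" with lower show "?S < \<infinity>" by (rule le_less_trans)
  next
    assume "?S < \<infinity>"
    then have "4 * ?S < \<infinity>" by (simp add: ennreal_mult_less_top)
    with upper show "?I < \<infinity>" by (rule le_less_trans)
  qed
  moreover have "summable (\<lambda>k. 2 ^ k * dyad k / 2) \<longleftrightarrow> summable (\<lambda>k. 2 ^ k * dyad k)"
    using summable_divide_iff[of "\<lambda>k. 2 ^ k * dyad k" 2] by simp
  ultimately show ?thesis by simp
qed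

end

section \<open>Finite energy and projections\<close>

text \<open>The mean value theorem at z/2 and the double angle formula give sin z >= z (cos (z/2))^2
  = z (1 + cos z)/2 for z in (0, pi/2].\<close>

lemma half_abs_le_abs_sin:
  fixes z :: real
  assumes "\<bar>z\<bar> \<le> pi / 2" shows "\<bar>z\<bar> / 2 \<le> \<bar>sin z\<bar>"
proof -
  have *: "z / 2 \<le> sin z" if z: "0 < z" "z \<le> pi / 2" for z :: real
  proof -
    obtain \<xi> where \<xi>: "0 < \<xi>" "\<xi> < z / 2" "sin (z / 2) - sin 0 = (z / 2 - 0) * cos \<xi>"
      using MVT2[of 0 "z / 2" sin cos] z by (auto intro: DERIV_sin)
    have c: "cos (z / 2) \<le> cos \<xi>" using \<xi> z by (intro cos_monotone_0_pi_le) auto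
    have "sin z = 2 * sin (z / 2) * cos (z / 2)" using sin_double[of "z / 2"] by simp
    also have "\<dots> = z * (cos \<xi> * cos (z / 2))" using \<xi> by simp
    also have "\<dots> \<ge> z * (cos (z / 2) * cos (z / 2))"
      using c z by (intro mult_left_mono mult_right_mono cos_ge_zero) auto
    also have "cos (z / 2) * cos (z / 2) = (1 + cos z) / 2"
      using cos_double_cos[of "z / 2"] by (simp add: power2_eq_square)
    finally have "z * ((1 + cos z) / 2) \<le> sin z" .
    moreover have "z * (1 / 2) \<le> z * ((1 + cos z) / 2)"
      using z cos_ge_zero[of z] by (intro mult_left_mono) auto
    ultimately show ?thesis by simp
  qed
  consider "z = 0" | "z > 0" | "z < 0" by linarith
  then show ?thesis
    using *[of z] *[of "- z"] assms by cases auto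
qed

text \<open>In polar form \<open>v \<bullet> dir \<theta>\<close> is \<open>norm v\<close> times
  cos(\<theta> - \<alpha>), and near each zero \<open>c k\<close> the cosine is at least half the
  distance to it. For \<alpha> in [0, 2 pi) the nearest zero has index between -3 and 1: five
  intervals of length 4 s / norm v.\<close>

lemma measure_directions_near_orthogonal:
  fixes v :: "real^2"
  assumes v: "v \<noteq> 0" and s: "0 \<le> s"
  shows "measure lborel {\<theta>\<in>{0..pi}. \<bar>v \<bullet> dir \<theta>\<bar> \<le> s} \<le> 20 * s / norm v"
proof -
  define \<rho> where "\<rho> = norm v"
  have \<rho>: "\<rho> > 0" using v by (simp add: \<rho>_def)
  have "(v $ 1)\<^sup>2 + (v $ 2)\<^sup>2 = \<rho>\<^sup>2"
    unfolding \<rho>_def power2_norm_eq_inner by (simp add: inner_vec_def sum_2 power2_eq_square)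
  then have "(v $ 1 / \<rho>)\<^sup>2 + (v $ 2 / \<rho>)\<^sup>2 = 1"
    using \<rho> by (simp add: power_divide flip: add_divide_distrib)
  then obtain \<alpha> where \<alpha>: "0 \<le> \<alpha>" "\<alpha> < 2 * pi" "v $ 1 / \<rho> = cos \<alpha>" "v $ 2 / \<rho> = sin \<alpha>"
    by (rule sincos_total_2pi)
  have vd: "v \<bullet> dir \<theta> = \<rho> * cos (\<theta> - \<alpha>)" for \<theta>
  proof -
    have "v $ 1 = \<rho> * cos \<alpha>" "v $ 2 = \<rho> * sin \<alpha>" using \<alpha> \<rho> by (auto simp: field_simps)
    then show ?thesis by (simp add: inner_dir cos_diff algebra_simps)
  qed
  define c where "c k = \<alpha> + pi / 2 + of_int k * pi" for k :: int
  have "{\<theta>\<in>{0..pi}. \<bar>v \<bullet> dir \<theta>\<bar> \<le> s} \<subseteq> (\<Union>k\<in>{-3..1}. {c k - 2 * s / \<rho>..c k + 2 * s / \<rho>})"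
  proof
    fix \<theta> assume "\<theta> \<in> {\<theta>\<in>{0..pi}. \<bar>v \<bullet> dir \<theta>\<bar> \<le> s}"
    then have \<theta>: "0 \<le> \<theta>" "\<theta> \<le> pi" "\<bar>cos (\<theta> - \<alpha>)\<bar> \<le> s / \<rho>"
      using \<rho> by (auto simp: vd abs_mult field_simps)
    define y where "y = \<theta> - \<alpha> - pi / 2"
    define k where "k = round (y / pi)"
    define z where "z = y - of_int k * pi"
    have "\<bar>y / pi - of_int k\<bar> \<le> 1 / 2"
      using of_int_round_abs_le[of "y / pi"] by (simp add: k_def abs_minus_commute)
    then have "\<bar>y / pi - of_int k\<bar> * pi \<le> 1 / 2 * pi" by (intro mult_right_mono) auto
    moreover have "\<bar>y / pi - of_int k\<bar> * pi = \<bar>z\<bar>"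
      by (simp add: z_def abs_mult_pos left_diff_distrib)
    ultimately have z: "\<bar>z\<bar> \<le> pi / 2" by simp
    have "\<bar>cos (\<theta> - \<alpha>)\<bar> = \<bar>sin y\<bar>" by (simp add: y_def sin_diff)
    also have "\<dots> = \<bar>sin z\<bar>"
    proof -
      have "sin z = sin y * cos (of_int k * pi)" by (simp add: z_def sin_diff sin_int_times_real mult.commute)
      moreover have "\<bar>cos (of_int k * pi)\<bar> = 1"
      proof -
        have "sin (of_int k * pi) = 0" by (simp add: mult.commute)
        then have "(cos (of_int k * pi))\<^sup>2 = 1" using sin_cos_squared_add[of "of_int k * pi"] by simp
        then show ?thesis by (auto simp: power2_eq_1_iff)
      qed
      ultimately show ?thesis by (simp add: abs_mult)
    qed
    finally have "\<bar>z\<bar> \<le> 2 * s / \<rho>" using half_abs_le_abs_sin[OF z] \<theta>(3) by simp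
    moreover have "z = \<theta> - c k" by (simp add: z_def y_def c_def)
    ultimately have "\<theta> \<in> {c k - 2 * s / \<rho>..c k + 2 * s / \<rho>}" by auto
    moreover have "k \<in> {-3..1}"
    proof -
      have "-5 / 2 * pi \<le> y" "y \<le> pi / 2" using \<theta> \<alpha> by (auto simp: y_def)
      then have "-3 * pi \<le> of_int k * pi" "of_int k * pi \<le> pi" using z unfolding z_def by linarith+
      then have "-3 \<le> (of_int k :: real)" "(of_int k :: real) \<le> 1"
        using mult_right_le_imp_le[of "-3" pi "of_int k"] mult_right_le_imp_le[of "of_int k" pi 1] by auto
      then show ?thesis by auto
    qed
    ultimately show "\<theta> \<in> (\<Union>k\<in>{-3..1}. {c k - 2 * s / \<rho>..c k + 2 * s / \<rho>})" by blast
  qed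
  then have "measure lborel {\<theta>\<in>{0..pi}. \<bar>v \<bullet> dir \<theta>\<bar> \<le> s}
      \<le> measure lborel (\<Union>k\<in>{-3..1}. {c k - 2 * s / \<rho>..c k + 2 * s / \<rho>})"
  proof (rule measure_mono_fmeasurable)
    show "{\<theta>\<in>{0..pi}. \<bar>v \<bullet> dir \<theta>\<bar> \<le> s} \<in> sets lborel" by (simp add: inner_dir)
    show "(\<Union>k\<in>{-3..1}. {c k - 2 * s / \<rho>..c k + 2 * s / \<rho>}) \<in> fmeasurable lborel"
      by (intro fmeasurable.finite_UN) (auto intro!: fmeasurableI simp: emeasure_lborel_Icc_eq)
  qed
  also have "\<dots> \<le> (\<Sum>k\<in>{-3..1}. measure lborel {c k - 2 * s / \<rho>..c k + 2 * s / \<rho>})"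
    by (intro measure_UNION_le) auto
  also have "\<dots> = 20 * s / norm v" using s \<rho> by (simp add: \<rho>_def)
  finally show ?thesis .
qed

text \<open>The Riesz kernel 1/norm v, truncated at scale 2^-n, up to constants; in this form it
  appears when the energies are integrated over the directions.\<close>

definition direction_kernel :: "nat \<Rightarrow> real^2 \<Rightarrow> real" where
  "direction_kernel n v = measure lborel {\<theta>\<in>{0..pi}. \<bar>v \<bullet> dir \<theta>\<bar> \<le> 2 * (1/2) ^ n} / (2 * (1/2) ^ n)"

text \<open>The dyadic sum dominates the smaller of 2^n and 1/norm v up to a factor 2 when
  \<open>norm v\<close> is at most 1: one summand, for the level k with 2^-(k+1) < norm v <= 2^-k or
  for k = n, suffices. The summand 1 covers larger distances.\<close>

lemma direction_kernel_le:
  "direction_kernel n v \<le> 40 * (1 + (\<Sum>k\<le>n. 2 ^ k * (if norm v \<le> (1/2) ^ k then 1 else 0)))"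
proof -
  define S where "S = (\<Sum>k\<le>n. 2 ^ k * (if norm v \<le> (1/2) ^ k then 1 else (0::real)))"
  have S: "2 ^ k \<le> S" if "k \<le> n" "norm v \<le> (1/2) ^ k" for k
  proof -
    have "2 ^ k * (if norm v \<le> (1/2) ^ k then 1 else (0::real)) \<le> S"
      unfolding S_def using that(1) by (intro member_le_sum) auto
    then show ?thesis using that by simp
  qed
  have S0: "0 \<le> S" unfolding S_def by (intro sum_nonneg) auto
  have far: "direction_kernel n v \<le> 20 / norm v" if "v \<noteq> 0"
  proof -
    define r :: real where "r = 2 * (1/2) ^ n"
    have r: "r > 0" by (simp add: r_def)
    have "direction_kernel n v \<le> 20 * r / norm v / r"
      unfolding direction_kernel_def r_def[symmetric]
      using r by (intro divide_right_mono measure_directions_near_orthogonal that) auto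
    then show ?thesis using r by simp
  qed
  consider "norm v \<le> (1/2) ^ n" | "norm v > 1" | "norm v > (1/2) ^ n" "norm v \<le> 1" by linarith
  then have "direction_kernel n v \<le> 40 * (1 + S)"
  proof cases
    case 1
    have "measure lborel {\<theta>\<in>{0..pi}. \<bar>v \<bullet> dir \<theta>\<bar> \<le> 2 * (1/2) ^ n} \<le> measure lborel {0..pi}"
      by (rule measure_mono_fmeasurable) (auto simp: inner_dir intro!: fmeasurableI)
    then have "direction_kernel n v \<le> pi / (2 * (1/2) ^ n)"
      unfolding direction_kernel_def by (intro divide_right_mono) auto
    also have "\<dots> = pi / 2 * 2 ^ n" by (simp add: field_simps)
    also have "\<dots> \<le> 40 * 2 ^ n" using pi_less_4 by (intro mult_right_mono) auto
    also have "\<dots> \<le> 40 * (1 + S)" using S[of n] 1 by simp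
    finally show ?thesis .
  next
    case 2
    then have "v \<noteq> 0" by auto
    then have "direction_kernel n v \<le> 20 / norm v" by (rule far)
    also have "\<dots> \<le> 20" using 2 by (simp add: divide_le_eq)
    also have "20 \<le> 40 * (1 + S)" using S0 by simp
    finally show ?thesis .
  next
    case 3
    define k where "k = (LEAST k. (1/2) ^ Suc k < norm v)"
    have "n \<noteq> 0" using 3 by (cases n) auto
    then have ex: "(1/2) ^ Suc (n - 1) < norm v" using 3 by simp
    have k: "(1/2) ^ Suc k < norm v" unfolding k_def using ex by (rule LeastI)
    have "k \<le> n - 1" unfolding k_def using ex by (rule Least_le)
    moreover have "norm v \<le> (1/2) ^ k"
    proof (cases k)
      case (Suc j)
      then show ?thesis using not_less_Least[of j "\<lambda>k. (1/2) ^ Suc k < norm v"] by (auto simp: k_def)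
    qed (use 3 in simp)
    ultimately have "2 ^ k \<le> S" using S[of k] by simp
    have "0 < norm v" using 3 less_trans[of 0 "(1/2) ^ n" "norm v"] by simp
    then have "direction_kernel n v \<le> 20 / norm v" by (intro far) auto
    also have "\<dots> \<le> 20 / (1/2) ^ Suc k" using k \<open>0 < norm v\<close> by (intro divide_left_mono) auto
    also have "\<dots> = 40 * 2 ^ k" by (simp add: field_simps)
    also have "\<dots> \<le> 40 * (1 + S)" using \<open>2 ^ k \<le> S\<close> by simp
    finally show ?thesis .
  qed
  then show ?thesis by (simp add: S_def)
qed

text \<open>A greedy version of Frostman's lemma: each point receives the largest mass that respects the
  bounds on the cells containing it, which saturates one of these cells.\<close>

lemma greedy_mass:
  fixes P :: "(real^2) set" and g :: "nat \<Rightarrow> real"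
  assumes "finite P" and g: "\<And>k. 0 < g k"
  shows "\<exists>\<mu>. (\<forall>p. 0 \<le> \<mu> p) \<and> (\<forall>k\<le>n. \<forall>z. (\<Sum>p\<in>{p\<in>P. cell k p = z}. \<mu> p) \<le> g k)
    \<and> (\<forall>p\<in>P. \<exists>k\<le>n. (\<Sum>q\<in>{q\<in>P. cell k q = cell k p}. \<mu> q) = g k)"
  using assms(1)
proof induction
  case empty
  show ?case by (rule exI[of _ "\<lambda>_. 0"]) (auto simp: g less_imp_le)
next
  case (insert x P)
  then obtain \<mu> where \<mu>: "\<And>p. 0 \<le> \<mu> p" "\<And>k z. k \<le> n \<Longrightarrow> (\<Sum>p\<in>{p\<in>P. cell k p = z}. \<mu> p) \<le> g k"
    "\<And>p. p \<in> P \<Longrightarrow> \<exists>k\<le>n. (\<Sum>q\<in>{q\<in>P. cell k q = cell k p}. \<mu> q) = g k" by blast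
  define slack where "slack k = g k - (\<Sum>q\<in>{q\<in>P. cell k q = cell k x}. \<mu> q)" for k
  define m where "m = Min (slack ` {..n})"
  have m_le: "m \<le> slack k" if "k \<le> n" for k unfolding m_def using that by auto
  have "m \<in> slack ` {..n}" unfolding m_def by (intro Min_in) auto
  then obtain k0 where k0: "k0 \<le> n" "m = slack k0" by auto
  have m0: "0 \<le> m" using \<mu>(2)[OF k0(1), of "cell k0 x"] k0 by (simp add: slack_def)
  define \<nu> where "\<nu> = \<mu>(x := m)"
  have sum: "(\<Sum>p\<in>{p\<in>insert x P. cell k p = z}. \<nu> p) =
      (\<Sum>p\<in>{p\<in>P. cell k p = z}. \<mu> p) + (if cell k x = z then m else 0)" for k z
  proof -
    have "(\<Sum>p\<in>{p\<in>P. cell k p = z}. \<nu> p) = (\<Sum>p\<in>{p\<in>P. cell k p = z}. \<mu> p)"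
      using insert.hyps by (intro sum.cong) (auto simp: \<nu>_def)
    moreover have "{p\<in>insert x P. cell k p = z} =
        (if cell k x = z then insert x {p\<in>P. cell k p = z} else {p\<in>P. cell k p = z})" by auto
    ultimately show ?thesis using insert.hyps by (simp add: \<nu>_def)
  qed
  have bound: "(\<Sum>p\<in>{p\<in>insert x P. cell k p = z}. \<nu> p) \<le> g k" if "k \<le> n" for k z
    using \<mu>(2)[OF that, of z] m_le[OF that] unfolding sum by (auto simp: slack_def)
  have "\<exists>k\<le>n. (\<Sum>q\<in>{q\<in>insert x P. cell k q = cell k p}. \<nu> q) = g k" if "p \<in> insert x P" for p
  proof (cases "p = x")
    case True
    then show ?thesis using k0 sum[of k0 "cell k0 x"] by (intro exI[of _ k0]) (simp add: slack_def)
  next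
    case False
    then have "p \<in> P" using that by simp
    from \<mu>(3)[OF this] obtain k where k: "k \<le> n" "(\<Sum>q\<in>{q\<in>P. cell k q = cell k p}. \<mu> q) = g k"
      by blast
    then have "g k \<le> (\<Sum>q\<in>{q\<in>insert x P. cell k q = cell k p}. \<nu> q)" using m0 unfolding sum by auto
    then show ?thesis using bound[OF k(1), of "cell k p"] k(1) by (intro exI[of _ k]) auto
  qed
  then show ?case using bound m0 \<mu>(1) by (intro exI[of _ \<nu>]) (auto simp: \<nu>_def)
qed

text \<open>The least saturated level \<open>L p\<close> picks the largest saturated cell around
  \<open>p\<close>. These cells are pairwise equal or disjoint, cover \<open>K\<close>, and each
  weighs exactly the mass it carries, so their total weight is the total mass.\<close>

lemma saturated_mass_ge_net_content:
  assumes P: "finite P" and \<mu>: "\<And>p. 0 \<le> \<mu> p"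
    and sat: "\<And>p. p \<in> P \<Longrightarrow> \<exists>k\<le>n. (\<Sum>q\<in>{q\<in>P. cell k q = cell k p}. \<mu> q) = g k"
    and K: "\<And>x. x \<in> K \<Longrightarrow> \<exists>p\<in>P. cell n p = cell n x"
    and g: "\<And>k. 0 < g k"
  shows "net_content g K \<le> ennreal (\<Sum>p\<in>P. \<mu> p)"
proof -
  define sat where "sat k p \<longleftrightarrow> k \<le> n \<and> (\<Sum>q\<in>{q\<in>P. cell k q = cell k p}. \<mu> q) = g k" for k p
  define L where "L p = (LEAST k. sat k p)" for p
  have L: "sat (L p) p" if "p \<in> P" for p
  proof -
    have "\<exists>k. sat k p" using assms(3)[OF that] unfolding sat_def .
    then show ?thesis unfolding L_def by (rule LeastI_ex[of "\<lambda>k. sat k p"])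
  qed
  have L_le: "L p \<le> k" if "sat k p" for k p unfolding L_def using that by (rule Least_le[of "\<lambda>k. sat k p"])
  have sat_cong: "sat k p \<longleftrightarrow> sat k q" if "cell k p = cell k q" for k p q using that by (simp add: sat_def)
  define q where "q p = (L p, cell (L p) p)" for p
  have fiber: "{p\<in>P. q p = q p0} = {p\<in>P. cell (L p0) p = cell (L p0) p0}" if p0: "p0 \<in> P" for p0
  proof (intro equalityI subsetI)
    fix p assume p: "p \<in> {p\<in>P. cell (L p0) p = cell (L p0) p0}"
    have "L p \<le> L p0" using p L[OF p0] sat_cong[of "L p0" p p0] by (intro L_le) simp
    then have "cell (L p) p = cell (L p) p0" using p by (auto intro: cell_mono)
    then have "L p0 \<le> L p" using L[of p] sat_cong[of "L p" p p0] p by (intro L_le) simp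
    then show "p \<in> {p\<in>P. q p = q p0}" using p \<open>L p \<le> L p0\<close> by (simp add: q_def)
  qed (auto simp: q_def)
  have "K \<subseteq> cells (q ` P)"
  proof
    fix x assume "x \<in> K"
    then obtain p where p: "p \<in> P" "cell n p = cell n x" using K by blast
    then have "cell (L p) p = cell (L p) x" using L[OF p(1)] unfolding sat_def by (blast intro: cell_mono)
    then have "(L p, cell (L p) x) = q p" by (simp add: q_def)
    then show "x \<in> cells (q ` P)" unfolding cells_def using p(1) by blast
  qed
  then have "net_content g K \<le> emeasure (net_measure g) (q ` P)" by (rule net_content_le)
  also have "\<dots> = ennreal (\<Sum>w\<in>q ` P. g (fst w))"
    using P g by (simp add: net_measure_finite less_imp_le)
  also have "(\<Sum>w\<in>q ` P. g (fst w)) = (\<Sum>w\<in>q ` P. \<Sum>p\<in>{p\<in>P. q p = w}. \<mu> p)"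
  proof (intro sum.cong refl)
    fix w assume "w \<in> q ` P"
    then obtain p0 where p0: "p0 \<in> P" "w = q p0" by auto
    then show "g (fst w) = (\<Sum>p\<in>{p\<in>P. q p = w}. \<mu> p)"
      using L[of p0] fiber[of p0] by (simp add: sat_def q_def)
  qed
  also have "\<dots> = (\<Sum>p\<in>P. \<mu> p)" by (rule sum.image_gen[symmetric, OF P])
  finally show ?thesis .
qed

lemma sum_ball_le:
  fixes \<mu> :: "real^2 \<Rightarrow> real"
  assumes P: "finite P" and \<mu>: "\<And>p. 0 \<le> \<mu> p"
    and bound: "\<And>z. (\<Sum>p\<in>{p\<in>P. cell k p = z}. \<mu> p) \<le> g"
  shows "(\<Sum>q\<in>{q\<in>P. norm (p - q) \<le> (1/2) ^ k}. \<mu> q) \<le> 9 * g"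
proof -
  let ?B = "{q\<in>P. norm (p - q) \<le> (1/2) ^ k}"
  have "(\<Sum>q\<in>?B. \<mu> q) = (\<Sum>z\<in>near_cells (cell k p). \<Sum>q\<in>{q\<in>?B. cell k q = z}. \<mu> q)"
    using P cell_near near_cells by (intro sum.group[symmetric]) auto
  also have "\<dots> \<le> (\<Sum>z\<in>near_cells (cell k p). g)"
  proof (intro sum_mono)
    fix z
    have "(\<Sum>q\<in>{q\<in>?B. cell k q = z}. \<mu> q) \<le> (\<Sum>p\<in>{p\<in>P. cell k p = z}. \<mu> p)"
      using P \<mu> by (intro sum_mono2) auto
    also note bound[of z]
    finally show "(\<Sum>q\<in>{q\<in>?B. cell k q = z}. \<mu> q) \<le> g" .
  qed
  also have "\<dots> = 9 * g" using near_cells by simp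
  finally show ?thesis .
qed

text \<open>Finitely supported measures project to null sets, so lengths can only be bounded for a
  thickened projection. A closed thickening of a compact set stays compact and shrinks to the
  projection as \<open>r\<close> tends to 0.\<close>

definition projection_nbhd :: "(real^2) set \<Rightarrow> real \<Rightarrow> real \<Rightarrow> real set" where
  "projection_nbhd K r \<theta> = {t. \<exists>x\<in>K. \<bar>t - x \<bullet> dir \<theta>\<bar> \<le> r}"

lemma compact_projection_nbhd:
  assumes "compact K" shows "compact (projection_nbhd K r \<theta>)"
proof -
  have "projection_nbhd K r \<theta> = (\<lambda>(x, e). x \<bullet> dir \<theta> + e) ` (K \<times> {-r..r})"
  proof (intro equalityI subsetI)
    fix t assume "t \<in> projection_nbhd K r \<theta>"
    then obtain x where x: "x \<in> K" "\<bar>t - x \<bullet> dir \<theta>\<bar> \<le> r" by (auto simp: projection_nbhd_def)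
    then have "t = (\<lambda>(x, e). x \<bullet> dir \<theta> + e) (x, t - x \<bullet> dir \<theta>)" "(x, t - x \<bullet> dir \<theta>) \<in> K \<times> {-r..r}"
      by (auto simp: abs_le_iff)
    then show "t \<in> (\<lambda>(x, e). x \<bullet> dir \<theta> + e) ` (K \<times> {-r..r})" by blast
  next
    fix t assume "t \<in> (\<lambda>(x, e). x \<bullet> dir \<theta> + e) ` (K \<times> {-r..r})"
    then obtain x e where "x \<in> K" "e \<in> {-r..r}" "t = x \<bullet> dir \<theta> + e" by auto
    then show "t \<in> projection_nbhd K r \<theta>"
      unfolding projection_nbhd_def by (auto intro!: bexI[of _ x] simp: abs_le_iff)
  qed
  also have "compact \<dots>"
    by (intro compact_continuous_image compact_Times assms) (auto simp: split_def intro!: continuous_intros)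
  finally show ?thesis .
qed

text \<open>Up to constants, an upper bound for the squared L2 norm of the measure projected in
  direction \<theta> and smoothed at scale 2^-n: the sum runs over the pairs whose smoothing
  intervals can overlap.\<close>

definition energy :: "nat \<Rightarrow> (real^2) set \<Rightarrow> (real^2 \<Rightarrow> real) \<Rightarrow> real \<Rightarrow> ennreal" where
  "energy n P \<mu> \<theta> = (\<Sum>p\<in>P. \<Sum>q\<in>P. ennreal (\<mu> p * \<mu> q / (2 * (1/2) ^ n)) *
     indicator {\<theta>\<in>{0..pi}. \<bar>(p - q) \<bullet> dir \<theta>\<bar> \<le> 2 * (1/2) ^ n} \<theta>)"

text \<open>Cauchy-Schwarz for the sum \<open>f\<close> of the masses spread over intervals of
  radius r = 2^-n: \<open>f\<close> lives on the neighbourhood, its integral is 2 r times the mass,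
  and the integral of its square is at most (2 r)^2 times the energy.\<close>

lemma projection_nbhd_energy:
  assumes K: "compact K" and P: "finite P" "P \<subseteq> K" and \<mu>: "\<And>p. 0 \<le> \<mu> p" and \<theta>: "\<theta> \<in> {0..pi}"
  shows "ennreal ((\<Sum>p\<in>P. \<mu> p)\<^sup>2) \<le> emeasure lborel (projection_nbhd K ((1/2) ^ n) \<theta>) * energy n P \<mu> \<theta>"
proof -
  define r :: real where "r = (1/2) ^ n"
  have r: "r > 0" by (simp add: r_def)
  define N where "N = projection_nbhd K r \<theta>"
  have N: "N \<in> sets borel" unfolding N_def by (intro borel_compact compact_projection_nbhd K)
  define M where "M = (\<Sum>p\<in>P. \<mu> p)"
  define I where "I p = {p \<bullet> dir \<theta> - r..p \<bullet> dir \<theta> + r}" for p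
  define f where "f t = (\<Sum>p\<in>P. ennreal (\<mu> p) * indicator (I p) t)" for t
  have f_meas[measurable]: "f \<in> borel_measurable lborel" unfolding f_def I_def by measurable
  have I_N: "I p \<subseteq> N" if "p \<in> P" for p using that P by (force simp: I_def N_def projection_nbhd_def)
  have fN: "f t * indicator N t = f t" for t
  proof (cases "t \<in> N")
    case False
    then have "f t = 0" using I_N P by (auto simp: f_def indicator_def)
    then show ?thesis by simp
  qed simp
  have int_f: "(\<integral>\<^sup>+t. f t * indicator N t \<partial>lborel) = ennreal (2 * r * M)"
  proof -
    have "(\<integral>\<^sup>+t. f t * indicator N t \<partial>lborel) = (\<Sum>p\<in>P. ennreal (\<mu> p) * emeasure lborel (I p))"
      unfolding fN unfolding f_def by (subst nn_integral_sum) (auto simp: I_def nn_integral_cmult)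
    also have "\<dots> = (\<Sum>p\<in>P. ennreal (\<mu> p * (2 * r)))"
      using r \<mu> by (intro sum.cong refl) (simp add: I_def ennreal_mult')
    also have "\<dots> = ennreal (\<Sum>p\<in>P. \<mu> p * (2 * r))" using \<mu> r by (intro sum_ennreal) auto
    finally show ?thesis by (simp add: M_def sum_distrib_right[symmetric] mult.commute)
  qed
  have int_ff: "(\<integral>\<^sup>+t. (f t)\<^sup>2 \<partial>lborel) \<le> ennreal ((2 * r)\<^sup>2) * energy n P \<mu> \<theta>"
  proof -
    have "(f t)\<^sup>2 = (\<Sum>p\<in>P. \<Sum>q\<in>P. ennreal (\<mu> p * \<mu> q) * indicator (I p \<inter> I q) t)" for t
      unfolding power2_eq_square f_def sum_product
      by (intro sum.cong refl) (simp add: ennreal_mult \<mu> indicator_inter_arith mult_ac)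
    then have "(\<integral>\<^sup>+t. (f t)\<^sup>2 \<partial>lborel) = (\<Sum>p\<in>P. \<Sum>q\<in>P. ennreal (\<mu> p * \<mu> q) * emeasure lborel (I p \<inter> I q))"
      by (simp add: nn_integral_sum nn_integral_cmult I_def)
    also have "\<dots> \<le> (\<Sum>p\<in>P. \<Sum>q\<in>P. ennreal ((2 * r)\<^sup>2) * (ennreal (\<mu> p * \<mu> q / (2 * r)) *
        indicator {\<theta>\<in>{0..pi}. \<bar>(p - q) \<bullet> dir \<theta>\<bar> \<le> 2 * r} \<theta>))"
    proof (intro sum_mono)
      fix p q
      show "ennreal (\<mu> p * \<mu> q) * emeasure lborel (I p \<inter> I q) \<le> ennreal ((2 * r)\<^sup>2) *
        (ennreal (\<mu> p * \<mu> q / (2 * r)) * indicator {\<theta>\<in>{0..pi}. \<bar>(p - q) \<bullet> dir \<theta>\<bar> \<le> 2 * r} \<theta>)"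
      proof (cases "\<bar>(p - q) \<bullet> dir \<theta>\<bar> \<le> 2 * r")
        case True
        have "emeasure lborel (I p \<inter> I q) \<le> emeasure lborel (I p)"
          by (intro emeasure_mono) (auto simp: I_def)
        also have "\<dots> = ennreal (2 * r)" using r by (simp add: I_def)
        finally have "ennreal (\<mu> p * \<mu> q) * emeasure lborel (I p \<inter> I q) \<le> ennreal (\<mu> p * \<mu> q) * ennreal (2 * r)"
          by (rule mult_left_mono) simp
        also have "\<dots> = ennreal (\<mu> p * \<mu> q * (2 * r))" using \<mu> r by (simp add: ennreal_mult)
        also have "\<mu> p * \<mu> q * (2 * r) = (2 * r)\<^sup>2 * (\<mu> p * \<mu> q / (2 * r))"
          using r by (simp add: power2_eq_square)
        also have "ennreal \<dots> = ennreal ((2 * r)\<^sup>2) * ennreal (\<mu> p * \<mu> q / (2 * r))"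
          using \<mu> r by (intro ennreal_mult) auto
        finally show ?thesis using True \<theta> by simp
      next
        case False
        then have "I p \<inter> I q = {}" by (auto simp: I_def inner_diff_left)
        then show ?thesis by simp
      qed
    qed
    also have "\<dots> = ennreal ((2 * r)\<^sup>2) * energy n P \<mu> \<theta>"
      unfolding energy_def r_def by (simp add: sum_distrib_left)
    finally show ?thesis .
  qed
  have "ennreal ((2 * r)\<^sup>2) * ennreal (M\<^sup>2) = (\<integral>\<^sup>+t. f t * indicator N t \<partial>lborel)\<^sup>2"
    unfolding int_f using r \<mu>
    by (simp add: ennreal_power M_def sum_nonneg power_mult_distrib flip: ennreal_mult)
  also have "\<dots> \<le> (\<integral>\<^sup>+t. (f t)\<^sup>2 \<partial>lborel) * (\<integral>\<^sup>+t. (indicator N t)\<^sup>2 \<partial>lborel)"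
    using N by (intro Cauchy_Schwarz_nn_integral) auto
  also have "(\<integral>\<^sup>+t. (indicator N t)\<^sup>2 \<partial>lborel) = emeasure lborel N"
  proof -
    have "(indicator N t)\<^sup>2 = (indicator N t :: ennreal)" for t by (simp add: indicator_def)
    then show ?thesis using N by simp
  qed
  also have "(\<integral>\<^sup>+t. (f t)\<^sup>2 \<partial>lborel) * emeasure lborel N \<le> ennreal ((2 * r)\<^sup>2) * (emeasure lborel N * energy n P \<mu> \<theta>)"
    using mult_right_mono[OF int_ff, of "emeasure lborel N"] by (simp add: mult_ac)
  finally have "ennreal ((2 * r)\<^sup>2) * ennreal (M\<^sup>2) \<le> ennreal ((2 * r)\<^sup>2) * (emeasure lborel N * energy n P \<mu> \<theta>)" .
  then show ?thesis using r by (simp add: ennreal_mult_le_mult_iff N_def r_def M_def)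
qed

text \<open>Integration over the directions turns each pair into \<open>direction_kernel\<close>.
  Its dyadic bound then leaves the masses of balls of radius 2^-k, each met by 9 cells of level
  k.\<close>

lemma nn_integral_energy_le:
  assumes P: "finite P" and \<mu>: "\<And>p. 0 \<le> \<mu> p"
    and bound: "\<And>k z. k \<le> n \<Longrightarrow> (\<Sum>p\<in>{p\<in>P. cell k p = z}. \<mu> p) \<le> g k"
  shows "(\<integral>\<^sup>+\<theta>. energy n P \<mu> \<theta> \<partial>lborel)
    \<le> ennreal (40 * (\<Sum>p\<in>P. \<mu> p) * ((\<Sum>p\<in>P. \<mu> p) + 9 * (\<Sum>k\<le>n. 2 ^ k * g k)))"
proof -
  define M where "M = (\<Sum>p\<in>P. \<mu> p)"
  define A where "A v = {\<theta>\<in>{0..pi}. \<bar>v \<bullet> dir \<theta>\<bar> \<le> 2 * (1/2) ^ n}" for v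
  have A[measurable]: "A v \<in> sets borel" for v
    unfolding A_def inner_dir by measurable
  have eA: "emeasure lborel (A v) = ennreal (measure lborel (A v))" for v
  proof (rule emeasure_eq_ennreal_measure)
    have "emeasure lborel (A v) \<le> emeasure lborel {0..pi}" by (rule emeasure_mono) (auto simp: A_def)
    then show "emeasure lborel (A v) \<noteq> top" by (auto simp: top_unique)
  qed
  have ker: "direction_kernel n v = measure lborel (A v) / (2 * (1/2) ^ n)" for v
    by (simp add: direction_kernel_def A_def)
  have ker0: "0 \<le> direction_kernel n v" for v unfolding ker by simp
  have "(\<integral>\<^sup>+\<theta>. energy n P \<mu> \<theta> \<partial>lborel) = (\<Sum>p\<in>P. \<Sum>q\<in>P. ennreal (\<mu> p * \<mu> q / (2 * (1/2) ^ n)) * emeasure lborel (A (p - q)))"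
    unfolding energy_def A_def[symmetric] by (simp add: nn_integral_sum nn_integral_cmult)
  also have "\<dots> = (\<Sum>p\<in>P. \<Sum>q\<in>P. ennreal (\<mu> p * \<mu> q * direction_kernel n (p - q)))"
  proof (intro sum.cong refl)
    fix p q
    have "ennreal (\<mu> p * \<mu> q / (2 * (1/2) ^ n)) * emeasure lborel (A (p - q))
        = ennreal (\<mu> p * \<mu> q / (2 * (1/2) ^ n) * measure lborel (A (p - q)))"
      unfolding eA using \<mu> by (intro ennreal_mult[symmetric]) auto
    then show "ennreal (\<mu> p * \<mu> q / (2 * (1/2) ^ n)) * emeasure lborel (A (p - q))
        = ennreal (\<mu> p * \<mu> q * direction_kernel n (p - q))" by (simp add: ker)
  qed
  also have "\<dots> = ennreal (\<Sum>p\<in>P. \<Sum>q\<in>P. \<mu> p * \<mu> q * direction_kernel n (p - q))"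
    using \<mu> ker0 by (simp add: sum_ennreal sum_nonneg)
  also have "\<dots> \<le> ennreal (\<Sum>p\<in>P. \<mu> p * (40 * (M + 9 * (\<Sum>k\<le>n. 2 ^ k * g k))))"
  proof (intro ennreal_leI sum_mono)
    fix p assume "p \<in> P"
    have "(\<Sum>q\<in>P. \<mu> q * direction_kernel n (p - q))
        \<le> (\<Sum>q\<in>P. \<mu> q * (40 * (1 + (\<Sum>k\<le>n. 2 ^ k * (if norm (p - q) \<le> (1/2) ^ k then 1 else 0)))))"
      using \<mu> by (intro sum_mono mult_left_mono direction_kernel_le) auto
    also have "\<dots> = 40 * (M + (\<Sum>q\<in>P. \<Sum>k\<le>n. 2 ^ k * (if norm (p - q) \<le> (1/2) ^ k then \<mu> q else 0)))"
      unfolding M_def sum.distrib[symmetric] sum_distrib_left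
      by (intro sum.cong refl) (auto simp: algebra_simps sum_distrib_left intro!: sum.cong)
    also have "(\<Sum>q\<in>P. \<Sum>k\<le>n. 2 ^ k * (if norm (p - q) \<le> (1/2) ^ k then \<mu> q else 0))
        = (\<Sum>k\<le>n. 2 ^ k * (\<Sum>q\<in>{q\<in>P. norm (p - q) \<le> (1/2) ^ k}. \<mu> q))"
      unfolding sum_distrib_left[symmetric] by (subst sum.swap) (simp add: sum_distrib_left[symmetric] sum.inter_filter P)
    also have "\<dots> \<le> (\<Sum>k\<le>n. 2 ^ k * (9 * g k))"
      using P \<mu> bound by (intro sum_mono mult_left_mono sum_ball_le) auto
    also have "\<dots> = 9 * (\<Sum>k\<le>n. 2 ^ k * g k)" by (simp add: sum_distrib_left mult_ac)
    finally have "(\<Sum>q\<in>P. \<mu> q * direction_kernel n (p - q)) \<le> 40 * (M + 9 * (\<Sum>k\<le>n. 2 ^ k * g k))" by simp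
    then have "\<mu> p * (\<Sum>q\<in>P. \<mu> q * direction_kernel n (p - q)) \<le> \<mu> p * (40 * (M + 9 * (\<Sum>k\<le>n. 2 ^ k * g k)))"
      using \<mu> by (rule mult_left_mono)
    then show "(\<Sum>q\<in>P. \<mu> p * \<mu> q * direction_kernel n (p - q)) \<le> \<mu> p * (40 * (M + 9 * (\<Sum>k\<le>n. 2 ^ k * g k)))"
      by (simp add: sum_distrib_left mult.assoc)
  qed
  also have "(\<Sum>p\<in>P. \<mu> p * (40 * (M + 9 * (\<Sum>k\<le>n. 2 ^ k * g k)))) = 40 * M * (M + 9 * (\<Sum>k\<le>n. 2 ^ k * g k))"
    by (simp add: M_def sum_distrib_right[symmetric])
  finally show ?thesis unfolding M_def .
qed

lemma finite_cell_image:
  assumes "bounded K" shows "finite (cell n ` K)"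
proof -
  obtain B where B: "\<And>x. x \<in> K \<Longrightarrow> norm x \<le> B" using assms by (auto simp: bounded_iff)
  have *: "\<lfloor>2 ^ n * x $ i\<rfloor> \<in> {\<lfloor>- (2 ^ n * B)\<rfloor>..\<lfloor>2 ^ n * B\<rfloor>}" if "x \<in> K" for x i
  proof -
    have "\<bar>x $ i\<bar> \<le> B" using B[OF that] component_le_norm_cart[of x i] by linarith
    then have "\<bar>2 ^ n * x $ i\<bar> \<le> 2 ^ n * B" by (simp add: abs_mult)
    then have "- (2 ^ n * B) \<le> 2 ^ n * x $ i" "2 ^ n * x $ i \<le> 2 ^ n * B" by linarith+
    then show ?thesis by (auto intro: floor_mono)
  qed
  then have "cell n ` K \<subseteq> {\<lfloor>- (2 ^ n * B)\<rfloor>..\<lfloor>2 ^ n * B\<rfloor>} \<times> {\<lfloor>- (2 ^ n * B)\<rfloor>..\<lfloor>2 ^ n * B\<rfloor>}"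
    unfolding cell_def by blast
  then show ?thesis by (rule finite_subset) simp
qed

text \<open>One point of \<open>K\<close> is chosen from every cell of level \<open>n\<close> that
  \<open>K\<close> meets, and the greedy mass is put on these points.\<close>

lemma discrete_frostman:
  assumes "bounded K" and g: "\<And>k. 0 < g k"
  obtains P \<mu> where "finite P" "P \<subseteq> K" "\<And>p. 0 \<le> \<mu> p"
    "\<And>k z. k \<le> n \<Longrightarrow> (\<Sum>p\<in>{p\<in>P. cell k p = z}. \<mu> p) \<le> g k"
    "net_content g K \<le> ennreal (\<Sum>p\<in>P. \<mu> p)"
proof -
  obtain P where P: "P \<subseteq> K" "finite P" "cell n ` K = cell n ` P"
    using finite_subset_image[OF finite_cell_image[OF assms(1), of n] order_refl] by metis
  obtain \<mu> where \<mu>: "\<And>p. 0 \<le> \<mu> p" "\<And>k z. k \<le> n \<Longrightarrow> (\<Sum>p\<in>{p\<in>P. cell k p = z}. \<mu> p) \<le> g k"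
    "\<And>p. p \<in> P \<Longrightarrow> \<exists>k\<le>n. (\<Sum>q\<in>{q\<in>P. cell k q = cell k p}. \<mu> q) = g k"
    using greedy_mass[OF P(2), of g n] g by blast
  have "\<exists>p\<in>P. cell n p = cell n x" if "x \<in> K" for x using that P(3) by (metis imageE imageI)
  then have "net_content g K \<le> ennreal (\<Sum>p\<in>P. \<mu> p)"
    using saturated_mass_ge_net_content[OF P(2) \<mu>(1) \<mu>(3) _ g] by blast
  then show ?thesis using that[of P \<mu>] P \<mu> by blast
qed

text \<open>The measures for different scales are unrelated; Fatou's lemma takes the place of a
  limit measure. The normalised energies \<Psi> n have bounded integrals, so their lower limit is
  finite in almost every direction, whereas a null projection would force the lengths to 0 and
  \<Psi> n to infinity.\<close>

theorem projection_positive: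
  fixes g :: "nat \<Rightarrow> real"
  assumes K: "compact K" and g: "\<And>k. 0 < g k" and sum: "summable (\<lambda>k. 2 ^ k * g k)"
    and pos: "net_content g K > 0"
  shows "AE \<theta> in lborel. \<theta> \<in> {0..pi} \<longrightarrow> emeasure lborel ((\<lambda>x. x \<bullet> dir \<theta>) ` K) > 0"
proof -
  obtain c' where c': "0 < c'" "c' < net_content g K" using dense[OF pos] by blast
  then obtain c where c: "0 < c" "ennreal c < net_content g K"
    by (cases c') (auto simp: less_top[symmetric])
  define S where "S = (\<Sum>k. 2 ^ k * g k)"
  have S: "(\<Sum>k\<le>n. 2 ^ k * g k) \<le> S" for n
    unfolding S_def using g by (intro sum_le_suminf sum) (auto intro: less_imp_le)
  have S0: "0 \<le> S" unfolding S_def using g by (intro suminf_nonneg sum) (auto intro: less_imp_le)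
  define N where "N n \<theta> = projection_nbhd K ((1/2) ^ n) \<theta>" for n \<theta>
  \<comment> \<open>This is 40 M (M + 9 S) / M^2 with the total mass M, which depends on the scale,
    replaced by its lower bound \<open>c\<close>.\<close>
  define C where "C = 40 * (1 + 9 * S / c)"
  have "\<exists>\<Psi>::real \<Rightarrow> ennreal. \<Psi> \<in> borel_measurable lborel \<and> (\<integral>\<^sup>+\<theta>. \<Psi> \<theta> \<partial>lborel) \<le> ennreal C \<and>
      (\<forall>\<theta>\<in>{0..pi}. 1 \<le> emeasure lborel (N n \<theta>) * \<Psi> \<theta>)" for n
  proof -
    obtain P \<mu> where P: "finite P" "P \<subseteq> K" and \<mu>: "\<And>p. 0 \<le> \<mu> p"
      "\<And>k z. k \<le> n \<Longrightarrow> (\<Sum>p\<in>{p\<in>P. cell k p = z}. \<mu> p) \<le> g k"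
      "net_content g K \<le> ennreal (\<Sum>p\<in>P. \<mu> p)"
      by (rule discrete_frostman[where K = K and g = g and n = n, OF compact_imp_bounded[OF K] g]) (rule that)
    define M where "M = (\<Sum>p\<in>P. \<mu> p)"
    have cM: "c < M" using less_le_trans[OF c(2) \<mu>(3)] c(1) by (auto simp: M_def ennreal_less_iff)
    define \<Psi> where "\<Psi> \<theta> = ennreal (1 / M\<^sup>2) * energy n P \<mu> \<theta>" for \<theta>
    have meas: "energy n P \<mu> \<in> borel_measurable lborel"
      unfolding energy_def inner_dir by measurable
    have "(\<integral>\<^sup>+\<theta>. \<Psi> \<theta> \<partial>lborel) = ennreal (1 / M\<^sup>2) * (\<integral>\<^sup>+\<theta>. energy n P \<mu> \<theta> \<partial>lborel)"
      unfolding \<Psi>_def using meas by (rule nn_integral_cmult)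
    also have "\<dots> \<le> ennreal (1 / M\<^sup>2) * ennreal (40 * M * (M + 9 * (\<Sum>k\<le>n. 2 ^ k * g k)))"
      unfolding M_def by (intro mult_left_mono nn_integral_energy_le P \<mu>) auto
    also have "\<dots> = ennreal (1 / M\<^sup>2 * (40 * M * (M + 9 * (\<Sum>k\<le>n. 2 ^ k * g k))))"
      by (rule ennreal_mult'[symmetric]) simp
    also have "\<dots> \<le> ennreal C"
    proof (rule ennreal_leI)
      have "1 / M\<^sup>2 * (40 * M * (M + 9 * (\<Sum>k\<le>n. 2 ^ k * g k))) = 40 * (1 + 9 * (\<Sum>k\<le>n. 2 ^ k * g k) / M)"
        using cM c(1) by (simp add: power2_eq_square field_simps)
      also have "\<dots> \<le> C" unfolding C_def using S[of n] S0 cM c(1)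
        by (intro mult_left_mono add_left_mono frac_le) auto
      finally show "1 / M\<^sup>2 * (40 * M * (M + 9 * (\<Sum>k\<le>n. 2 ^ k * g k))) \<le> C" .
    qed
    finally have 1: "(\<integral>\<^sup>+\<theta>. \<Psi> \<theta> \<partial>lborel) \<le> ennreal C" .
    have "1 \<le> emeasure lborel (N n \<theta>) * \<Psi> \<theta>" if "\<theta> \<in> {0..pi}" for \<theta>
    proof -
      have "(1::ennreal) = ennreal (1 / M\<^sup>2) * ennreal (M\<^sup>2)"
        using cM c(1) by (subst ennreal_mult[symmetric]) auto
      also have "\<dots> \<le> ennreal (1 / M\<^sup>2) * (emeasure lborel (N n \<theta>) * energy n P \<mu> \<theta>)"
        unfolding M_def N_def by (intro mult_left_mono projection_nbhd_energy K P \<mu> that) auto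
      finally show ?thesis by (simp add: \<Psi>_def mult_ac)
    qed
    moreover have "\<Psi> \<in> borel_measurable lborel" unfolding \<Psi>_def using meas by measurable
    ultimately show ?thesis using 1 by blast
  qed
  then have "\<forall>n. \<exists>\<Psi>::real \<Rightarrow> ennreal. \<Psi> \<in> borel_measurable lborel \<and> (\<integral>\<^sup>+\<theta>. \<Psi> \<theta> \<partial>lborel) \<le> ennreal C \<and>
      (\<forall>\<theta>\<in>{0..pi}. 1 \<le> emeasure lborel (N n \<theta>) * \<Psi> \<theta>)" ..
  from choice[OF this] obtain \<Psi> :: "nat \<Rightarrow> real \<Rightarrow> ennreal" where \<Psi>: "\<And>n. \<Psi> n \<in> borel_measurable lborel"
    "\<And>n. (\<integral>\<^sup>+\<theta>. \<Psi> n \<theta> \<partial>lborel) \<le> ennreal C"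
    "\<And>n \<theta>. \<theta> \<in> {0..pi} \<Longrightarrow> 1 \<le> emeasure lborel (N n \<theta>) * \<Psi> n \<theta>" by blast
  have "(\<integral>\<^sup>+\<theta>. liminf (\<lambda>n. \<Psi> n \<theta>) \<partial>lborel) \<le> liminf (\<lambda>n. \<integral>\<^sup>+\<theta>. \<Psi> n \<theta> \<partial>lborel)"
    by (rule nn_integral_liminf[OF \<Psi>(1)])
  also have "\<dots> \<le> liminf (\<lambda>n. ennreal C)" using \<Psi>(2) by (intro Liminf_mono) auto
  also have "\<dots> = ennreal C" by (simp add: Liminf_const)
  finally have "(\<integral>\<^sup>+\<theta>. liminf (\<lambda>n. \<Psi> n \<theta>) \<partial>lborel) \<noteq> \<infinity>" by (auto simp: top_unique)
  then have "AE \<theta> in lborel. liminf (\<lambda>n. \<Psi> n \<theta>) \<noteq> \<infinity>"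
    by (intro nn_integral_PInf_AE borel_measurable_liminf \<Psi>(1))
  then show ?thesis
  proof eventually_elim
    case (elim \<theta>)
    show ?case
    proof (intro impI, rule ccontr)
      assume \<theta>: "\<theta> \<in> {0..pi}" and "\<not> 0 < emeasure lborel ((\<lambda>x. x \<bullet> dir \<theta>) ` K)"
      then have null: "emeasure lborel ((\<lambda>x. x \<bullet> dir \<theta>) ` K) = 0" by simp
      have comp: "compact (N n \<theta>)" for n unfolding N_def by (rule compact_projection_nbhd[OF K])
      have "(\<Inter>n. N n \<theta>) = (\<lambda>x. x \<bullet> dir \<theta>) ` K"
      proof (intro equalityI subsetI)
        fix t assume t: "t \<in> (\<Inter>n. N n \<theta>)"
        have "closed ((\<lambda>x. x \<bullet> dir \<theta>) ` K)"
          by (intro compact_imp_closed compact_continuous_image K continuous_intros)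
        moreover have "\<exists>y\<in>(\<lambda>x. x \<bullet> dir \<theta>) ` K. dist y t < e" if e: "e > 0" for e
        proof -
          obtain n where n: "(1/2) ^ n < e" using real_arch_pow_inv[OF e, of "1/2"] by auto
          have "t \<in> N n \<theta>" using t by blast
          then obtain x where "x \<in> K" "\<bar>t - x \<bullet> dir \<theta>\<bar> \<le> (1/2) ^ n"
            by (auto simp: N_def projection_nbhd_def)
          then show ?thesis using n by (intro bexI[of _ "x \<bullet> dir \<theta>"]) (auto simp: dist_real_def)
        qed
        ultimately show "t \<in> (\<lambda>x. x \<bullet> dir \<theta>) ` K" using closed_approachable by blast
      qed (force simp: N_def projection_nbhd_def)
      moreover have "(\<lambda>n. emeasure lborel (N n \<theta>)) \<longlonglongrightarrow> emeasure lborel (\<Inter>n. N n \<theta>)"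
      proof (rule Lim_emeasure_decseq)
        show "range (\<lambda>n. N n \<theta>) \<subseteq> sets lborel" using comp by (auto intro: borel_compact)
        show "decseq (\<lambda>n. N n \<theta>)"
        proof (rule decseq_SucI)
          fix n
          have le: "(1/2 :: real) ^ Suc n \<le> (1/2) ^ n" by simp
          show "N (Suc n) \<theta> \<subseteq> N n \<theta>" unfolding N_def projection_nbhd_def
            using order_trans[OF _ le] by blast
        qed
        show "emeasure lborel (N n \<theta>) \<noteq> \<infinity>" for n
          using emeasure_compact_finite[OF comp[of n]] by simp
      qed
      ultimately have lim: "(\<lambda>n. emeasure lborel (N n \<theta>)) \<longlonglongrightarrow> 0" using null by simp
      have "ennreal B \<le> liminf (\<lambda>n. \<Psi> n \<theta>)" if B: "B > 0" for B
      proof (rule Liminf_bounded)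
        have "\<forall>\<^sub>F n in sequentially. emeasure lborel (N n \<theta>) < ennreal (1 / B)"
          using lim B by (intro order_tendstoD(2)) auto
        then show "\<forall>\<^sub>F n in sequentially. ennreal B \<le> \<Psi> n \<theta>"
        proof eventually_elim
          case (elim n)
          have "ennreal B \<le> ennreal B * (emeasure lborel (N n \<theta>) * \<Psi> n \<theta>)"
            using mult_left_mono[OF \<Psi>(3)[OF \<theta>, of n], of "ennreal B"] by simp
          also have "\<dots> \<le> ennreal B * (ennreal (1 / B) * \<Psi> n \<theta>)"
            using elim by (intro mult_left_mono mult_right_mono) auto
          also have "\<dots> = \<Psi> n \<theta>"
            using B by (simp add: mult.assoc[symmetric] ennreal_mult[symmetric])
          finally show ?case .
        qed
      qed
      note large = this
      obtain b where b: "liminf (\<lambda>n. \<Psi> n \<theta>) = ennreal b" "0 \<le> b"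
        using elim by (cases "liminf (\<lambda>n. \<Psi> n \<theta>)") auto
      then show False using large[of "b + 1"] by (simp add: ennreal_le_iff2)
    qed
  qed
qed

section \<open>Hitting probabilities of random dyadic patterns\<close>

text \<open>The unit square has the projection \<open>[lo c s, hi c s]\<close> in the direction \<open>(c, s)\<close>. A bit
  \<open>True\<close> keeps all four quarters of a square, a bit \<open>False\<close> keeps one quarter chosen uniformly at
  random; \<open>hit_prob c s bs t\<close> is the probability that the line \<open>{x. x \<bullet> (c, s) = t}\<close> meets one
  of the open squares that remain after the steps \<open>bs\<close>.\<close>

definition lo :: "real \<Rightarrow> real \<Rightarrow> real" where "lo c s = min 0 c + min 0 s"
definition hi :: "real \<Rightarrow> real \<Rightarrow> real" where "hi c s = max 0 c + max 0 s"

fun hit_prob :: "real \<Rightarrow> real \<Rightarrow> bool list \<Rightarrow> real \<Rightarrow> real" where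
  "hit_prob c s [] t = (if lo c s < t \<and> t < hi c s then 1 else 0)"
| "hit_prob c s (True # bs) t = 1 - (1 - hit_prob c s bs (2 * t)) * (1 - hit_prob c s bs (2 * t - c))
     * ((1 - hit_prob c s bs (2 * t - s)) * (1 - hit_prob c s bs (2 * t - c - s)))"
| "hit_prob c s (False # bs) t = (hit_prob c s bs (2 * t) + hit_prob c s bs (2 * t - c)
     + hit_prob c s bs (2 * t - s) + hit_prob c s bs (2 * t - c - s)) / 4"

lemma hit_prob_bounds: "0 \<le> hit_prob c s bs t \<and> hit_prob c s bs t \<le> 1"
proof (induction bs arbitrary: t)
  case (Cons b bs)
  show ?case
  proof (cases b)
    case True
    have "0 \<le> (1 - hit_prob c s bs (2 * t)) * (1 - hit_prob c s bs (2 * t - c))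
     * ((1 - hit_prob c s bs (2 * t - s)) * (1 - hit_prob c s bs (2 * t - c - s)))"
      using Cons.IH by (intro mult_nonneg_nonneg) auto
    moreover have "(1 - hit_prob c s bs (2 * t)) * (1 - hit_prob c s bs (2 * t - c))
     * ((1 - hit_prob c s bs (2 * t - s)) * (1 - hit_prob c s bs (2 * t - c - s))) \<le> 1"
      using Cons.IH by (intro mult_le_one mult_nonneg_nonneg) auto
    ultimately show ?thesis using True by simp
  next
    case False
    then show ?thesis using Cons.IH[of "2 * t"] Cons.IH[of "2 * t - c"] Cons.IH[of "2 * t - s"]
        Cons.IH[of "2 * t - c - s"] by simp
  qed
qed simp

lemma hit_prob_support: "hit_prob c s bs t \<noteq> 0 \<Longrightarrow> lo c s < t \<and> t < hi c s"
proof (induction bs arbitrary: t)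
  case (Cons b bs)
  have "hit_prob c s bs (2 * t) \<noteq> 0 \<or> hit_prob c s bs (2 * t - c) \<noteq> 0 \<or>
      hit_prob c s bs (2 * t - s) \<noteq> 0 \<or> hit_prob c s bs (2 * t - c - s) \<noteq> 0"
    using Cons.prems by (cases b) auto
  then show ?case using Cons.IH by (auto simp: lo_def hi_def dest!: Cons.IH split: if_splits)
qed (auto split: if_splits)

text \<open>Two diagonally opposite open quarters project to disjoint intervals, separated by the
  midpoint of the projected square; the signs of \<open>c\<close> and \<open>s\<close> decide which
  diagonal. The strict inequalities for the empty list matter here.\<close>

lemma hit_prob_misses_quarter:
  "hit_prob c s bs (2 * t) = 0 \<or> hit_prob c s bs (2 * t - c) = 0 \<or>
   hit_prob c s bs (2 * t - s) = 0 \<or> hit_prob c s bs (2 * t - c - s) = 0"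
proof (rule ccontr)
  assume "\<not> ?thesis"
  then show False
    using hit_prob_support[of c s bs "2 * t"] hit_prob_support[of c s bs "2 * t - c"]
      hit_prob_support[of c s bs "2 * t - s"] hit_prob_support[of c s bs "2 * t - c - s"]
    by (auto simp: lo_def hi_def min_def max_def split: if_splits)
qed

text \<open>With \<open>tanh\<close> as the uniformising parameter (\<open>conduct (1 - exp (-2 a)) = tanh a\<close>), a union of
  independent events is at most the parallel connection of conductances.\<close>

definition conduct :: "real \<Rightarrow> real" where "conduct h = h / (2 - h)"

lemma conduct_nonneg: "0 \<le> h \<Longrightarrow> h \<le> 1 \<Longrightarrow> 0 \<le> conduct h"
  by (simp add: conduct_def)

lemma conduct_mono: "0 \<le> h \<Longrightarrow> h \<le> h' \<Longrightarrow> h' \<le> 1 \<Longrightarrow> conduct h \<le> conduct h'"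
  by (auto simp: conduct_def intro!: frac_le)

lemma conduct_inverse: "0 \<le> h \<Longrightarrow> h \<le> 1 \<Longrightarrow> h = 2 * conduct h / (1 + conduct h)"
  by (simp add: conduct_def field_simps)

lemma le_2_conduct: "0 \<le> h \<Longrightarrow> h \<le> 1 \<Longrightarrow> h \<le> 2 * conduct h"
  by (simp add: conduct_def field_simps mult_left_le)

text \<open>In the parameter of \<open>tanh\<close> this is the subadditivity tanh (a + b) <= tanh a
  + tanh b for nonnegative a and b.\<close>

lemma conduct_union:
  assumes "0 \<le> x" "x \<le> 1" "0 \<le> y" "y \<le> 1"
  shows "conduct (1 - (1 - x) * (1 - y)) \<le> conduct x + conduct y"
proof -
  define z where "z = 1 - (1 - x) * (1 - y)"
  have "0 \<le> (1 - x) * (1 - y)" "(1 - x) * (1 - y) \<le> 1" using assms by (auto intro!: mult_le_one)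
  then have z: "0 \<le> z" "z \<le> 1" by (auto simp: z_def)
  have den: "(2 - x) * (2 - y) = 4 - 2 * z - x * y" by (simp add: z_def algebra_simps)
  have "conduct x + conduct y = (x * (2 - y) + y * (2 - x)) / ((2 - x) * (2 - y))"
    using assms by (simp add: conduct_def add_frac_eq)
  also have "x * (2 - y) + y * (2 - x) = 2 * z" by (simp add: z_def algebra_simps)
  also have "2 * z / ((2 - x) * (2 - y)) \<ge> 2 * z / (4 - 2 * z)"
  proof (rule divide_left_mono)
    show "(2 - x) * (2 - y) \<le> 4 - 2 * z" unfolding den using assms by simp
    show "0 < (4 - 2 * z) * ((2 - x) * (2 - y))" using z assms by (intro mult_pos_pos) auto
  qed (use z in simp)
  also have "2 * z / (4 - 2 * z) = 2 * z / (2 * (2 - z))" by simp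
  also have "\<dots> = conduct z" unfolding conduct_def by (rule mult_divide_mult_cancel_left) simp
  finally show ?thesis by (simp add: z_def)
qed

text \<open>Jensen's inequality for the concave map x / (a + x), by its tangent at v = (sum of u) /
  n. The tangent has a nonnegative value at 0, so \<open>n\<close> may exceed the number of terms,
  as if zeros were added.\<close>

lemma concave_sum_bound:
  fixes u :: "'a \<Rightarrow> real"
  assumes fin: "finite I" and u: "\<And>i. i \<in> I \<Longrightarrow> 0 \<le> u i" and a: "a > 0" and n: "real (card I) \<le> n" "n > 0"
  shows "(\<Sum>i\<in>I. u i / (a + u i)) \<le> n * (\<Sum>i\<in>I. u i) / (a * n + (\<Sum>i\<in>I. u i))"
proof -
  define v where "v = (\<Sum>i\<in>I. u i) / n"
  have v: "v \<ge> 0" unfolding v_def using u n by (intro divide_nonneg_pos sum_nonneg) auto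
  have tangent: "x / (a + x) \<le> v / (a + v) + a / (a + v)\<^sup>2 * (x - v)" if "x \<ge> 0" for x
  proof -
    define A X where "A = a + v" and "X = a + x"
    have AX: "A > 0" "X > 0" using a v that by (auto simp: A_def X_def)
    have "0 \<le> a * ((X - A)\<^sup>2 / (X * A\<^sup>2))" using a AX by simp
    also have "(X - A)\<^sup>2 / (X * A\<^sup>2) = 1 / X - 1 / A + (X - A) / A\<^sup>2"
      using AX by (simp add: field_simps power2_eq_square)
    also have "a * \<dots> = (1 - a / A) + a / A\<^sup>2 * (X - A) - (1 - a / X)"
      by (simp add: algebra_simps)
    also have "1 - a / A = v / A" using AX by (simp add: A_def field_simps)
    also have "1 - a / X = x / X" using AX by (simp add: X_def field_simps)
    finally show ?thesis by (simp add: A_def X_def)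
  qed
  have "(\<Sum>i\<in>I. u i / (a + u i)) \<le> (\<Sum>i\<in>I. v / (a + v) + a / (a + v)\<^sup>2 * (u i - v))"
    using tangent u by (intro sum_mono) auto
  also have "\<dots> = real (card I) * (v / (a + v) - a / (a + v)\<^sup>2 * v) + a / (a + v)\<^sup>2 * (\<Sum>i\<in>I. u i)"
  proof -
    have "v / (a + v) + a / (a + v)\<^sup>2 * (u i - v) = (v / (a + v) - a / (a + v)\<^sup>2 * v) + a / (a + v)\<^sup>2 * u i" for i
      by (simp add: right_diff_distrib)
    then show ?thesis by (simp only: sum.distrib sum_distrib_left sum_constant)
  qed
  also have "\<dots> \<le> n * (v / (a + v) - a / (a + v)\<^sup>2 * v) + a / (a + v)\<^sup>2 * (\<Sum>i\<in>I. u i)"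
  proof -
    have "v / (a + v) - a / (a + v)\<^sup>2 * v = (v * (a + v) - a * v) / (a + v)\<^sup>2"
      using a v by (simp add: diff_divide_distrib power2_eq_square)
    also have "v * (a + v) - a * v = v\<^sup>2" by (simp add: algebra_simps power2_eq_square)
    finally have "v / (a + v) - a / (a + v)\<^sup>2 * v = v\<^sup>2 / (a + v)\<^sup>2" .
    then have "0 \<le> v / (a + v) - a / (a + v)\<^sup>2 * v" by simp
    with n(1) show ?thesis by (intro add_right_mono mult_right_mono)
  qed
  also have "(\<Sum>i\<in>I. u i) = n * v" using n(2) by (simp add: v_def)
  also have "n * (v / (a + v) - a / (a + v)\<^sup>2 * v) + a / (a + v)\<^sup>2 * (n * v) = n * v / (a + v)"
    by (simp add: algebra_simps)
  also have "\<dots> = n * (n * v) / (n * (a + v))" using n(2) by simp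
  also have "n * (a + v) = a * n + n * v" by (simp add: algebra_simps)
  finally show ?thesis using n(2) by (simp add: v_def)
qed

text \<open>The gain in the denominator comes from the fact that a line meets at most three of the four
  open quarters.\<close>

lemma conduct_average:
  assumes h: "\<And>i. i < 4 \<Longrightarrow> 0 \<le> h i \<and> h i \<le> 1" and z: "j < (4::nat)" "h j = 0"
  shows "conduct ((\<Sum>i<4. h i) / 4) \<le> 3 * (\<Sum>i<4. conduct (h i)) / (12 + (\<Sum>i<4. conduct (h i)))"
proof -
  let ?I = "{..<4} - {j}"
  define g where "g = (\<Sum>i<4. conduct (h i))"
  have g0: "0 \<le> g" unfolding g_def using h by (intro sum_nonneg conduct_nonneg) auto
  have "conduct (h j) = 0" using z by (simp add: conduct_def)
  then have gI: "(\<Sum>i\<in>?I. conduct (h i)) = g" unfolding g_def using z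
    by (subst (2) sum.remove[of _ j]) auto
  have "(\<Sum>i<4. h i) = (\<Sum>i\<in>?I. h i)" using z by (subst sum.remove[of _ j]) auto
  also have "\<dots> = 2 * (\<Sum>i\<in>?I. conduct (h i) / (1 + conduct (h i)))"
    unfolding sum_distrib_left using h by (intro sum.cong refl) (use conduct_inverse in auto)
  moreover define Z where "Z = 3 * g / (1 * 3 + g)"
  moreover have "(\<Sum>i\<in>?I. conduct (h i) / (1 + conduct (h i))) \<le> Z"
    unfolding Z_def gI[symmetric] using z h by (intro concave_sum_bound conduct_nonneg) auto
  ultimately have "(\<Sum>i<4. h i) / 4 \<le> 2 * Z / 4" by linarith
  also have "\<dots> = 3 * g / (2 * (3 + g))" using g0 by (simp add: Z_def divide_simps)
  finally have *: "(\<Sum>i<4. h i) / 4 \<le> 3 * g / (2 * (3 + g))" .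
  have "conduct ((\<Sum>i<4. h i) / 4) \<le> conduct (3 * g / (2 * (3 + g)))" if "g \<le> 3"
    using * that g0 h by (intro conduct_mono) (auto intro!: sum_nonneg simp: field_simps)
  moreover have "g \<le> 3"
  proof -
    have "g \<le> (\<Sum>i\<in>?I. 1)" unfolding gI[symmetric]
      using h by (intro sum_mono) (auto simp: conduct_def divide_le_eq)
    then show ?thesis using z by simp
  qed
  \<comment> \<open>In resistances the value is 4/g + 1/3: averaging over quarters gives 4/g, and
    the missed quarter adds 1/3. With four nonzero terms the same computation would give g/4 and no
    gain.\<close>
  moreover have "conduct (3 * g / (2 * (3 + g))) = 3 * g / (12 + g)"
  proof -
    define D where "D = 2 * (3 + g)"
    have D: "D > 0" using g0 by (simp add: D_def)
    have "2 - 3 * g / D = (12 + g) / D" using D by (simp add: field_simps D_def)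
    then have "conduct (3 * g / D) = (3 * g / D) / ((12 + g) / D)" by (simp add: conduct_def)
    also have "\<dots> = 3 * g / (12 + g)" using D by simp
    finally show ?thesis by (simp add: D_def)
  qed
  ultimately show ?thesis by (simp add: g_def)
qed

definition quarter_sum :: "real \<Rightarrow> real \<Rightarrow> (real \<Rightarrow> real) \<Rightarrow> real \<Rightarrow> real" where
  "quarter_sum c s f t = f (2 * t) + f (2 * t - c) + f (2 * t - s) + f (2 * t - c - s)"

lemma conduct_True:
  "conduct (hit_prob c s (True # bs) t) \<le> quarter_sum c s (\<lambda>u. conduct (hit_prob c s bs u)) t"
proof -
  let ?h = "hit_prob c s bs"
  define x where "x = 1 - (1 - ?h (2 * t)) * (1 - ?h (2 * t - c))"
  define y where "y = 1 - (1 - ?h (2 * t - s)) * (1 - ?h (2 * t - c - s))"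
  have x: "0 \<le> x" "x \<le> 1" and y: "0 \<le> y" "y \<le> 1"
    unfolding x_def y_def using hit_prob_bounds[of c s bs] by (auto intro!: mult_le_one)
  have "hit_prob c s (True # bs) t = 1 - (1 - x) * (1 - y)" by (simp add: x_def y_def)
  then have "conduct (hit_prob c s (True # bs) t) \<le> conduct x + conduct y"
    using conduct_union[OF x y] by simp
  also have "conduct x \<le> conduct (?h (2 * t)) + conduct (?h (2 * t - c))"
    unfolding x_def using hit_prob_bounds[of c s bs] by (intro conduct_union) auto
  also have "conduct y \<le> conduct (?h (2 * t - s)) + conduct (?h (2 * t - c - s))"
    unfolding y_def using hit_prob_bounds[of c s bs] by (intro conduct_union) auto
  finally show ?thesis by (simp add: quarter_sum_def)
qed

lemma conduct_False:
  fixes c s t :: real and bs :: "bool list"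
  defines "g \<equiv> quarter_sum c s (\<lambda>u. conduct (hit_prob c s bs u)) t"
  shows "conduct (hit_prob c s (False # bs) t) \<le> 3 * (g / (12 + g))"
proof -
  define u where "u i = [2 * t, 2 * t - c, 2 * t - s, 2 * t - c - s] ! i" for i
  have 4: "(\<Sum>i<4. f (u i)) = quarter_sum c s f t" for f :: "real \<Rightarrow> real"
    by (simp add: u_def quarter_sum_def eval_nat_numeral)
  have "\<exists>j<4. hit_prob c s bs (u j) = 0"
    using hit_prob_misses_quarter[of c s bs t]
  proof (elim disjE)
    assume "hit_prob c s bs (2 * t) = 0" then show ?thesis by (intro exI[of _ 0]) (simp add: u_def)
  next
    assume "hit_prob c s bs (2 * t - c) = 0" then show ?thesis by (intro exI[of _ 1]) (simp add: u_def)
  next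
    assume "hit_prob c s bs (2 * t - s) = 0" then show ?thesis by (intro exI[of _ 2]) (simp add: u_def)
  next
    assume "hit_prob c s bs (2 * t - c - s) = 0" then show ?thesis by (intro exI[of _ 3]) (simp add: u_def)
  qed
  then obtain j where "j < 4" "hit_prob c s bs (u j) = 0" by blast
  then have "conduct ((\<Sum>i<4. hit_prob c s bs (u i)) / 4) \<le>
      3 * (\<Sum>i<4. conduct (hit_prob c s bs (u i))) / (12 + (\<Sum>i<4. conduct (hit_prob c s bs (u i))))"
    using hit_prob_bounds by (intro conduct_average) auto
  then show ?thesis unfolding 4[of "hit_prob c s bs"] 4[of "\<lambda>u. conduct (hit_prob c s bs u)"] g_def
    by (simp add: quarter_sum_def)
qed

text \<open>The sum of \<open>f\<close> over all 4^i squares of side 2^-i, with the offset of the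
  line expressed in the rescaled coordinates of the square with corner (p, q) / 2^i.\<close>

definition grid_sum :: "real \<Rightarrow> real \<Rightarrow> nat \<Rightarrow> (real \<Rightarrow> real) \<Rightarrow> real \<Rightarrow> real" where
  "grid_sum c s i f t = (\<Sum>p<2 ^ i. \<Sum>q<2 ^ i. f (2 ^ i * t - real p * c - real q * s))"

lemma sum_lessThan_double: "(\<Sum>p<2 * N. f p) = (\<Sum>p<N. f (2 * p) + f (2 * p + 1))"
  for f :: "nat \<Rightarrow> 'a::comm_monoid_add"
  by (induction N) (auto simp: add_ac)

lemma grid_sum_Suc: "grid_sum c s (Suc i) f t = grid_sum c s i (quarter_sum c s f) t"
  unfolding grid_sum_def power_Suc sum_lessThan_double
  by (intro sum.cong refl) (simp add: sum.distrib quarter_sum_def algebra_simps)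

lemma card_le_2_if_close:
  fixes A :: "nat set"
  assumes "\<And>x y. x \<in> A \<Longrightarrow> y \<in> A \<Longrightarrow> \<bar>real x - real y\<bar> < 2"
  shows "card A \<le> 2"
proof (cases "A = {}")
  case False
  define m where "m = (LEAST x. x \<in> A)"
  have m: "m \<in> A" unfolding m_def using False by (intro LeastI_ex[of "\<lambda>x. x \<in> A"]) auto
  have "A \<subseteq> {m, Suc m}"
  proof
    fix x assume x: "x \<in> A"
    have "m \<le> x" unfolding m_def using x by (rule Least_le)
    moreover have "real x < real m + 2" using assms[OF x m] by linarith
    ultimately show "x \<in> {m, Suc m}" by auto
  qed
  then have "card A \<le> card {m, Suc m}" by (intro card_mono) auto
  then show ?thesis by simp
qed simp

text \<open>If |s| <= |c|, the projection of a square has width at most 2 |c| while neighbours in a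
  row are shifted by |c|, so a line meets at most two open squares per row. Otherwise rows and
  columns are exchanged.\<close>

lemma card_hit_squares:
  assumes "c \<noteq> 0 \<or> s \<noteq> 0"
  shows "card {(p, q). p < N \<and> q < N \<and> lo c s < t - real p * c - real q * s \<and> t - real p * c - real q * s < hi c s} \<le> 2 * N"
proof -
  have main: "card {(p, q). p < N \<and> q < N \<and> lo c s < t - real p * c - real q * s \<and> t - real p * c - real q * s < hi c s} \<le> 2 * N"
    if c: "c \<noteq> 0" "\<bar>s\<bar> \<le> \<bar>c\<bar>" for c s :: real
  proof -
    define A where "A q = {p. p < N \<and> lo c s < t - real p * c - real q * s \<and> t - real p * c - real q * s < hi c s}" for q
    have "card (A q) \<le> 2" for q
    proof (rule card_le_2_if_close)
      fix x y assume "x \<in> A q" "y \<in> A q"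
      then have "\<bar>(real x - real y) * c\<bar> < hi c s - lo c s"
        by (auto simp: A_def abs_less_iff algebra_simps)
      also have "\<dots> \<le> 2 * \<bar>c\<bar>" using c(2) by (auto simp: hi_def lo_def)
      finally show "\<bar>real x - real y\<bar> < 2" using c(1) by (simp add: abs_mult)
    qed
    moreover have "{(p, q). p < N \<and> q < N \<and> lo c s < t - real p * c - real q * s \<and> t - real p * c - real q * s < hi c s}
        = (\<Union>q<N. (\<lambda>p. (p, q)) ` A q)" by (auto simp: A_def)
    moreover have "card (\<Union>q<N. (\<lambda>p. (p, q)) ` A q) \<le> (\<Sum>q<N. card ((\<lambda>p. (p, q)) ` A q))"
      by (rule card_UN_le) simp
    moreover have "card ((\<lambda>p. (p, q)) ` A q) = card (A q)" for q by (intro card_image inj_onI) auto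
    moreover have "(\<Sum>q<N. card (A q)) \<le> (\<Sum>q<N. 2)" using calculation(1) by (intro sum_mono)
    ultimately show ?thesis by simp
  qed
  show ?thesis
  proof (cases "\<bar>s\<bar> \<le> \<bar>c\<bar>")
    case True
    then show ?thesis using assms by (intro main) auto
  next
    case False
    define B where "B = {(q, p). q < N \<and> p < N \<and> lo s c < t - real q * s - real p * c \<and> t - real q * s - real p * c < hi s c}"
    have "{(p, q). p < N \<and> q < N \<and> lo c s < t - real p * c - real q * s \<and> t - real p * c - real q * s < hi c s}
      = prod.swap ` B"
      by (auto simp: B_def lo_def hi_def add.commute diff_right_commute image_iff)
    moreover have "card (prod.swap ` B) = card B" by (intro card_image inj_on_subset[OF inj_swap]) auto
    moreover have "card B \<le> 2 * N" unfolding B_def using False by (intro main) auto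
    ultimately show ?thesis by simp
  qed
qed

text \<open>The total conductance when every grid square of level \<open>i\<close>, retained or not,
  carries a copy of the remaining steps. For \<open>i = 0\<close> it is the conductance of the
  hitting probability itself.\<close>

definition level_sum :: "real \<Rightarrow> real \<Rightarrow> bool list \<Rightarrow> real \<Rightarrow> nat \<Rightarrow> real" where
  "level_sum c s bs t i = grid_sum c s i (\<lambda>u. conduct (hit_prob c s (drop i bs) u)) t"

lemma level_sum_nonneg: "0 \<le> level_sum c s bs t i"
  unfolding level_sum_def grid_sum_def using hit_prob_bounds by (intro sum_nonneg conduct_nonneg) auto

lemma level_sum_True:
  assumes "i < length bs" "bs ! i"
  shows "level_sum c s bs t i \<le> level_sum c s bs t (Suc i)"
proof -
  have d: "drop i bs = True # drop (Suc i) bs" using assms by (simp flip: Cons_nth_drop_Suc)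
  show ?thesis unfolding level_sum_def grid_sum_Suc d unfolding grid_sum_def
    by (intro sum_mono conduct_True)
qed

text \<open>\<open>conduct_False\<close> is summed by concavity over the at most n = 2 * 2^i squares
  that the line meets. Read in resistances, with L for the level sums: 1/L(i) >= 4/L(i+1) +
  1/(3n).\<close>

lemma level_sum_False:
  assumes i: "i < length bs" "\<not> bs ! i" and cs: "c \<noteq> 0 \<or> s \<noteq> 0"
  shows "level_sum c s bs t i \<le>
    3 * (2 * 2 ^ i * level_sum c s bs t (Suc i) / (12 * (2 * 2 ^ i) + level_sum c s bs t (Suc i)))"
proof -
  have d: "drop i bs = False # drop (Suc i) bs" using i by (simp flip: Cons_nth_drop_Suc)
  define u where "u = (\<lambda>(p, q). 2 ^ i * t - real p * c - real q * s)"
  define H where "H = {(p, q). p < 2 ^ i \<and> q < 2 ^ i \<and> lo c s < 2 ^ i * t - real p * c - real q * s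
    \<and> 2 ^ i * t - real p * c - real q * s < hi c s}"
  define g where "g = quarter_sum c s (\<lambda>u. conduct (hit_prob c s (drop (Suc i) bs) u))"
  have g0: "0 \<le> g v" for v unfolding g_def quarter_sum_def
    using hit_prob_bounds by (intro add_nonneg_nonneg conduct_nonneg) auto
  have HI: "H \<subseteq> {..<2 ^ i} \<times> {..<2 ^ i}" by (auto simp: H_def)
  then have fin: "finite H" by (rule finite_subset) simp
  have cardH: "real (card H) \<le> 2 * 2 ^ i"
    unfolding H_def using card_hit_squares[OF cs, of "2 ^ i" "2 ^ i * t"]
    by (metis (no_types, lifting) of_nat_le_iff of_nat_mult of_nat_numeral of_nat_power)
  have "level_sum c s bs t i = (\<Sum>w\<in>{..<2 ^ i} \<times> {..<2 ^ i}. conduct (hit_prob c s (drop i bs) (u w)))"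
    unfolding level_sum_def grid_sum_def u_def by (simp add: sum.cartesian_product split_def)
  also have "\<dots> = (\<Sum>w\<in>H. conduct (hit_prob c s (drop i bs) (u w)))"
  proof (rule sum.mono_neutral_right[OF _ HI ballI])
    fix w assume "w \<in> {..<2 ^ i} \<times> {..<2 ^ i} - H"
    then have "hit_prob c s (drop i bs) (u w) = 0"
      using hit_prob_support[of c s "drop i bs" "u w"] by (cases w) (auto simp: H_def u_def)
    then show "conduct (hit_prob c s (drop i bs) (u w)) = 0" by (simp add: conduct_def)
  qed simp
  also have "\<dots> \<le> (\<Sum>w\<in>H. 3 * (g (u w) / (12 + g (u w))))"
    unfolding d g_def by (intro sum_mono conduct_False)
  also have "\<dots> = 3 * (\<Sum>w\<in>H. g (u w) / (12 + g (u w)))" by (simp add: sum_distrib_left)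
  also have "(\<Sum>w\<in>H. g (u w) / (12 + g (u w))) \<le> 2 * 2 ^ i * (\<Sum>w\<in>H. g (u w)) / (12 * (2 * 2 ^ i) + (\<Sum>w\<in>H. g (u w)))"
    using fin g0 cardH by (intro concave_sum_bound) auto
  also have "\<dots> \<le> 2 * 2 ^ i * level_sum c s bs t (Suc i) / (12 * (2 * 2 ^ i) + level_sum c s bs t (Suc i))"
  proof -
    have "(\<Sum>w\<in>H. g (u w)) \<le> (\<Sum>w\<in>{..<2 ^ i} \<times> {..<2 ^ i}. g (u w))"
      using HI g0 by (intro sum_mono2) auto
    also have "\<dots> = level_sum c s bs t (Suc i)"
      unfolding level_sum_def grid_sum_Suc g_def[symmetric] unfolding grid_sum_def u_def
      by (simp add: sum.cartesian_product split_def)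
    finally have le: "(\<Sum>w\<in>H. g (u w)) \<le> level_sum c s bs t (Suc i)" .
    have mono: "n * x / (12 * n + x) \<le> n * y / (12 * n + y)" if "0 < n" "0 \<le> x" "x \<le> y" for n x y :: real
    proof -
      have "n * x / (12 * n + x) = n - 12 * n * n / (12 * n + x)" if "0 \<le> x" for x using that \<open>0 < n\<close> by (simp add: field_simps)
      moreover have "12 * n * n / (12 * n + y) \<le> 12 * n * n / (12 * n + x)"
        using that by (intro divide_left_mono) auto
      ultimately show ?thesis using that by auto
    qed
    show ?thesis using le g0 by (intro mono sum_nonneg) auto
  qed
  finally show ?thesis by simp
qed

text \<open>The resistance 1/(6 * 2^i) added by a level that keeps one quarter, rescaled by the
  factors 4 that the earlier such levels contribute.\<close>

definition gain :: "bool list \<Rightarrow> nat \<Rightarrow> real" where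
  "gain bs i = (if bs ! i then 0 else 4 ^ count_list (take i bs) False / (6 * 2 ^ i))"

text \<open>Divided by 4 for each earlier \<open>False\<close>, the level sums become
  \<open>S\<close>, with 1/S(k) >= 1/S(k+1) + gain(k). Backward induction from the last level adds
  up the resistances; the product form avoids division by a vanishing \<open>S\<close>. The constant
  2 is that of \<open>le_2_conduct\<close>.\<close>

theorem hit_prob_le:
  assumes cs: "c \<noteq> 0 \<or> s \<noteq> 0"
  shows "hit_prob c s bs t * (\<Sum>i<length bs. gain bs i) \<le> 2"
proof -
  define P where "P i = (1 / 4 :: real) ^ count_list (take i bs) False" for i
  define S where "S i = P i * level_sum c s bs t i" for i
  have P: "P i > 0" for i by (simp add: P_def)
  have S0: "0 \<le> S i" for i using P level_sum_nonneg by (simp add: S_def less_imp_le)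
  have take_Suc: "count_list (take (Suc i) bs) False = count_list (take i bs) False + (if bs ! i then 0 else 1)"
    if "i < length bs" for i using that by (simp add: take_Suc_conv_app_nth)
  have main: "i \<le> length bs \<Longrightarrow> S (length bs - i) * (\<Sum>j\<in>{length bs - i..<length bs}. gain bs j) \<le> 1" for i
  proof (induction i)
    case (Suc i)
    define k where "k = length bs - Suc i"
    have k: "k < length bs" "length bs - i = Suc k" using Suc.prems by (auto simp: k_def)
    define W where "W = (\<Sum>j\<in>{Suc k..<length bs}. gain bs j)"
    have IH: "S (Suc k) * W \<le> 1" using Suc k by (simp add: W_def)
    have "gain bs j \<ge> 0" for j by (simp add: gain_def)
    then have W0: "0 \<le> W" unfolding W_def by (intro sum_nonneg)
    have split: "(\<Sum>j\<in>{k..<length bs}. gain bs j) = gain bs k + W"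
      unfolding W_def using k by (simp add: sum.atLeast_Suc_lessThan)
    have "S k * (gain bs k + W) \<le> 1"
    proof (cases "bs ! k")
      case True
      then have "S k \<le> S (Suc k)"
        unfolding S_def using level_sum_True[OF k(1) True] P[of k] take_Suc[OF k(1)] by (simp add: P_def)
      then have "S k * W \<le> S (Suc k) * W" using W0 by (rule mult_right_mono)
      then show ?thesis using IH True by (simp add: gain_def)
    next
      case False
      define n :: real where "n = 2 * 2 ^ k"
      define T where "T = level_sum c s bs t (Suc k)"
      have n: "n > 0" by (simp add: n_def)
      have T: "T \<ge> 0" unfolding T_def by (rule level_sum_nonneg)
      have PS: "P k = 4 * P (Suc k)" using take_Suc[OF k(1)] False by (simp add: P_def)
      have gk: "gain bs k = 1 / (3 * n * P k)"
        using False by (simp add: gain_def n_def P_def power_one_over field_simps)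
      have "level_sum c s bs t k \<le> 3 * (n * T / (12 * n + T))"
        unfolding n_def T_def by (rule level_sum_False[OF k(1) False cs])
      then have "S k \<le> P k * (3 * (n * T / (12 * n + T)))"
        unfolding S_def using P[of k] by (intro mult_left_mono) auto
      then have "S k * (gain bs k + W) \<le> P k * (3 * (n * T / (12 * n + T))) * (gain bs k + W)"
        using W0 by (intro mult_right_mono) (auto simp: gain_def)
      also have "\<dots> = (T + 12 * n * (S (Suc k) * W)) / (12 * n + T)"
      proof -
        have "3 * n * P k * gain bs k = 1" using n P[of k] by (simp add: gk)
        moreover have "P k * (3 * (n * T / (12 * n + T))) * gain bs k = (3 * n * P k * gain bs k) * (T / (12 * n + T))"
          by (simp add: divide_inverse mult_ac)
        ultimately have "P k * (3 * (n * T / (12 * n + T))) * gain bs k = T / (12 * n + T)" by simp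
        moreover have "P k * (3 * (n * T / (12 * n + T))) * W = (P k * T) * (W * 3 * n) / (12 * n + T)"
          by (simp add: divide_inverse mult_ac)
        moreover have "(P k * T) * (W * 3 * n) = 12 * n * (S (Suc k) * W)" by (simp add: PS S_def T_def)
        ultimately show ?thesis by (simp only: distrib_left add_divide_distrib)
      qed
      also have "\<dots> \<le> (T + 12 * n * 1) / (12 * n + T)"
        using IH n T by (intro divide_right_mono add_left_mono mult_left_mono) auto
      also have "\<dots> = 1" using n T by simp
      finally show ?thesis .
    qed
    then show ?case using split by (simp add: k_def)
  qed simp
  have "conduct (hit_prob c s bs t) * (\<Sum>i<length bs. gain bs i) \<le> 1"
    using main[of "length bs"] by (simp add: S_def P_def level_sum_def grid_sum_def lessThan_atLeast0)
  moreover have "hit_prob c s bs t \<le> 2 * conduct (hit_prob c s bs t)"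
    using hit_prob_bounds by (intro le_2_conduct) auto
  moreover have "0 \<le> (\<Sum>i<length bs. gain bs i)" by (intro sum_nonneg) (simp add: gain_def)
  ultimately show ?thesis
    using mult_right_mono[of "hit_prob c s bs t" "2 * conduct (hit_prob c s bs t)" "\<Sum>i<length bs. gain bs i"]
    by linarith
qed

section \<open>Dyadic patterns\<close>

definition place :: "nat \<Rightarrow> real^2 \<Rightarrow> (real^2) set \<Rightarrow> (real^2) set" where
  "place k x Y = (\<lambda>y. x + (1/2) ^ k *\<^sub>R y) ` Y"

definition quarter :: "real \<Rightarrow> real \<Rightarrow> real^2" where
  "quarter a b = vector [a / 2, b / 2]"

text \<open>A pattern is the set of the lower left corners of its squares. The list runs through all
  outcomes of the random choices, with multiplicities.\<close>

fun patterns :: "bool list \<Rightarrow> (real^2) set list" where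
  "patterns [] = [{0}]"
| "patterns (False # bs) = concat (map (\<lambda>Y. [place 1 (quarter 0 0) Y, place 1 (quarter 1 0) Y,
     place 1 (quarter 0 1) Y, place 1 (quarter 1 1) Y]) (patterns bs))"
| "patterns (True # bs) = concat (map (\<lambda>Y0. concat (map (\<lambda>Y1. concat (map (\<lambda>Y2. map (\<lambda>Y3.
     place 1 (quarter 0 0) Y0 \<union> place 1 (quarter 1 0) Y1 \<union> place 1 (quarter 0 1) Y2 \<union> place 1 (quarter 1 1) Y3)
     (patterns bs)) (patterns bs))) (patterns bs))) (patterns bs))"

lemma quarter_component [simp]: "quarter a b $ 1 = a / 2" "quarter a b $ 2 = b / 2"
  by (simp_all add: quarter_def)

definition hits :: "real \<Rightarrow> real \<Rightarrow> nat \<Rightarrow> (real^2) set \<Rightarrow> real \<Rightarrow> bool" where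
  "hits c s n Y t \<longleftrightarrow> (\<exists>y\<in>Y. lo c s < 2 ^ n * (t - (y $ 1 * c + y $ 2 * s)) \<and> 2 ^ n * (t - (y $ 1 * c + y $ 2 * s)) < hi c s)"

lemma hits_Un: "hits c s n (A \<union> B) t \<longleftrightarrow> hits c s n A t \<or> hits c s n B t"
  by (auto simp: hits_def)

lemma hits_place: "hits c s (Suc n) (place 1 (quarter a b) Y) t \<longleftrightarrow> hits c s n Y (2 * t - a * c - b * s)"
proof -
  have "2 ^ Suc n * (t - ((quarter a b + (1/2) ^ 1 *\<^sub>R y) $ 1 * c + (quarter a b + (1/2) ^ 1 *\<^sub>R y) $ 2 * s))
     = 2 ^ n * (2 * t - a * c - b * s - (y $ 1 * c + y $ 2 * s))" for y
    by (simp add: algebra_simps)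
  then show ?thesis by (simp only: hits_def place_def bex_simps)
qed

lemma sum_list_concat_map:
  fixes f :: "'b \<Rightarrow> 'c::comm_monoid_add"
  shows "(\<Sum>x\<leftarrow>concat (map g xs). f x) = (\<Sum>y\<leftarrow>xs. \<Sum>x\<leftarrow>g y. f x)"
  by (induction xs) auto

text \<open>Multiplicities make every outcome equally likely, so \<open>hit_prob\<close> is an exact
  proportion. For a bit \<open>True\<close> the four sublists are chosen independently, and the
  numbers of missing outcomes multiply.\<close>

lemma sum_list_patterns:
  "(\<Sum>Y\<leftarrow>patterns bs. of_bool (hits c s (length bs) Y t)) = real (length (patterns bs)) * hit_prob c s bs t"
proof (induction bs arbitrary: t)
  case Nil
  show ?case by (simp add: hits_def)
next
  case (Cons b bs)
  define L where "L = real (length (patterns bs))"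
  define H where "H Y t = (of_bool (hits c s (length bs) Y t) :: real)" for Y t
  have IH: "(\<Sum>Y\<leftarrow>patterns bs. H Y t) = L * hit_prob c s bs t" for t
    using Cons.IH by (simp add: L_def H_def)
  show ?case
  proof (cases b)
    case False
    have "(\<Sum>Y\<leftarrow>patterns (b # bs). of_bool (hits c s (length (b # bs)) Y t)) =
        (\<Sum>Y\<leftarrow>patterns bs. H Y (2 * t) + (H Y (2 * t - c) + (H Y (2 * t - s) + H Y (2 * t - c - s))))"
      using False by (simp add: sum_list_concat_map H_def hits_place del: One_nat_def)
    also have "\<dots> = real (length (patterns (b # bs))) * hit_prob c s (b # bs) t"
      using False by (simp add: sum_list_addf IH length_concat o_def sum_list_triv L_def algebra_simps)
    finally show ?thesis .
  next
    case True
    have q: "of_bool (hits c s (Suc (length bs)) (place 1 (quarter 0 0) Y0 \<union> place 1 (quarter 1 0) Y1 \<union>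
        place 1 (quarter 0 1) Y2 \<union> place 1 (quarter 1 1) Y3) t) =
      1 - (1 - H Y0 (2 * t)) * ((1 - H Y1 (2 * t - c)) * ((1 - H Y2 (2 * t - s)) * (1 - H Y3 (2 * t - c - s))))"
      for Y0 Y1 Y2 Y3 unfolding hits_Un hits_place H_def by auto
    have miss: "L - (\<Sum>Y\<leftarrow>patterns bs. H Y t) = L * (1 - hit_prob c s bs t)" for t
      by (simp add: IH right_diff_distrib)
    have "(\<Sum>Y\<leftarrow>patterns (b # bs). of_bool (hits c s (length (b # bs)) Y t)) =
      (\<Sum>Y0\<leftarrow>patterns bs. \<Sum>Y1\<leftarrow>patterns bs. \<Sum>Y2\<leftarrow>patterns bs. \<Sum>Y3\<leftarrow>patterns bs.
        1 - (1 - H Y0 (2 * t)) * ((1 - H Y1 (2 * t - c)) * ((1 - H Y2 (2 * t - s)) * (1 - H Y3 (2 * t - c - s)))))"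
      using True by (simp add: sum_list_concat_map o_def q del: One_nat_def)
    also have "\<dots> = L ^ 4 - (L * (1 - hit_prob c s bs (2 * t))) * ((L * (1 - hit_prob c s bs (2 * t - c))) *
        ((L * (1 - hit_prob c s bs (2 * t - s))) * (L * (1 - hit_prob c s bs (2 * t - c - s)))))"
      by (simp add: sum_list_subtractf sum_list_triv sum_list_const_mult sum_list_mult_const miss
          L_def[symmetric] power4_eq_xxxx)
    also have "\<dots> = real (length (patterns (b # bs))) * hit_prob c s (b # bs) t"
      using True by (simp add: length_concat o_def sum_list_triv L_def[symmetric] power4_eq_xxxx algebra_simps)
    finally show ?thesis .
  qed
qed

lemma patterns_nonempty: "patterns bs \<noteq> []"
proof (induction bs)
  case (Cons b bs) then show ?case by (cases b) (auto simp: neq_Nil_conv)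
qed simp

section \<open>Grid points and the regularity shared by all outcomes\<close>

definition grid_point :: "nat \<Rightarrow> real^2 \<Rightarrow> bool" where
  "grid_point n x \<longleftrightarrow> (\<forall>i. \<exists>m::int. 0 \<le> m \<and> m < 2 ^ n \<and> x $ i = of_int m / 2 ^ n)"

lemma grid_point_bounds: "grid_point n x \<Longrightarrow> 0 \<le> x $ i \<and> x $ i + (1/2) ^ n \<le> 1"
proof -
  assume "grid_point n x"
  then obtain m :: int where m: "0 \<le> m" "m < 2 ^ n" "x $ i = of_int m / 2 ^ n" unfolding grid_point_def by blast
  have "of_int (m + 1) \<le> (2 ^ n :: real)" using m(2) by (metis add1_zle_eq of_int_le_numeral_power_cancel_iff)
  then have "x $ i + (1/2) ^ n \<le> 1" using m(3) by (simp add: power_one_over field_simps)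
  moreover have "0 \<le> x $ i" using m by simp
  ultimately show "0 \<le> x $ i \<and> x $ i + (1/2) ^ n \<le> 1" by simp
qed

lemma grid_point_lt_1: "grid_point n x \<Longrightarrow> x $ i < 1"
  using grid_point_bounds[of n x i] zero_less_power[of "1/2 :: real" n] by linarith

lemma grid_point_place:
  assumes "grid_point n x" "grid_point k y"
  shows "grid_point (n + k) (x + (1/2) ^ n *\<^sub>R y)"
  unfolding grid_point_def
proof
  fix i
  obtain m :: int where m: "0 \<le> m" "m < 2 ^ n" "x $ i = of_int m / 2 ^ n" using assms(1) unfolding grid_point_def by blast
  obtain l :: int where l: "0 \<le> l" "l < 2 ^ k" "y $ i = of_int l / 2 ^ k" using assms(2) unfolding grid_point_def by blast
  have "m * 2 ^ k + l < m * 2 ^ k + 2 ^ k" using l by simp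
  also have "\<dots> = (m + 1) * 2 ^ k" by (simp add: algebra_simps)
  also have "\<dots> \<le> 2 ^ n * 2 ^ k" using m by (intro mult_right_mono) auto
  finally have "m * 2 ^ k + l < 2 ^ (n + k)" by (simp add: power_add)
  moreover have "(x + (1/2) ^ n *\<^sub>R y) $ i = of_int (m * 2 ^ k + l) / 2 ^ (n + k)"
    using m l by (simp add: power_add field_simps)
  moreover have "0 \<le> m * 2 ^ k + l" using m l by simp
  ultimately show "\<exists>m::int. 0 \<le> m \<and> m < 2 ^ (n + k) \<and> (x + (1/2) ^ n *\<^sub>R y) $ i = of_int m / 2 ^ (n + k)" by blast
qed

lemma cell_place_coarse:
  assumes x: "grid_point n x" and y: "\<And>i. 0 \<le> y $ i \<and> y $ i < 1" and j: "j \<le> n"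
  shows "cell j (x + (1/2) ^ n *\<^sub>R y) = cell j x"
proof -
  have "\<lfloor>2 ^ n * (x + (1/2) ^ n *\<^sub>R y) $ i\<rfloor> = \<lfloor>2 ^ n * x $ i\<rfloor>" for i
  proof -
    obtain m :: int where m: "x $ i = of_int m / 2 ^ n" using x unfolding grid_point_def by blast
    have "2 ^ n * (x + (1/2) ^ n *\<^sub>R y) $ i = of_int m + y $ i" by (simp add: m field_simps)
    moreover have "2 ^ n * x $ i = of_int m" by (simp add: m)
    ultimately show ?thesis using y[of i] by (simp add: floor_eq_iff)
  qed
  then have "cell n (x + (1/2) ^ n *\<^sub>R y) = cell n x" by (simp add: cell_def)
  then show ?thesis using j by (rule cell_mono)
qed

lemma cell_place_fine:
  assumes x: "grid_point n x" and eq: "cell (n + j) (x + (1/2) ^ n *\<^sub>R y) = cell (n + j) (x + (1/2) ^ n *\<^sub>R y')"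
  shows "cell j y = cell j y'"
proof -
  have *: "\<exists>l::int. \<forall>y. \<lfloor>2 ^ (n + j) * (x + (1/2) ^ n *\<^sub>R y) $ i\<rfloor> = l + \<lfloor>2 ^ j * y $ i\<rfloor>" for i
  proof -
    obtain m :: int where m: "x $ i = of_int m / 2 ^ n" using x unfolding grid_point_def by blast
    have "2 ^ (n + j) * (x + (1/2) ^ n *\<^sub>R y) $ i = of_int (2 ^ j * m) + 2 ^ j * y $ i" for y :: "real^2"
      by (simp add: m power_add field_simps)
    then show ?thesis by (intro exI[of _ "2 ^ j * m"] allI) (simp only: int_add_floor)
  qed
  have "\<lfloor>2 ^ j * y $ i\<rfloor> = \<lfloor>2 ^ j * y' $ i\<rfloor>"
    if "\<lfloor>2 ^ (n + j) * (x + (1/2) ^ n *\<^sub>R y) $ i\<rfloor> = \<lfloor>2 ^ (n + j) * (x + (1/2) ^ n *\<^sub>R y') $ i\<rfloor>" for i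
    using *[of i] that by auto
  then show ?thesis using eq unfolding cell_def by (simp only: prod.inject)
qed

lemma grid_point_eq:
  assumes "grid_point n x" "grid_point n x'" "cell n x = cell n x'" shows "x = x'"
proof -
  have *: "x $ i = x' $ i" if "\<lfloor>2 ^ n * x $ i\<rfloor> = \<lfloor>2 ^ n * x' $ i\<rfloor>" for i
  proof -
    obtain m :: int where m: "x $ i = of_int m / 2 ^ n" using assms(1) unfolding grid_point_def by blast
    obtain l :: int where l: "x' $ i = of_int l / 2 ^ n" using assms(2) unfolding grid_point_def by blast
    show ?thesis using that by (simp add: m l)
  qed
  show ?thesis using assms(3) * by (simp add: cell_def vec_eq_iff forall_2)
qed

text \<open>A deterministic Frostman condition: a cell of level \<open>i\<close> holds at most its
  fair share of corners, as if they were equally divided among the squares of that level. Chance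
  only moves the squares, so every outcome satisfies it.\<close>

definition spread :: "bool list \<Rightarrow> (real^2) set \<Rightarrow> bool" where
  "spread bs Y \<longleftrightarrow> finite Y \<and> (\<forall>y\<in>Y. grid_point (length bs) y) \<and> card Y = 4 ^ count_list bs True \<and>
     (\<forall>i\<le>length bs. \<forall>z. card {y\<in>Y. cell i y = z} \<le> 4 ^ count_list (drop i bs) True)"

lemma card_place: "card (place n x Y) = card Y"
  unfolding place_def by (intro card_image inj_onI) simp

text \<open>Up to level \<open>length as\<close> a cell sees only the corners in \<open>X\<close>,
  each multiplied by the common size of the inserted patterns. A finer cell meets the pattern of a
  single corner and becomes a cell of that pattern.\<close>

lemma spread_compose:
  assumes X: "spread as X" and Y: "\<And>x. x \<in> X \<Longrightarrow> spread bs (Y x)"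
  shows "spread (as @ bs) (\<Union>x\<in>X. place (length as) x (Y x))"
proof -
  define n where "n = length as"
  define Z where "Z = (\<Union>x\<in>X. place n x (Y x))"
  have gX: "grid_point n x" if "x \<in> X" for x using X that by (simp add: spread_def n_def)
  have gY: "grid_point (length bs) y" if "x \<in> X" "y \<in> Y x" for x y using Y[OF that(1)] that(2) by (simp add: spread_def)
  have Yb: "0 \<le> y $ i \<and> y $ i < 1" if "x \<in> X" "y \<in> Y x" for x y i
    using grid_point_bounds[OF gY[OF that], of i] grid_point_lt_1[OF gY[OF that], of i] by simp
  have coarse: "cell j z = cell j x" if "x \<in> X" "z \<in> place n x (Y x)" "j \<le> n" for x z j
  proof -
    obtain y where y: "y \<in> Y x" "z = x + (1/2) ^ n *\<^sub>R y" using \<open>z \<in> place n x (Y x)\<close> unfolding place_def by blast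
    show ?thesis unfolding y(2) using Yb[OF that(1) y(1)] by (intro cell_place_coarse gX that) auto
  qed
  have finX: "finite X" and finY: "\<And>x. x \<in> X \<Longrightarrow> finite (Y x)" using X Y by (auto simp: spread_def)
  have finP: "finite (place n x (Y x))" if "x \<in> X" for x using finY[OF that] by (simp add: place_def)
  have cardY: "card (place n x (Y x)) = 4 ^ count_list bs True" if "x \<in> X" for x
    using Y[OF that] by (simp add: card_place spread_def)
  have "card Z = (\<Sum>x\<in>X. card (place n x (Y x)))" unfolding Z_def
  proof (intro card_UN_disjoint finX ballI impI)
    fix x x' assume xx: "x \<in> X" "x' \<in> X" "x \<noteq> x'"
    have "x = x'" if "z \<in> place n x (Y x)" "z \<in> place n x' (Y x')" for z
      using coarse[OF xx(1) that(1), of n] coarse[OF xx(2) that(2), of n] gX xx by (intro grid_point_eq[of n]) auto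
    then show "place n x (Y x) \<inter> place n x' (Y x') = {}" using xx(3) by blast
  qed (use finP in auto)
  also have "\<dots> = 4 ^ count_list (as @ bs) True"
    using X by (simp add: cardY spread_def power_add)
  finally have cardZ: "card Z = 4 ^ count_list (as @ bs) True" .
  have "card {z\<in>Z. cell i z = w} \<le> 4 ^ count_list (drop i (as @ bs)) True" if i: "i \<le> length (as @ bs)" for i w
  proof (cases "i \<le> n")
    case True
    have "{z\<in>Z. cell i z = w} \<subseteq> (\<Union>x\<in>{x\<in>X. cell i x = w}. place n x (Y x))"
    proof
      fix z assume z: "z \<in> {z\<in>Z. cell i z = w}"
      then obtain x where x: "x \<in> X" "z \<in> place n x (Y x)" by (auto simp: Z_def)
      then have "cell i x = w" using coarse[OF x True] z by simp
      then show "z \<in> (\<Union>x\<in>{x\<in>X. cell i x = w}. place n x (Y x))" using x by blast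
    qed
    then have "card {z\<in>Z. cell i z = w} \<le> card (\<Union>x\<in>{x\<in>X. cell i x = w}. place n x (Y x))"
      using finX finP by (intro card_mono) auto
    also have "\<dots> \<le> (\<Sum>x\<in>{x\<in>X. cell i x = w}. card (place n x (Y x)))"
      using finX by (intro card_UN_le) simp
    also have "\<dots> = card {x\<in>X. cell i x = w} * 4 ^ count_list bs True" by (simp add: cardY)
    also have "\<dots> \<le> 4 ^ count_list (drop i as) True * 4 ^ count_list bs True"
      using X True by (intro mult_right_mono) (simp_all add: spread_def n_def del: split_paired_All)
    finally show ?thesis using True by (simp add: n_def power_add)
  next
    case False
    define j where "j = i - n"
    have j: "i = n + j" "j \<le> length bs" using i False by (auto simp: n_def j_def)
    show ?thesis
    proof (cases "{z\<in>Z. cell i z = w} = {}")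
      case True then show ?thesis by (simp only: card.empty le0)
    next
      case ne: False
      then obtain x y where xy: "x \<in> X" "y \<in> Y x" "cell i (x + (1/2) ^ n *\<^sub>R y) = w"
        by (auto simp: Z_def place_def)
      have "{z\<in>Z. cell i z = w} \<subseteq> place n x {y'\<in>Y x. cell j y' = cell j y}"
      proof
        fix z assume z: "z \<in> {z\<in>Z. cell i z = w}"
        then obtain x' y' where xy': "x' \<in> X" "y' \<in> Y x'" "z = x' + (1/2) ^ n *\<^sub>R y'"
          by (auto simp: Z_def place_def)
        have "cell n z = cell n (x + (1/2) ^ n *\<^sub>R y)"
        proof (rule cell_mono)
          show "cell i z = cell i (x + (1/2) ^ n *\<^sub>R y)" using z xy(3) by simp
        qed (simp add: j(1))
        moreover have "cell n z = cell n x'"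
          by (rule coarse[OF xy'(1) _ order_refl]) (simp add: xy' place_def)
        moreover have "cell n (x + (1/2) ^ n *\<^sub>R y) = cell n x"
          by (rule coarse[OF xy(1) _ order_refl]) (simp add: xy place_def)
        ultimately have "x' = x" using gX xy(1) xy'(1) by (intro grid_point_eq[of n]) auto
        then have "cell j y' = cell j y"
          using cell_place_fine[OF gX[OF xy(1)], of j y' y] z xy xy' j(1) by simp
        then show "z \<in> place n x {y'\<in>Y x. cell j y' = cell j y}" using xy' \<open>x' = x\<close> by (auto simp: place_def)
      qed
      then have "card {z\<in>Z. cell i z = w} \<le> card (place n x {y'\<in>Y x. cell j y' = cell j y})"
        using finY[OF xy(1)] by (intro card_mono) (auto simp: place_def)
      also have "\<dots> \<le> 4 ^ count_list (drop j bs) True"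
        using Y[OF xy(1)] j(2) by (simp add: card_place spread_def del: split_paired_All)
      finally show ?thesis using j(1) by (simp add: n_def)
    qed
  qed
  moreover have "finite Z" unfolding Z_def using finX finP by simp
  moreover have "grid_point (length (as @ bs)) z" if z: "z \<in> Z" for z
  proof -
    obtain x y where "x \<in> X" "y \<in> Y x" "z = x + (1/2) ^ n *\<^sub>R y" using z by (auto simp: Z_def place_def)
    then show ?thesis using grid_point_place[OF gX gY] by (simp add: n_def)
  qed
  ultimately show ?thesis using cardZ unfolding spread_def Z_def n_def by blast
qed

lemma grid_point_quarter:
  assumes "a = 0 \<or> a = 1" "b = 0 \<or> b = 1" shows "grid_point 1 (quarter a b)"
proof -
  have "\<exists>m::int. 0 \<le> m \<and> m < 2 ^ 1 \<and> u / 2 = of_int m / 2 ^ 1" if "u = 0 \<or> u = 1" for u :: real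
    using that by (intro exI[of _ "\<lfloor>u\<rfloor>"]) auto
  then show ?thesis using assms by (simp add: grid_point_def forall_2)
qed

lemma quarter_inj: "quarter a b = quarter a' b' \<longleftrightarrow> a = a' \<and> b = b'"
  by (auto simp: vec_eq_iff forall_2)

lemma spread_quarter:
  assumes "a = 0 \<or> a = 1" "b = 0 \<or> b = 1" shows "spread [False] {quarter a b}"
proof -
  have "card {y \<in> {quarter a b}. P y} \<le> 1" for P
    by (rule order_trans[OF card_mono[of "{quarter a b}"]]) auto
  then show ?thesis using grid_point_quarter[OF assms] by (auto simp: spread_def le_Suc_eq)
qed

lemma spread_quarters: "spread [True] {quarter 0 0, quarter 1 0, quarter 0 1, quarter 1 1}"
proof -
  define Q where "Q = {quarter 0 0, quarter 1 0, quarter 0 1, quarter 1 1}"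
  have Q: "finite Q" "card Q = 4" "\<And>y. y \<in> Q \<Longrightarrow> grid_point 1 y"
    by (auto simp: Q_def quarter_inj intro: grid_point_quarter[unfolded One_nat_def])
  have "card {y\<in>Q. cell 1 y = z} \<le> 1" for z
    using Q by (subst card_le_Suc0_iff_eq[folded One_nat_def]) (auto intro: grid_point_eq[of 1])
  moreover have "card {y\<in>Q. cell 0 y = z} \<le> 4" for z
    using card_mono[of Q "{y\<in>Q. cell 0 y = z}"] Q by auto
  ultimately have "spread [True] Q" using Q by (auto simp: spread_def le_Suc_eq)
  then show ?thesis by (simp add: Q_def)
qed

lemma spread_Nil: "spread [] {0}"
proof -
  have "card {y \<in> {0 :: real^2}. P y} \<le> 1" for P
    by (rule order_trans[OF card_mono[of "{0}"]]) auto
  then show ?thesis by (auto simp: spread_def grid_point_def)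
qed

lemma spread_patterns: "Y \<in> set (patterns bs) \<Longrightarrow> spread bs Y"
proof (induction bs arbitrary: Y)
  case Nil then show ?case using spread_Nil by simp
next
  case (Cons b bs)
  show ?case
  proof (cases b)
    case False
    then obtain Y' a b' where Y': "Y' \<in> set (patterns bs)" "a = 0 \<or> a = 1" "b' = 0 \<or> b' = 1" "Y = place 1 (quarter a b') Y'"
      using Cons.prems by auto
    then show ?thesis using spread_compose[OF spread_quarter, of a b' bs "\<lambda>_. Y'"] Cons.IH False by simp
  next
    case True
    then obtain Y0 Y1 Y2 Y3 where Y': "{Y0, Y1, Y2, Y3} \<subseteq> set (patterns bs)" and
      Y: "Y = place 1 (quarter 0 0) Y0 \<union> place 1 (quarter 1 0) Y1 \<union> place 1 (quarter 0 1) Y2 \<union> place 1 (quarter 1 1) Y3"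
      using Cons.prems by auto
    define F where "F x = (if x = quarter 0 0 then Y0 else if x = quarter 1 0 then Y1 else if x = quarter 0 1 then Y2 else Y3)" for x
    have "spread bs (F x)" for x using Y' Cons.IH by (auto simp: F_def)
    then have "spread ([True] @ bs) (\<Union>x\<in>{quarter 0 0, quarter 1 0, quarter 0 1, quarter 1 1}. place (length [True]) x (F x))"
      by (intro spread_compose spread_quarters)
    moreover have "(\<Union>x\<in>{quarter 0 0, quarter 1 0, quarter 0 1, quarter 1 1}. place (length [True]) x (F x)) = Y"
      unfolding Y by (simp add: F_def quarter_inj Un_assoc)
    ultimately show ?thesis using True by simp
  qed
qed

section \<open>Lines meeting a set\<close>

text \<open>As a subset of the parameter plane, its area is the integral of the projection lengths.
  The closed interval of angles keeps it compact for compact \<open>A\<close>.\<close>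

definition lines_meeting :: "(real^2) set \<Rightarrow> (real \<times> real) set" where
  "lines_meeting A = {(\<theta>, a). \<theta> \<in> {0..pi} \<and> a \<in> (\<lambda>x. x \<bullet> dir \<theta>) ` A}"

lemma lines_meeting_mono: "A \<subseteq> B \<Longrightarrow> lines_meeting A \<subseteq> lines_meeting B"
  by (auto simp: lines_meeting_def)

lemma lines_meeting_UN: "lines_meeting (\<Union>i\<in>I. A i) = (\<Union>i\<in>I. lines_meeting (A i))"
  by (auto simp: lines_meeting_def)

lemma compact_lines_meeting:
  assumes "compact K" shows "compact (lines_meeting K)"
proof -
  have "lines_meeting K = (\<lambda>(\<theta>, x). (\<theta>, x \<bullet> dir \<theta>)) ` ({0..pi} \<times> K)"
    by (auto simp: lines_meeting_def image_iff)
  also have "compact \<dots>"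
    by (intro compact_continuous_image compact_Times assms)
      (auto simp: split_def inner_dir intro!: continuous_intros)
  finally show ?thesis .
qed

lemma sets_lines_meeting: "compact K \<Longrightarrow> lines_meeting K \<in> sets lborel"
  using borel_compact[OF compact_lines_meeting] by simp

lemma emeasure_plane:
  fixes S :: "(real \<times> real) set"
  assumes "S \<in> sets lborel"
  shows "emeasure lborel S = (\<integral>\<^sup>+\<theta>. emeasure lborel (Pair \<theta> -` S) \<partial>lborel)"
proof -
  have "S \<in> sets (lborel \<Otimes>\<^sub>M lborel)" using assms by (simp only: lborel_prod)
  from lborel.emeasure_pair_measure_alt[OF this] show ?thesis by (simp only: lborel_prod)
qed

lemma emeasure_lines_meeting_place:
  assumes K: "compact K"
  shows "emeasure lborel (lines_meeting (place n x K)) = ennreal ((1/2) ^ n) * emeasure lborel (lines_meeting K)"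
proof -
  have c: "compact (place n x K)" unfolding place_def
    by (intro compact_continuous_image K continuous_intros)
  have sec: "emeasure lborel (Pair \<theta> -` lines_meeting (place n x K)) =
      ennreal ((1/2) ^ n) * emeasure lborel (Pair \<theta> -` lines_meeting K)" for \<theta>
  proof (cases "\<theta> \<in> {0..pi}")
    case True
    define S where "S = (\<lambda>x. x \<bullet> dir \<theta>) ` K"
    define T where "T = (\<lambda>x. x \<bullet> dir \<theta>) ` place n x K"
    have S: "S \<in> sets borel" unfolding S_def
      by (intro borel_compact compact_continuous_image K continuous_intros)
    have T: "T \<in> sets borel" unfolding T_def
      by (intro borel_compact compact_continuous_image c continuous_intros)
    have T_eq: "T = (\<lambda>a. x \<bullet> dir \<theta> + (1/2) ^ n * a) ` S"
      by (auto simp: T_def S_def place_def inner_add_left image_image)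
    have ind: "indicator T (x \<bullet> dir \<theta> + (1/2) ^ n * a) = (indicator S a :: ennreal)" for a
      by (auto simp: T_eq indicator_def)
    have "emeasure lborel T = (\<integral>\<^sup>+a. indicator T a \<partial>lborel)" using T by simp
    also have "\<dots> = ennreal \<bar>(1/2) ^ n\<bar> * (\<integral>\<^sup>+a. indicator T (x \<bullet> dir \<theta> + (1/2) ^ n * a) \<partial>lborel)"
      using T by (intro nn_integral_real_affine) auto
    also have "\<dots> = ennreal ((1/2) ^ n) * emeasure lborel S" using S by (simp add: ind)
    finally have "emeasure lborel T = ennreal ((1/2) ^ n) * emeasure lborel S" .
    moreover have "Pair \<theta> -` lines_meeting K = S" "Pair \<theta> -` lines_meeting (place n x K) = T"
      using True by (auto simp: lines_meeting_def S_def T_def)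
    ultimately show ?thesis by simp
  next
    case False
    then have "Pair \<theta> -` lines_meeting A = {}" for A by (auto simp: lines_meeting_def)
    then show ?thesis by simp
  qed
  have m: "(\<lambda>\<theta>. emeasure lborel (Pair \<theta> -` lines_meeting K)) \<in> borel_measurable lborel"
    using sets_lines_meeting[OF K] by (intro lborel.measurable_emeasure_Pair) (simp only: lborel_prod)
  show ?thesis
    unfolding emeasure_plane[OF sets_lines_meeting[OF K]] emeasure_plane[OF sets_lines_meeting[OF c]] sec
    using m by (rule nn_integral_cmult)
qed

lemma null_sets_graph:
  fixes f :: "real \<Rightarrow> real"
  assumes "continuous_on UNIV f" shows "{(\<theta>, a). a = f \<theta>} \<in> null_sets lborel"
proof -
  have "closed {(\<theta>, a). a = f \<theta>}" unfolding split_def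
    by (intro closed_Collect_eq continuous_intros continuous_on_compose2[OF assms]) auto
  then have S: "{(\<theta>, a). a = f \<theta>} \<in> sets lborel" by (simp add: borel_closed)
  have "Pair \<theta> -` {(\<theta>, a). a = f \<theta>} = {f \<theta>}" for \<theta> by auto
  then show ?thesis using S by (auto simp: null_sets_def emeasure_plane)
qed

definition unit_square :: "(real^2) set" where
  "unit_square = {u. \<forall>i. 0 \<le> u $ i \<and> u $ i \<le> 1}"

lemma compact_unit_square: "compact unit_square"
proof -
  have "unit_square = cbox 0 1" by (auto simp: unit_square_def mem_box_cart)
  moreover have "compact (cbox 0 1 :: (real^2) set)" by (rule compact_cbox)
  ultimately show ?thesis by metis
qed

definition squares :: "nat \<Rightarrow> (real^2) set \<Rightarrow> (real^2) set" where
  "squares n Y = (\<Union>y\<in>Y. place n y unit_square)"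

lemma compact_place: "compact K \<Longrightarrow> compact (place n x K)"
  unfolding place_def by (intro compact_continuous_image continuous_intros)

lemma compact_squares: "finite Y \<Longrightarrow> compact (squares n Y)"
  unfolding squares_def by (intro compact_UN compact_place compact_unit_square)

lemma place_place: "place n x (place k y S) = place (n + k) (x + (1/2) ^ n *\<^sub>R y) S"
  by (auto simp: place_def image_image power_add scaleR_add_right add.assoc)

lemma place_squares: "place n x (squares k Y) = squares (n + k) (place n x Y)"
proof -
  have "place n x (squares k Y) = (\<Union>y\<in>Y. place n x (place k y unit_square))"
    by (auto simp: squares_def place_def)
  then show ?thesis unfolding place_place squares_def by (simp add: place_def)
qed

lemma projection_unit_square:
  assumes "u \<in> unit_square"
  shows "lo c s \<le> u $ 1 * c + u $ 2 * s \<and> u $ 1 * c + u $ 2 * s \<le> hi c s"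
proof -
  have *: "min 0 w \<le> v * w \<and> v * w \<le> max 0 w" if "0 \<le> v" "v \<le> 1" for v w :: real
  proof (cases "w \<ge> 0")
    case True
    then show ?thesis using that mult_left_le_one_le[of w v] by auto
  next
    case False
    then show ?thesis using that mult_left_le_one_le[of "- w" v] by (auto simp: mult_nonneg_nonpos)
  qed
  show ?thesis using assms *[of "u $ 1" c] *[of "u $ 2" s]
    by (auto simp: unit_square_def lo_def hi_def intro!: add_mono)
qed

lemma lo_hi_bounds: "-2 \<le> lo (cos \<theta>) (sin \<theta>)" "hi (cos \<theta>) (sin \<theta>) \<le> 2"
proof -
  have "- 1 \<le> min 0 (cos \<theta>)" "- 1 \<le> min 0 (sin \<theta>)" "max 0 (cos \<theta>) \<le> 1" "max 0 (sin \<theta>) \<le> 1"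
    by simp_all
  then show "- 2 \<le> lo (cos \<theta>) (sin \<theta>)" "hi (cos \<theta>) (sin \<theta>) \<le> 2"
    unfolding lo_def hi_def by linarith+
qed

definition open_lines :: "nat \<Rightarrow> (real^2) set \<Rightarrow> (real \<times> real) set" where
  "open_lines n Y = {(\<theta>, a). \<theta> \<in> {0..pi} \<and> hits (cos \<theta>) (sin \<theta>) n Y a}"

lemma sets_open_lines:
  assumes "finite Y" shows "open_lines n Y \<in> sets lborel"
proof -
  let ?p = "\<lambda>y q. 2 ^ n * (snd q - (y $ 1 * cos (fst q) + y $ 2 * sin (fst q)))"
  have "open_lines n Y = (\<Union>y\<in>Y. ({0..pi} \<times> UNIV) \<inter> {q. lo (cos (fst q)) (sin (fst q)) < ?p y q}
      \<inter> {q. ?p y q < hi (cos (fst q)) (sin (fst q))})"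
    by (auto simp: open_lines_def hits_def)
  also have "\<dots> \<in> sets borel"
  proof (intro sets.finite_UN assms sets.Int)
    fix y
    show "{0..pi} \<times> UNIV \<in> sets (borel :: (real \<times> real) measure)"
      by (intro borel_closed closed_Times) auto
    show "{q. lo (cos (fst q)) (sin (fst q)) < ?p y q} \<in> sets borel"
      unfolding lo_def by (intro borel_open open_Collect_less continuous_intros)
    show "{q. ?p y q < hi (cos (fst q)) (sin (fst q))} \<in> sets borel"
      unfolding hi_def by (intro borel_open open_Collect_less continuous_intros)
  qed
  finally show ?thesis by simp
qed

text \<open>Compactness requires closed squares, whereas \<open>hit_prob\<close> counts open ones.
  Only supporting lines distinguish them, and for each square these form two graphs over \<theta>,
  hence a null set.\<close>

lemma emeasure_lines_meeting_squares:
  assumes fin: "finite Y"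
  shows "emeasure lborel (lines_meeting (squares n Y)) \<le> emeasure lborel (open_lines n Y)"
proof -
  define B where "B y = {(\<theta>, a). a = y \<bullet> dir \<theta> + lo (cos \<theta>) (sin \<theta>) / 2 ^ n} \<union>
     {(\<theta>, a). a = y \<bullet> dir \<theta> + hi (cos \<theta>) (sin \<theta>) / 2 ^ n}" for y
  have B: "B y \<in> null_sets lborel" for y unfolding B_def inner_dir lo_def hi_def
    by (intro null_sets.Un null_sets_graph continuous_intros) auto
  have N: "(\<Union>y\<in>Y. B y) \<in> null_sets lborel" using fin B by (intro null_sets_UN') (auto intro: countable_finite)
  have "lines_meeting (squares n Y) \<subseteq> open_lines n Y \<union> (\<Union>y\<in>Y. B y)"
  proof
    fix q assume "q \<in> lines_meeting (squares n Y)"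
    then obtain \<theta> y u where q: "\<theta> \<in> {0..pi}" "y \<in> Y" "u \<in> unit_square" "q = (\<theta>, (y + (1/2) ^ n *\<^sub>R u) \<bullet> dir \<theta>)"
      by (auto simp: lines_meeting_def squares_def place_def)
    define a where "a = (y + (1/2) ^ n *\<^sub>R u) \<bullet> dir \<theta>"
    have eq: "2 ^ n * (a - (y $ 1 * cos \<theta> + y $ 2 * sin \<theta>)) = u $ 1 * cos \<theta> + u $ 2 * sin \<theta>"
      by (simp add: a_def inner_dir field_simps)
    then have a: "a = y \<bullet> dir \<theta> + (u $ 1 * cos \<theta> + u $ 2 * sin \<theta>) / 2 ^ n"
      by (simp add: inner_dir field_simps)
    have *: "lo (cos \<theta>) (sin \<theta>) \<le> u $ 1 * cos \<theta> + u $ 2 * sin \<theta>" "u $ 1 * cos \<theta> + u $ 2 * sin \<theta> \<le> hi (cos \<theta>) (sin \<theta>)"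
      using projection_unit_square[OF q(3)] by auto
    show "q \<in> open_lines n Y \<union> (\<Union>y\<in>Y. B y)"
    proof (cases "u $ 1 * cos \<theta> + u $ 2 * sin \<theta> \<in> {lo (cos \<theta>) (sin \<theta>), hi (cos \<theta>) (sin \<theta>)}")
      case True
      then have "(\<theta>, a) \<in> B y" using a by (auto simp: B_def)
      then show ?thesis using q by (auto simp: a_def)
    next
      case False
      then have "hits (cos \<theta>) (sin \<theta>) n Y a" unfolding hits_def using * q(2) eq by (intro bexI[of _ y]) auto
      then show ?thesis using q by (simp add: open_lines_def a_def)
    qed
  qed
  then have "emeasure lborel (lines_meeting (squares n Y)) \<le> emeasure lborel (open_lines n Y \<union> (\<Union>y\<in>Y. B y))"
    using sets_open_lines[OF fin] N by (intro emeasure_mono sets.Un) auto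
  also have "\<dots> = emeasure lborel (open_lines n Y)"
    using sets_open_lines[OF fin] N by (rule emeasure_Un_null_set)
  finally show ?thesis .
qed

lemma emeasure_strip: "emeasure lborel ({0..pi} \<times> {-2..2 :: real}) = ennreal (4 * pi)"
proof -
  have "emeasure (lborel \<Otimes>\<^sub>M lborel) ({0..pi} \<times> {-2..2 :: real}) = emeasure lborel {0..pi} * emeasure lborel {-2..2 :: real}"
    by (rule lborel.emeasure_pair_measure_Times) auto
  also have "\<dots> = ennreal (4 * pi)" by (simp add: ennreal_mult'[symmetric] mult.commute del: ennreal_numeral)
  finally show ?thesis by (simp add: lborel_prod)
qed

text \<open>Every pattern is met only by lines in the strip of area 4 pi, and each line hits with
  probability at most 2 divided by the total gain. The mean area is therefore at most 8 pi divided
  by the gain, and the best outcome does not exceed the mean.\<close>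

lemma ex_sparse_pattern:
  assumes W: "(\<Sum>i<length bs. gain bs i) > 0"
  shows "\<exists>Y\<in>set (patterns bs). emeasure lborel (lines_meeting (squares (length bs) Y))
    \<le> ennreal (8 * pi / (\<Sum>i<length bs. gain bs i))"
proof -
  define W where "W = (\<Sum>i<length bs. gain bs i)"
  define L where "L = length (patterns bs)"
  define Y where "Y i = patterns bs ! i" for i
  define n where "n = length bs"
  have L: "L > 0" using patterns_nonempty[of bs] by (simp add: L_def)
  have W0: "W > 0" using W by (simp add: W_def)
  have finY: "finite (Y i)" if "i < L" for i
    using spread_patterns[of "Y i" bs] that by (auto simp: spread_def Y_def L_def)
  have pw: "(\<Sum>i<L. indicator (open_lines n (Y i)) q) \<le> ennreal (real L * (2 / W)) * indicator ({0..pi} \<times> {-2..2}) q" for q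
  proof (cases q)
    case (Pair \<theta> a)
    define S where "S = (\<Sum>i<L. of_bool (hits (cos \<theta>) (sin \<theta>) n (Y i) a) :: real)"
    have cs: "cos \<theta> \<noteq> 0 \<or> sin \<theta> \<noteq> 0" by (metis add_0 power_zero_numeral sin_cos_squared_add zero_neq_one)
    have S: "S = real L * hit_prob (cos \<theta>) (sin \<theta>) bs a"
      using sum_list_patterns[of "cos \<theta>" "sin \<theta>" bs a]
      by (simp add: S_def L_def Y_def n_def sum_list_sum_nth lessThan_atLeast0)
    show ?thesis
    proof (cases "\<theta> \<in> {0..pi} \<and> a \<in> {-2..2}")
      case True
      have "(\<Sum>i<L. indicator (open_lines n (Y i)) q) = (\<Sum>i<L. ennreal (of_bool (hits (cos \<theta>) (sin \<theta>) n (Y i) a)))"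
        using True by (intro sum.cong refl) (auto simp: Pair open_lines_def indicator_def)
      also have "\<dots> = ennreal S" unfolding S_def by (rule sum_ennreal) simp
      also have "S \<le> real L * (2 / W)"
      proof -
        have "hit_prob (cos \<theta>) (sin \<theta>) bs a * W \<le> 2" unfolding W_def by (rule hit_prob_le[OF cs])
        then have "hit_prob (cos \<theta>) (sin \<theta>) bs a \<le> 2 / W" using W0 by (simp add: pos_le_divide_eq)
        then show ?thesis unfolding S by (rule mult_left_mono) simp
      qed
      finally show ?thesis using True Pair by (simp add: ennreal_leI)
    next
      case False
      have "q \<notin> open_lines n (Y i)" if "i < L" for i
      proof
        assume "q \<in> open_lines n (Y i)"
        then have h: "\<theta> \<in> {0..pi}" "hits (cos \<theta>) (sin \<theta>) n (Y i) a" by (auto simp: open_lines_def Pair)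
        have "1 \<le> S" unfolding S_def using that h(2)
          by (intro order_trans[OF _ member_le_sum[of i]]) auto
        then have "hit_prob (cos \<theta>) (sin \<theta>) bs a \<noteq> 0" unfolding S by auto
        then have "a \<in> {-2..2}" using hit_prob_support[of "cos \<theta>" "sin \<theta>" bs a] lo_hi_bounds[of \<theta>] by auto
        then show False using False h(1) by simp
      qed
      then show ?thesis by simp
    qed
  qed
  define e where "e i = emeasure lborel (open_lines n (Y i))" for i
  have "(\<Sum>i<L. e i) = (\<integral>\<^sup>+q. (\<Sum>i<L. indicator (open_lines n (Y i)) q) \<partial>lborel)"
    unfolding e_def using sets_open_lines finY by (subst nn_integral_sum) auto
  also have "\<dots> \<le> (\<integral>\<^sup>+q. ennreal (real L * (2 / W)) * indicator ({0..pi} \<times> {-2..2::real}) q \<partial>lborel)"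
    by (intro nn_integral_mono pw)
  also have "\<dots> = ennreal (real L * (2 / W)) * ennreal (4 * pi)"
  proof -
    have "{0..pi} \<times> {-2..2::real} \<in> sets lborel"
      using borel_closed[OF closed_Times[of "{0..pi}" "{-2..2::real}"]] by simp
    then show ?thesis by (simp add: nn_integral_cmult emeasure_strip)
  qed
  also have "\<dots> = of_nat L * ennreal (8 * pi / W)"
    using W0 by (simp add: ennreal_mult[symmetric] ennreal_of_nat_eq_real_of_nat mult_ac)
  finally have tot: "(\<Sum>i<L. e i) \<le> of_nat L * ennreal (8 * pi / W)" .
  obtain i where i: "i < L" "\<And>j. j < L \<Longrightarrow> e i \<le> e j"
  proof -
    have "\<exists>m\<in>e ` {..<L}. \<not> (\<exists>x\<in>e ` {..<L}. x < m)" using L by (intro ex_min_if_finite) auto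
    then show ?thesis using that by (auto simp: not_less)
  qed
  have "of_nat L * e i = (\<Sum>j<L. e i)" by simp
  also have "\<dots> \<le> (\<Sum>j<L. e j)" using i by (intro sum_mono) auto
  also note tot
  finally have "e i \<le> ennreal (8 * pi / W)"
    using L by (subst (asm) ennreal_mult_le_mult_iff) auto
  then have "emeasure lborel (lines_meeting (squares n (Y i))) \<le> ennreal (8 * pi / W)"
    using emeasure_lines_meeting_squares[OF finY[OF i(1)], of n] by (simp add: e_def)
  moreover have "Y i \<in> set (patterns bs)" using i(1) by (simp add: Y_def L_def)
  ultimately show ?thesis by (auto simp: n_def W_def)
qed

section \<open>Invisible sets of positive content\<close>

text \<open>\<open>g_dec\<close> and \<open>g_quarter\<close> are the dyadic forms of the two
  monotonicity hypotheses. They allow the reciprocal of \<open>g\<close> to be tracked up to a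
  constant by a sequence that grows by a factor 1 or 4 at each level.\<close>

locale slow_weights =
  fixes g :: "nat \<Rightarrow> real"
  assumes g_pos: "\<And>k. 0 < g k" and g_dec: "\<And>k. g (Suc k) \<le> g k" and g_quarter: "\<And>k. g k \<le> 4 * g (Suc k)"
    and diverges: "\<not> summable (\<lambda>k. 2 ^ k * g k)"
begin

text \<open>The numbers of squares of the levels are chosen such that \<open>num k * g k\<close> stays between
  \<open>g 0\<close> and \<open>4 * g 0\<close>.\<close>

fun num :: "nat \<Rightarrow> real" where
  "num 0 = 1"
| "num (Suc k) = (if num k * g (Suc k) < g 0 then 4 * num k else num k)"

definition keep_all :: "nat \<Rightarrow> bool" where
  "keep_all k \<longleftrightarrow> num k * g (Suc k) < g 0"

definition bits :: "nat \<Rightarrow> nat \<Rightarrow> bool list" where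
  "bits m n = map keep_all [m..<n]"

lemma num_pos: "num k > 0"
  by (induction k) auto

lemma num_bounds: "g 0 \<le> num k * g k \<and> num k * g k < 4 * g 0"
proof (induction k)
  case 0 then show ?case using g_pos[of 0] by simp
next
  case (Suc k)
  have "num k * g (Suc k) \<le> num k * g k" using g_dec num_pos[of k] by (intro mult_left_mono) auto
  moreover have "num k * g k \<le> num k * (4 * g (Suc k))" using g_quarter num_pos[of k] by (intro mult_left_mono) auto
  ultimately show ?case using Suc by (auto simp: algebra_simps)
qed

lemma length_bits [simp]: "length (bits m n) = n - m"
  by (simp add: bits_def)

lemma num_bits: "m \<le> n \<Longrightarrow> 4 ^ count_list (bits m n) True * num m = num n"
proof (induction n)
  case (Suc n)
  show ?case
  proof (cases "m \<le> n")
    case True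
    then have "bits m (Suc n) = bits m n @ [keep_all n]" by (simp add: bits_def)
    then show ?thesis using Suc.IH[OF True] by (auto simp: keep_all_def)
  next
    case False
    then have "m = Suc n" using Suc.prems by simp
    then show ?thesis by (simp add: bits_def)
  qed
qed (simp add: bits_def)

lemma take_bits: "i \<le> n - m \<Longrightarrow> take i (bits m n) = bits m (m + i)"
  by (cases "i = 0") (auto simp: bits_def take_map take_upt)

lemma drop_bits: "drop i (bits m n) = bits (m + i) n"
  by (simp add: bits_def drop_map)

lemma bits_append: "l \<le> m \<Longrightarrow> m \<le> n \<Longrightarrow> bits l m @ bits m n = bits l n"
  unfolding bits_def map_append[symmetric] using upt_add_eq_append[of l m "n - m"] by simp

lemma count_False_True: "count_list xs False + count_list xs True = length xs"
  by (induction xs) auto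

text \<open>Among \<open>i\<close> bits the powers of 4 for \<open>False\<close> and for
  \<open>True\<close> multiply to 4^i, and the latter is \<open>num (m + i) / num m\<close>. So up
  to a factor depending on \<open>m\<close> only, the gain is 2^k / num k at k = m + i.\<close>

lemma gain_bits:
  assumes "i < n - m"
  shows "gain (bits m n) i = num m / (6 * 2 ^ m) * (if keep_all (m + i) then 0 else 2 ^ (m + i) / num (m + i))"
proof -
  have nth: "bits m n ! i = keep_all (m + i)" using assms by (simp add: bits_def)
  let ?T = "count_list (bits m (m + i)) True" and ?F = "count_list (bits m (m + i)) False"
  have "?F + ?T = i" using count_False_True[of "bits m (m + i)"] by simp
  then have "(4::real) ^ ?F * 4 ^ ?T = 4 ^ i" by (simp flip: power_add)
  moreover have "4 ^ ?T * num m = num (m + i)" by (rule num_bits) simp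
  ultimately have "4 ^ ?F * num (m + i) = 4 ^ i * num m"
    by (metis mult.assoc)
  then have "4 ^ ?F = 4 ^ i * num m / num (m + i)" using num_pos[of "m + i"] by (simp add: field_simps)
  also have "(4::real) ^ i = 2 ^ i * 2 ^ i" by (simp flip: power_mult_distrib)
  finally have F: "4 ^ ?F = 2 ^ i * 2 ^ i * num m / num (m + i)" .
  show ?thesis using assms
    by (simp add: gain_def nth take_bits F power_add)
qed

text \<open>The term 2^k / num k halves at a level that keeps all quarters and doubles at the
  others. Adding twice the current term makes the induction exact: the total is unchanged in the
  first case and grows by three terms in the second.\<close>

lemma sum_all_levels_le:
  "(\<Sum>k<n. 2 ^ k / num k) \<le> 2 + 3 * (\<Sum>k<n. if keep_all k then 0 else 2 ^ k / num k)"
proof -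
  have "(\<Sum>k<n. 2 ^ k / num k) + 2 * (2 ^ n / num n) \<le> 2 + 3 * (\<Sum>k<n. if keep_all k then 0 else 2 ^ k / num k)"
  proof (induction n)
    case (Suc n)
    have "2 ^ Suc n / num (Suc n) = (if keep_all n then 2 ^ n / num n / 2 else 2 * (2 ^ n / num n))"
      by (simp add: keep_all_def)
    then show ?case using Suc by (auto split: if_splits)
  qed simp
  moreover have "0 \<le> 2 * (2 ^ n / num n)" using num_pos[of n] by simp
  ultimately show ?thesis by linarith
qed

text \<open>Bounded gains after level \<open>m\<close> would bound the sum of 2^k / num k over the
  levels that keep one quarter, then over all levels, and finally the sum of 2^k \<open>g k\<close>,
  because \<open>g k\<close> is below \<open>4 * g 0 / num k\<close>.\<close>

lemma sum_gain_unbounded: "\<exists>n>m. B \<le> (\<Sum>i<length (bits m n). gain (bits m n) i)"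
proof (rule ccontr)
  assume contra: "\<not> ?thesis"
  define \<beta> where "\<beta> k = (if keep_all k then 0 else 2 ^ k / num k)" for k
  define q where "q = num m / (6 * 2 ^ m)"
  have q: "q > 0" using num_pos[of m] by (simp add: q_def)
  have \<beta>0: "0 \<le> \<beta> k" for k using num_pos[of k] by (simp add: \<beta>_def)
  have gain: "(\<Sum>i<length (bits m n). gain (bits m n) i) = q * (\<Sum>k\<in>{m..<n}. \<beta> k)" if "n > m" for n
  proof -
    have "(\<Sum>i<length (bits m n). gain (bits m n) i) = (\<Sum>i<n - m. q * \<beta> (m + i))"
      by (intro sum.cong) (auto simp: gain_bits q_def \<beta>_def)
    also have "\<dots> = q * (\<Sum>i\<in>{0..<n - m}. \<beta> (i + m))" by (simp add: sum_distrib_left lessThan_atLeast0 add.commute)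
    also have "(\<Sum>i\<in>{0..<n - m}. \<beta> (i + m)) = (\<Sum>k\<in>{0 + m..<(n - m) + m}. \<beta> k)"
      by (rule sum.shift_bounds_nat_ivl[symmetric])
    finally show ?thesis using that by simp
  qed
  have "(\<Sum>k<n. 2 ^ k * g k) \<le> 4 * g 0 * (2 + 3 * ((\<Sum>k<m. \<beta> k) + B / q))" for n
  proof -
    define N where "N = n + m + 1"
    have N: "m < N" by (simp add: N_def)
    then have "(\<Sum>i<length (bits m N). gain (bits m N) i) < B" using contra by (meson not_le)
    then have "q * (\<Sum>k\<in>{m..<N}. \<beta> k) < B" by (simp only: gain[OF N])
    then have "(\<Sum>k\<in>{m..<N}. \<beta> k) \<le> B / q" using q by (simp add: field_simps)
    moreover have "(\<Sum>k<N. \<beta> k) = (\<Sum>k<m. \<beta> k) + (\<Sum>k\<in>{m..<N}. \<beta> k)"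
      unfolding lessThan_atLeast0 by (rule sum.atLeastLessThan_concat[symmetric]) (auto simp: N_def)
    ultimately have b: "(\<Sum>k<N. \<beta> k) \<le> (\<Sum>k<m. \<beta> k) + B / q" by simp
    have "2 ^ k * g k \<le> 4 * g 0 * (2 ^ k / num k)" for k
    proof -
      have "g k \<le> 4 * g 0 / num k" using num_bounds[of k] num_pos[of k] by (simp add: field_simps)
      then have "2 ^ k * g k \<le> 2 ^ k * (4 * g 0 / num k)" by (rule mult_left_mono) simp
      then show ?thesis by (simp add: mult_ac)
    qed
    then have "(\<Sum>k<n. 2 ^ k * g k) \<le> (\<Sum>k<n. 4 * g 0 * (2 ^ k / num k))" by (intro sum_mono)
    also have "\<dots> = 4 * g 0 * (\<Sum>k<n. 2 ^ k / num k)" by (simp only: sum_distrib_left)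
    also have "(\<Sum>k<n. 2 ^ k / num k) \<le> 2 + 3 * (\<Sum>k<n. \<beta> k)"
      unfolding \<beta>_def by (rule sum_all_levels_le)
    also have "(\<Sum>k<n. \<beta> k) \<le> (\<Sum>k<N. \<beta> k)" using \<beta>0 by (intro sum_mono2) (auto simp: N_def)
    also note b
    finally show ?thesis using g_pos[of 0] by (simp add: mult_left_mono)
  qed
  note bound = this
  have "summable (\<lambda>k. 2 ^ k * g k)"
  proof (rule bounded_imp_summable)
    show "0 \<le> 2 ^ k * g k" for k using g_pos[of k] by simp
    show "(\<Sum>k\<le>n. 2 ^ k * g k) \<le> 4 * g 0 * (2 + 3 * ((\<Sum>k<m. \<beta> k) + B / q))" for n
      using bound[of "Suc n"] by (simp only: lessThan_Suc_atMost)
  qed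
  then show False using diverges by simp
qed

text \<open>The same sparse pattern is placed in each of the \<open>num m\<close> squares of the
  stage, shrunk by 2^-m. The areas add up to at most \<epsilon> because the pattern is taken with
  area at most \<epsilon> / (num m * 2^-m).\<close>

lemma ex_stage:
  assumes \<epsilon>: "\<epsilon> > 0" and X: "spread (bits 0 m) X"
  shows "\<exists>n>m. \<exists>X'. spread (bits 0 n) X' \<and> squares n X' \<subseteq> squares m X \<and>
    emeasure lborel (lines_meeting (squares n X')) \<le> ennreal \<epsilon>"
proof -
  define \<delta> where "\<delta> = \<epsilon> / (num m * (1/2) ^ m)"
  have \<delta>: "\<delta> > 0" using \<epsilon> num_pos[of m] by (simp add: \<delta>_def)
  obtain n where n: "n > m" and W: "8 * pi / \<delta> \<le> (\<Sum>i<length (bits m n). gain (bits m n) i)"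
    using sum_gain_unbounded by blast
  define W where "W = (\<Sum>i<length (bits m n). gain (bits m n) i)"
  have "0 < 8 * pi / \<delta>" using \<delta> by simp
  then have W0: "W > 0" using W unfolding W_def by linarith
  obtain Y where Y: "Y \<in> set (patterns (bits m n))"
    "emeasure lborel (lines_meeting (squares (n - m) Y)) \<le> ennreal (8 * pi / W)"
    using ex_sparse_pattern[of "bits m n"] W0 by (auto simp: W_def)
  have "8 * pi / W \<le> \<delta>" using W W0 \<delta> by (simp add: W_def field_simps)
  then have Y2: "emeasure lborel (lines_meeting (squares (n - m) Y)) \<le> ennreal \<delta>"
    using Y(2) by (meson ennreal_leI order_trans)
  have sY: "spread (bits m n) Y" by (rule spread_patterns[OF Y(1)])
  define X' where "X' = (\<Union>x\<in>X. place m x Y)"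
  have spread: "spread (bits 0 n) X'"
  proof -
    have "spread (bits 0 m @ bits m n) (\<Union>x\<in>X. place (length (bits 0 m)) x Y)"
      by (intro spread_compose X sY)
    moreover have "bits 0 m @ bits m n = bits 0 n" using n by (intro bits_append) auto
    ultimately show ?thesis by (simp add: X'_def)
  qed
  have sq: "squares n X' = (\<Union>x\<in>X. place m x (squares (n - m) Y))"
    using n by (simp add: place_squares X'_def) (simp add: squares_def)
  have finX: "finite X" and cX: "card X = 4 ^ count_list (bits 0 m) True" using X by (auto simp: spread_def)
  have finY: "finite Y" and gY: "\<And>y. y \<in> Y \<Longrightarrow> grid_point (n - m) y" using sY by (auto simp: spread_def)
  have "squares (n - m) Y \<subseteq> unit_square"
  proof
    fix z assume "z \<in> squares (n - m) Y"
    then obtain y u where yu: "y \<in> Y" "u \<in> unit_square" "z = y + (1/2) ^ (n - m) *\<^sub>R u"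
      by (auto simp: squares_def place_def)
    have "0 \<le> z $ i \<and> z $ i \<le> 1" for i
    proof -
      have "0 \<le> u $ i" "u $ i \<le> 1" using yu(2) by (auto simp: unit_square_def)
      then have "0 \<le> (1/2) ^ (n - m) * u $ i" "(1/2) ^ (n - m) * u $ i \<le> (1/2) ^ (n - m)"
        by (auto intro: mult_left_le)
      moreover have "z $ i = y $ i + (1/2) ^ (n - m) * u $ i" by (simp add: yu(3))
      ultimately show ?thesis using grid_point_bounds[OF gY[OF yu(1)], of i] by linarith
    qed
    then show "z \<in> unit_square" by (simp add: unit_square_def)
  qed
  then have sub: "squares n X' \<subseteq> squares m X"
    unfolding sq unfolding squares_def place_def by blast
  have "emeasure lborel (lines_meeting (squares n X')) \<le> (\<Sum>x\<in>X. emeasure lborel (lines_meeting (place m x (squares (n - m) Y))))"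
    unfolding sq lines_meeting_UN using finX finY
    by (intro emeasure_subadditive_finite) (auto intro!: sets_lines_meeting[simplified] compact_place compact_squares)
  also have "\<dots> = of_nat (card X) * (ennreal ((1/2) ^ m) * emeasure lborel (lines_meeting (squares (n - m) Y)))"
    using finY by (simp add: emeasure_lines_meeting_place compact_squares)
  also have "\<dots> \<le> of_nat (card X) * (ennreal ((1/2) ^ m) * ennreal \<delta>)"
    using Y2 by (intro mult_left_mono) auto
  also have "\<dots> = ennreal (num m * ((1/2) ^ m * \<delta>))"
  proof -
    have "real (card X) = num m" using num_bits[of 0 m] by (simp add: cX)
    then have "of_nat (card X) = ennreal (num m)" by (metis ennreal_of_nat_eq_real_of_nat)
    then show ?thesis using \<delta> num_pos[of m] by (simp add: ennreal_mult less_imp_le)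
  qed
  also have "num m * ((1/2) ^ m * \<delta>) = \<epsilon>" using num_pos[of m] by (simp add: \<delta>_def)
  finally show ?thesis using n spread sub by blast
qed

text \<open>A mass distribution argument: equidistributed unit mass on the corners gives a cell of
  level k at most 1 / num k, which is at most \<open>g k / g 0\<close>. So a finite cover of a stage
  weighs at least \<open>g 0\<close>, and a cover of the intersection at least
  \<open>g 0 / 9\<close>.\<close>

lemma net_content_spread_pos:
  fixes m :: "nat \<Rightarrow> nat"
  assumes X: "\<And>j. spread (bits 0 (m j)) (X j)" and m: "strict_mono m"
    and dec: "decseq (\<lambda>j. squares (m j) (X j))"
  shows "net_content g (\<Inter>j. squares (m j) (X j)) > 0"
proof (rule ccontr)
  assume "\<not> ?thesis"
  then have "net_content g (\<Inter>j. squares (m j) (X j)) < ennreal (g 0 / 9)" using g_pos[of 0] by simp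
  then obtain Q where Q: "(\<Inter>j. squares (m j) (X j)) \<subseteq> cells Q" "emeasure (net_measure g) Q < ennreal (g 0 / 9)"
    by (rule net_content_lessE)
  have comp: "compact (squares (m j) (X j))" for j using X[of j] by (intro compact_squares) (simp add: spread_def)
  obtain n R where R: "finite R" "squares (m n) (X n) \<subseteq> cells R"
    "emeasure (net_measure g) R \<le> 9 * emeasure (net_measure g) Q"
    using compact_decseq_cells[OF comp dec Q(1)] by metis
  \<comment> \<open>A stage past \<open>n\<close> whose squares are at least as fine as every cell
    of \<open>R\<close>, so that the share bounds of \<open>spread\<close> apply to all these
    cells.\<close>
  define j where "j = Max (insert n (fst ` R))"
  have j: "n \<le> j" "\<And>q. q \<in> R \<Longrightarrow> fst q \<le> m j"
  proof -
    show "n \<le> j" unfolding j_def using R(1) by auto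
    fix q assume "q \<in> R"
    then have "fst q \<le> j" unfolding j_def using R(1) by auto
    also have "j \<le> m j" by (rule strict_mono_imp_increasing[OF m])
    finally show "fst q \<le> m j" .
  qed
  have finX: "finite (X j)" using X[of j] by (simp add: spread_def)
  have "X j \<subseteq> squares (m j) (X j)"
  proof
    fix x assume x: "x \<in> X j"
    have "x \<in> place (m j) x unit_square" unfolding place_def
      by (rule image_eqI[of _ _ 0]) (auto simp: unit_square_def)
    then show "x \<in> squares (m j) (X j)" using x by (auto simp: squares_def)
  qed
  also have "\<dots> \<subseteq> cells R" using dec j(1) R(2) by (auto simp: decseq_def)
  finally have "X j \<subseteq> (\<Union>q\<in>R. {x\<in>X j. cell (fst q) x = snd q})" by (force simp: cells_def)
  then have "card (X j) \<le> card (\<Union>q\<in>R. {x\<in>X j. cell (fst q) x = snd q})"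
    using finX R(1) by (intro card_mono) auto
  also have "\<dots> \<le> (\<Sum>q\<in>R. card {x\<in>X j. cell (fst q) x = snd q})" by (rule card_UN_le[OF R(1)])
  also have "\<dots> \<le> (\<Sum>q\<in>R. 4 ^ count_list (bits (fst q) (m j)) True)"
  proof (intro sum_mono)
    fix q assume "q \<in> R"
    then have "fst q \<le> length (bits 0 (m j))" using j(2) by simp
    then have "card {x\<in>X j. cell (fst q) x = snd q} \<le> 4 ^ count_list (drop (fst q) (bits 0 (m j))) True"
      using X[of j] unfolding spread_def by blast
    then show "card {x\<in>X j. cell (fst q) x = snd q} \<le> 4 ^ count_list (bits (fst q) (m j)) True"
      by (simp add: drop_bits)
  qed
  finally have "real (card (X j)) \<le> real (\<Sum>q\<in>R. 4 ^ count_list (bits (fst q) (m j)) True)" by (rule of_nat_mono)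
  also have "real (card (X j)) = num (m j)" using X[of j] num_bits[of 0 "m j"] by (simp add: spread_def)
  also have "real (\<Sum>q\<in>R. 4 ^ count_list (bits (fst q) (m j)) True) \<le> (\<Sum>q\<in>R. num (m j) * (g (fst q) / g 0))"
    unfolding of_nat_sum
  proof (intro sum_mono)
    fix q assume q: "q \<in> R"
    have "real (4 ^ count_list (bits (fst q) (m j)) True) = num (m j) / num (fst q)"
      using num_bits[OF j(2)[OF q]] num_pos[of "fst q"] by (simp add: field_simps)
    also have "\<dots> = num (m j) * (1 / num (fst q))" by simp
    also have "1 / num (fst q) \<le> g (fst q) / g 0"
      using num_bounds[of "fst q"] num_pos[of "fst q"] g_pos[of 0] by (simp add: field_simps)
    finally show "real (4 ^ count_list (bits (fst q) (m j)) True) \<le> num (m j) * (g (fst q) / g 0)"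
      using num_pos[of "m j"] by (simp add: mult_left_mono)
  qed
  also have "\<dots> = num (m j) * ((\<Sum>q\<in>R. g (fst q)) / g 0)"
    by (simp add: sum_distrib_left sum_divide_distrib)
  finally have "num (m j) * 1 \<le> num (m j) * ((\<Sum>q\<in>R. g (fst q)) / g 0)" by simp
  then have "1 \<le> (\<Sum>q\<in>R. g (fst q)) / g 0" using num_pos[of "m j"] by (simp only: mult_le_cancel_left_pos)
  then have "g 0 \<le> (\<Sum>q\<in>R. g (fst q))" using g_pos[of 0] by (simp add: field_simps)
  then have "ennreal (g 0) \<le> emeasure (net_measure g) R"
    using g_pos R(1) by (simp add: net_measure_finite less_imp_le ennreal_leI)
  also have "\<dots> \<le> 9 * emeasure (net_measure g) Q" by (rule R(3))
  also have "\<dots> < 9 * ennreal (g 0 / 9)" using Q(2) by (intro ennreal_mult_strict_left_mono) auto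
  also have "\<dots> = ennreal (9 * (g 0 / 9))" by (simp only: ennreal_mult' ennreal_numeral zero_le_numeral)
  finally show False by simp
qed

theorem ex_invisible_set:
  "\<exists>A. compact A \<and> net_content g A > 0 \<and> emeasure lborel (lines_meeting A) = 0"
proof -
  define P where "P = (\<lambda>(j::nat) s. case s of (m, X) \<Rightarrow> spread (bits 0 m) X)"
  define R where "R = (\<lambda>(j::nat) s s'. case s of (m, X) \<Rightarrow> case s' of (n, X') \<Rightarrow> m < n \<and>
    squares n X' \<subseteq> squares m X \<and> emeasure lborel (lines_meeting (squares n X')) \<le> ennreal ((1/2) ^ j))"
  have "\<exists>f. \<forall>j. P j (f j) \<and> R j (f j) (f (Suc j))"
  proof (rule dependent_nat_choice)
    have "bits 0 0 = []" by (simp add: bits_def)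
    then show "\<exists>s. P 0 s" unfolding P_def using spread_Nil by (intro exI[of _ "(0, {0})"]) simp
    fix s j assume "P j s"
    then obtain m X where s: "s = (m, X)" "spread (bits 0 m) X" by (auto simp: P_def)
    obtain n X' where "n > m" "spread (bits 0 n) X'" "squares n X' \<subseteq> squares m X"
      "emeasure lborel (lines_meeting (squares n X')) \<le> ennreal ((1/2) ^ j)"
      using ex_stage[OF _ s(2), of "(1/2) ^ j"] by auto
    then show "\<exists>s'. P (Suc j) s' \<and> R j s s'" by (intro exI[of _ "(n, X')"]) (simp add: P_def R_def s)
  qed
  then obtain f where f: "\<And>j. P j (f j)" "\<And>j. R j (f j) (f (Suc j))" by blast
  define m X where "m j = fst (f j)" and "X j = snd (f j)" for j
  have fj: "f j = (m j, X j)" for j by (simp add: m_def X_def)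
  have X: "spread (bits 0 (m j)) (X j)" for j using f(1)[of j] by (simp add: P_def fj)
  have step: "m j < m (Suc j)" "squares (m (Suc j)) (X (Suc j)) \<subseteq> squares (m j) (X j)"
    "emeasure lborel (lines_meeting (squares (m (Suc j)) (X (Suc j)))) \<le> ennreal ((1/2) ^ j)" for j
    using f(2)[of j] by (auto simp: R_def fj)
  define A where "A = (\<Inter>j. squares (m j) (X j))"
  have comp: "compact (squares (m j) (X j))" for j using X[of j] by (intro compact_squares) (simp add: spread_def)
  have "compact A" unfolding A_def using comp by (auto intro!: compact_Inter)
  moreover have "net_content g A > 0" unfolding A_def
    using step by (intro net_content_spread_pos X) (auto intro!: strict_mono_Suc_iff[THEN iffD2] decseq_SucI)
  moreover have "emeasure lborel (lines_meeting A) = 0"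
  proof -
    have le: "emeasure lborel (lines_meeting A) \<le> ennreal ((1/2) ^ j)" for j
    proof -
      have "emeasure lborel (lines_meeting A) \<le> emeasure lborel (lines_meeting (squares (m (Suc j)) (X (Suc j))))"
        using sets_lines_meeting[OF comp] by (intro emeasure_mono lines_meeting_mono) (auto simp: A_def)
      then show ?thesis using step(3)[of j] by (rule order_trans)
    qed
    have "emeasure lborel (lines_meeting A) \<le> 0"
    proof (rule ennreal_le_epsilon)
      fix e :: real assume e: "e > 0"
      obtain j where j: "(1/2) ^ j < e" using real_arch_pow_inv[OF e, of "1/2"] by auto
      show "emeasure lborel (lines_meeting A) \<le> 0 + ennreal e"
        using order_trans[OF le[of j] ennreal_leI[of "(1/2) ^ j" e]] j by simp
    qed
    then show ?thesis by simp
  qed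
  ultimately show ?thesis by blast
qed

end

section \<open>Projections and the integral-geometric measure\<close>

lemma L1_on_line_proj: "L1_on_line \<theta> (proj \<theta> ` A) = outer_measure_of lebesgue ((\<lambda>x. x \<bullet> dir \<theta>) ` A)"
proof -
  have "dir \<theta> \<bullet> dir \<theta> = 1"
    by (simp add: inner_dir) (simp add: dir_def flip: power2_eq_square)
  then have "dir \<theta> \<noteq> 0" by force
  then have "{t. t *\<^sub>R dir \<theta> \<in> proj \<theta> ` A} = (\<lambda>x. x \<bullet> dir \<theta>) ` A"
    by (auto simp: proj_def image_iff)
  then show ?thesis by (simp add: L1_on_line_def)
qed

lemma compact_projection: "compact K \<Longrightarrow> compact ((\<lambda>x. x \<bullet> dir \<theta>) ` K)"
  by (intro compact_continuous_image continuous_intros)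

lemma outer_measure_projection_compact:
  assumes "compact K"
  shows "outer_measure_of lebesgue ((\<lambda>x. x \<bullet> dir \<theta>) ` K) = emeasure lborel ((\<lambda>x. x \<bullet> dir \<theta>) ` K)"
proof -
  have "(\<lambda>x. x \<bullet> dir \<theta>) ` K \<in> sets borel" by (intro borel_compact compact_projection assms)
  then show ?thesis by (subst outer_measure_of_eq) auto
qed

section \<open>Transport between the parameter plane and the space of lines\<close>

definition line_param :: "real \<times> real \<Rightarrow> (real^2) set" where
  "line_param = (\<lambda>(\<theta>, a). perp_line \<theta> a)"

definition line_params :: "(real \<times> real) set" where
  "line_params = {0..<pi} \<times> UNIV"

lemma line_measure_eq: "line_measure = embed_measure (lebesgue_on line_params) line_param"
  by (simp add: line_measure_def line_params_def line_param_def)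

lemma sets_line_params: "line_params \<in> sets borel"
  unfolding line_params_def borel_prod[symmetric] by (intro pair_measureI) auto

lemma inj_line_param: "inj_on line_param line_params"
  using inj_perp_line by (simp add: line_param_def line_params_def)

lemma line_measure_image:
  assumes "T \<in> sets borel" "T \<subseteq> line_params"
  shows "line_param ` T \<in> sets line_measure" "emeasure line_measure (line_param ` T) = emeasure lborel T"
proof -
  have sp: "space (lebesgue_on line_params) = line_params" by (simp add: space_restrict_space)
  have LP: "line_params \<inter> space lebesgue \<in> sets lebesgue" using sets_line_params by simp
  have T: "T \<in> sets (lebesgue_on line_params)"
    using assms sets_line_params by (auto simp: sets_restrict_space_iff[OF LP])
  then show S: "line_param ` T \<in> sets line_measure" unfolding line_measure_eq by (rule in_sets_embed_measure)
  have "line_param -` (line_param ` T) \<inter> line_params = T"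
    using assms(2) inj_line_param by (auto simp: inj_on_def)
  then have "emeasure line_measure (line_param ` T) = emeasure (lebesgue_on line_params) T"
    using S unfolding line_measure_eq by (subst emeasure_embed_measure') (simp_all add: sp inj_line_param)
  also have "\<dots> = emeasure lborel T"
    using assms LP by (subst emeasure_restrict_space) auto
  finally show "emeasure line_measure (line_param ` T) = emeasure lborel T" .
qed

lemma line_param_meets: "p \<in> line_params \<Longrightarrow> A \<inter> line_param p \<noteq> {} \<longleftrightarrow> p \<in> lines_meeting A"
  by (cases p) (auto simp: line_param_def line_params_def perp_line_eq lines_meeting_def)

lemma sets_lines_meeting_params:
  assumes "compact K" shows "lines_meeting K \<inter> line_params \<in> sets borel"
  using sets_lines_meeting[OF assms] sets_line_params by auto

text \<open>The intersection number is at least 1 on the lines that meet \<open>K\<close>.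
  Compactness of \<open>K\<close> makes this set of lines measurable, so that its indicator bounds
  the integral from below.\<close>

lemma integral_geometric_ge:
  assumes "compact K" "K \<subseteq> A"
  shows "emeasure lborel (lines_meeting K \<inter> line_params) \<le> integral_geometric A"
proof -
  define T where "T = lines_meeting K \<inter> line_params"
  have T: "T \<in> sets borel" "T \<subseteq> line_params" using sets_lines_meeting_params[OF assms(1)] by (auto simp: T_def)
  have "emeasure lborel T = (\<integral>\<^sup>+l. indicator (line_param ` T) l \<partial>line_measure)"
    using line_measure_image[OF T] by simp
  also have "\<dots> \<le> integral_geometric A" unfolding integral_geometric_def
  proof (rule nn_integral_mono)
    fix l
    show "indicator (line_param ` T) l \<le> emeasure (count_space UNIV) (A \<inter> l)"
    proof (cases "l \<in> line_param ` T")
      case True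
      then have "K \<inter> l \<noteq> {}" using line_param_meets by (auto simp: T_def)
      then obtain x where "{x} \<subseteq> A \<inter> l" using assms(2) by auto
      then have "emeasure (count_space UNIV) {x} \<le> emeasure (count_space UNIV) (A \<inter> l)"
        by (intro emeasure_mono) auto
      then show ?thesis using True by simp
    qed simp
  qed
  finally show ?thesis by (simp add: T_def)
qed

lemma integral_geometric_zero:
  assumes K: "compact K" and null: "emeasure lborel (lines_meeting K) = 0"
  shows "integral_geometric K = 0"
proof -
  define T where "T = lines_meeting K \<inter> line_params"
  have T: "T \<in> sets borel" "T \<subseteq> line_params" using sets_lines_meeting_params[OF K] by (auto simp: T_def)
  have "emeasure lborel T \<le> emeasure lborel (lines_meeting K)"
    using sets_lines_meeting[OF K] by (intro emeasure_mono) (auto simp: T_def)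
  then have "line_param ` T \<in> null_sets line_measure"
    using null line_measure_image[OF T] by (auto simp: null_sets_def)
  moreover have "{l \<in> space line_measure. \<not> K \<inter> l = {}} \<subseteq> line_param ` T"
  proof
    fix l assume l: "l \<in> {l \<in> space line_measure. \<not> K \<inter> l = {}}"
    then obtain p where "p \<in> line_params" "l = line_param p"
      unfolding line_measure_eq by (auto simp: space_embed_measure space_restrict_space)
    then show "l \<in> line_param ` T" using l line_param_meets[of p K] by (auto simp: T_def)
  qed
  ultimately have "AE l in line_measure. K \<inter> l = {}" by (rule AE_I')
  then have "AE l in line_measure. emeasure (count_space UNIV) (K \<inter> l) = 0"
    by eventually_elim simp
  then have "integral_geometric K = (\<integral>\<^sup>+l. 0 \<partial>line_measure)"
    unfolding integral_geometric_def by (rule nn_integral_cong_AE)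
  then show ?thesis by simp
qed

lemma section_lines_meeting: "\<theta> \<in> {0..pi} \<Longrightarrow> Pair \<theta> -` lines_meeting A = (\<lambda>x. x \<bullet> dir \<theta>) ` A"
  by (auto simp: lines_meeting_def)

lemma lines_meeting_null_imp:
  assumes K: "compact K" and null: "emeasure lborel (lines_meeting K) = 0"
  shows "AE \<theta> in lborel. \<theta> \<in> {0..pi} \<longrightarrow> emeasure lborel ((\<lambda>x. x \<bullet> dir \<theta>) ` K) = 0"
proof -
  have m: "(\<lambda>\<theta>. emeasure lborel (Pair \<theta> -` lines_meeting K)) \<in> borel_measurable lborel"
    using sets_lines_meeting[OF K] by (intro lborel.measurable_emeasure_Pair) (simp only: lborel_prod)
  have "AE \<theta> in lborel. emeasure lborel (Pair \<theta> -` lines_meeting K) = 0"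
    using null nn_integral_0_iff_AE[OF m] by (simp add: emeasure_plane[OF sets_lines_meeting[OF K]])
  then show ?thesis by eventually_elim (metis section_lines_meeting)
qed

lemma not_AE_False_directions: "\<not> (AE \<theta> in lborel. \<theta> \<notin> {0..<pi})"
proof
  assume "AE \<theta> in lborel. \<theta> \<notin> {0..<pi}"
  then have "emeasure lborel {0..<pi} = 0" by (subst (asm) AE_iff_measurable[of "{0..<pi}"]) auto
  then show False by (simp add: emeasure_lborel_Ico)
qed

lemma lines_meeting_pos:
  assumes K: "compact K"
    and pos: "AE \<theta> in lborel. \<theta> \<in> {0..pi} \<longrightarrow> emeasure lborel ((\<lambda>x. x \<bullet> dir \<theta>) ` K) > 0"
  shows "emeasure lborel (lines_meeting K \<inter> line_params) > 0"
proof (rule ccontr)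
  define T where "T = lines_meeting K \<inter> line_params"
  have T: "T \<in> sets lborel" using sets_lines_meeting_params[OF K] by (simp add: T_def)
  assume "\<not> ?thesis"
  then have "emeasure lborel T = 0" by (simp add: T_def)
  moreover have m: "(\<lambda>\<theta>. emeasure lborel (Pair \<theta> -` T)) \<in> borel_measurable lborel"
    using T by (intro lborel.measurable_emeasure_Pair) (simp only: lborel_prod)
  ultimately have "AE \<theta> in lborel. emeasure lborel (Pair \<theta> -` T) = 0"
    using nn_integral_0_iff_AE[OF m] by (simp add: emeasure_plane[OF T])
  then have "AE \<theta> in lborel. \<theta> \<notin> {0..<pi}" using pos
  proof eventually_elim
    case (elim \<theta>)
    have "Pair \<theta> -` T = (\<lambda>x. x \<bullet> dir \<theta>) ` K" if "\<theta> \<in> {0..<pi}"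
      using that by (auto simp: T_def lines_meeting_def line_params_def)
    then show ?case using elim by auto
  qed
  then show False using not_AE_False_directions by blast
qed

lemma AE_directions:
  "(AE \<theta> in lborel. \<theta> \<in> {0..<pi} \<longrightarrow> P \<theta>) \<Longrightarrow> AE \<theta> in lebesgue_on {0..<pi}. P \<theta>"
  by (subst AE_restrict_space_iff) (auto dest: AE_completion)

section \<open>Assembly of the two directions of the equivalences\<close>

context gauge
begin

lemma ex_visible_compact:
  assumes "summable (\<lambda>k. 2 ^ k * dyad k)" "A \<in> sets borel" "hausdorff \<phi> A > 0"
  obtains K where "compact K" "K \<subseteq> A"
    "AE \<theta> in lborel. \<theta> \<in> {0..pi} \<longrightarrow> emeasure lborel ((\<lambda>x. x \<bullet> dir \<theta>) ` K) > 0"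
proof -
  have "net_content dyad A > 0"
    using assms(3) hausdorff_zero_if_net_content_zero[of A] zero_less_iff_neq_zero by blast
  then obtain K where "compact K" "K \<subseteq> A" "net_content dyad K > 0"
    using net_content_compact_subset[OF assms(2)] by blast
  then show ?thesis using that projection_positive[OF _ dyad_pos assms(1)] by blast
qed

lemma summable_imp_projections_positive:
  assumes "summable (\<lambda>k. 2 ^ k * dyad k)" "A \<in> sets borel" "hausdorff \<phi> A > 0"
  shows "AE \<theta> in lebesgue_on {0..<pi}. L1_on_line \<theta> (proj \<theta> ` A) > 0"
proof (rule AE_directions)
  obtain K where K: "compact K" "K \<subseteq> A"
    "AE \<theta> in lborel. \<theta> \<in> {0..pi} \<longrightarrow> emeasure lborel ((\<lambda>x. x \<bullet> dir \<theta>) ` K) > 0"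
    using ex_visible_compact[OF assms] by blast
  have le: "emeasure lborel ((\<lambda>x. x \<bullet> dir \<theta>) ` K) \<le> L1_on_line \<theta> (proj \<theta> ` A)" for \<theta>
    unfolding L1_on_line_proj outer_measure_projection_compact[OF K(1), symmetric]
    using K(2) by (intro outer_measure_of_mono image_mono)
  from K(3) show "AE \<theta> in lborel. \<theta> \<in> {0..<pi} \<longrightarrow> L1_on_line \<theta> (proj \<theta> ` A) > 0"
    by eventually_elim (use less_le_trans[OF _ le] in auto)
qed

lemma summable_imp_absolutely_continuous:
  assumes "summable (\<lambda>k. 2 ^ k * dyad k)" "A \<in> sets borel" "integral_geometric A = 0"
  shows "hausdorff \<phi> A = 0"
proof (rule ccontr)
  assume "hausdorff \<phi> A \<noteq> 0"
  then have "hausdorff \<phi> A > 0" using zero_less_iff_neq_zero by blast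
  then obtain K where K: "compact K" "K \<subseteq> A"
    "AE \<theta> in lborel. \<theta> \<in> {0..pi} \<longrightarrow> emeasure lborel ((\<lambda>x. x \<bullet> dir \<theta>) ` K) > 0"
    using ex_visible_compact[OF assms(1,2)] by blast
  have "0 < emeasure lborel (lines_meeting K \<inter> line_params)" by (rule lines_meeting_pos[OF K(1,3)])
  also have "\<dots> \<le> integral_geometric A" by (rule integral_geometric_ge[OF K(1,2)])
  finally show False using assms(3) by simp
qed

text \<open>The invisible compact set refutes both (ii) and (iii): almost no line meets it, so its
  projection is null in almost every direction, and the directions in [0, pi) are not a null
  set.\<close>

lemma not_summable_imp_invisible:
  assumes "\<not> summable (\<lambda>k. 2 ^ k * dyad k)"
  obtains A :: "(real^2) set" where "A \<in> sets borel" "hausdorff \<phi> A > 0" "integral_geometric A = 0"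
    "\<not> (AE \<theta> in lebesgue_on {0..<pi}. L1_on_line \<theta> (proj \<theta> ` A) > 0)"
proof -
  interpret slow_weights dyad
    using dyad_pos dyad_antimono dyad_le_4_Suc assms by unfold_locales auto
  obtain A where A: "compact A" "net_content dyad A > 0" "emeasure lborel (lines_meeting A) = 0"
    using ex_invisible_set by blast
  have "hausdorff \<phi> A > 0"
    using A(2) net_content_zero_if_hausdorff_zero[of A] zero_less_iff_neq_zero by fastforce
  moreover have "\<not> (AE \<theta> in lebesgue_on {0..<pi}. L1_on_line \<theta> (proj \<theta> ` A) > 0)"
  proof
    assume "AE \<theta> in lebesgue_on {0..<pi}. L1_on_line \<theta> (proj \<theta> ` A) > 0"
    then have "AE \<theta> in lebesgue. \<theta> \<in> {0..<pi} \<longrightarrow> L1_on_line \<theta> (proj \<theta> ` A) > 0"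
      by (subst (asm) AE_restrict_space_iff) auto
    then have "AE \<theta> in lborel. \<theta> \<in> {0..<pi} \<longrightarrow> L1_on_line \<theta> (proj \<theta> ` A) > 0"
      by (simp add: AE_completion_iff)
    then have "AE \<theta> in lborel. \<theta> \<notin> {0..<pi}" using lines_meeting_null_imp[OF A(1,3)]
      by eventually_elim (auto simp: L1_on_line_proj outer_measure_projection_compact[OF A(1)])
    then show False using not_AE_False_directions by blast
  qed
  ultimately show ?thesis
    using that[of A] borel_compact[OF A(1)] integral_geometric_zero[OF A(1,3)] by blast
qed

end

theorem theorem1p1:
  fixes \<phi> :: "real \<Rightarrow> real"
  assumes pos: "\<And>r. r > 0 \<Longrightarrow> \<phi> r > 0"
    and incr: "mono_on {0<..} \<phi>"
    and decr: "antimono_on {0<..} (\<lambda>r. \<phi> r / r\<^sup>2)"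
  shows "((\<integral>\<^sup>+ r\<in>{0<..1}. ennreal (\<phi> r / r\<^sup>2) \<partial>lborel) < \<infinity>
            \<longleftrightarrow> (\<forall>A\<in>sets (borel :: (real^2) measure). hausdorff \<phi> A > 0 \<longrightarrow>
                  (AE \<theta> in lebesgue_on {0..<pi}. L1_on_line \<theta> (proj \<theta> ` A) > 0)))
       \<and> ((\<integral>\<^sup>+ r\<in>{0<..1}. ennreal (\<phi> r / r\<^sup>2) \<partial>lborel) < \<infinity>
            \<longleftrightarrow> (\<forall>A\<in>sets (borel :: (real^2) measure).
                  integral_geometric A = 0 \<longrightarrow> hausdorff \<phi> A = 0))"
proof -
  interpret gauge \<phi> using assms by unfold_locales auto
  show ?thesis
  proof (cases "summable (\<lambda>k. 2 ^ k * dyad k)")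
    case True
    then show ?thesis unfolding integral_finite_iff_summable
      using summable_imp_projections_positive summable_imp_absolutely_continuous by blast
  next
    case False
    then obtain A :: "(real^2) set" where A: "A \<in> sets borel" "hausdorff \<phi> A > 0" "integral_geometric A = 0"
      "\<not> (AE \<theta> in lebesgue_on {0..<pi}. L1_on_line \<theta> (proj \<theta> ` A) > 0)"
      by (rule not_summable_imp_invisible)
    have "hausdorff \<phi> A \<noteq> 0" using A(2) by simp
    with A False show ?thesis unfolding integral_finite_iff_summable by blast
  qed
qed

end
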